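(* Let $M=[0,t_{\max})\times\mathbb{R}^3$ with coordinates $(x^0=t,x^1,x^2,x^3)$ carry a globally hyperbolic Lorentzian metric $g^\ddagger$ of signature $(-,+,+,+)$, foliated by the spacelike Cauchy hypersurfaces $M_t=\{x^0=t\}$, together with a symmetric two-tensor $T$ and a scalar field $\varrho$ (all sufficiently regular). Set $g_{\alpha\beta}:=e^{-2\varrho}g^\ddagger_{\alpha\beta}$, with scalar curvature $R_g$, and denote by $\mathrm{tr}$ the trace with respect to $g$. Assume that in $M$ $$g^{\ddagger\alpha'\beta'}\partial_{\alpha'}\partial_{\beta'}g^\ddagger_{\alpha\beta}=F_{\alpha\beta}(g^\ddagger;\partial g^\ddagger,\partial g^\ddagger)-12\,\partial_\alpha\varrho\,\partial_\beta\varrho+\frac{W_2(\varrho)}{e^{2\varrho}}g^\ddagger_{\alpha\beta}-\frac{16\pi}{e^{2\varrho}}\big(T_{\alpha\beta}-\tfrac12g_{\alpha\beta}\mathrm{tr}(T)\big),$$ $$\nabla^{\ddagger\alpha}T_{\alpha\beta}=e^{-2\varrho}\big(2g^{\delta\gamma}\partial_\gamma\varrho\,T_{\delta\beta}-\mathrm{tr}(T)\,\partial_\beta\varrho\big),$$ $$g^{\ddagger\alpha'\beta'}\partial_{\alpha'}\partial_{\beta'}\varrho=\frac{W_2(\varrho)}{6e^{2\varrho}}+\frac{f(\theta(\varrho))}{6e^{4\varrho}}+\frac{4\pi\,\mathrm{tr}(T)}{3e^{4\varrho}} .$$ Assume also that on the slice $\{x^0=0\}$ the Hamiltonian and momentum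 constraints $N^\ddagger_{00}=8\pi T_{00}$, $N^\ddagger_{0j}=8\pi T_{0j}$ $(j=1,2,3)$ hold (components in the Cauchy adapted frame) together with $$g^{\ddagger\alpha\beta}\Gamma^{\ddagger\gamma}_{\alpha\beta}=0\qquad(\gamma=0,\dots,3).$$ Then $g^{\ddagger\alpha\beta}\Gamma^{\ddagger\gamma}_{\alpha\beta}=0$ in all of $M$. Furthermore, in $M$, $$\varrho=\tfrac12\ln f'(R_g),$$ so that $(g^\ddagger,T,\varrho)$ is also a solution of the conformal field equations of modified gravity $$e^{2\varrho}R^\ddagger_{\alpha\beta}-6e^{2\varrho}\partial_\alpha\varrho\,\partial_\beta\varrho+\tfrac12g^\ddagger_{\alpha\beta}W_2(\varrho)=8\pi\big(T_{\alpha\beta}-\tfrac12g_{\alpha\beta}\mathrm{tr}(T)\big).$$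
   Context: $f$ is a given smooth function with $f'>0$ and $f''>0$ on an interval $I$ around $0$; $\theta$ denotes the inverse of the map $s(r)=\frac12\ln f'(r)$ on $I$, and all values of $\varrho$ are assumed to lie in $s(I)$. $W_2$ is defined by $W_2(s)=\frac{f(r)-rf'(r)}{f'(r)}$ where $e^{2s}=f'(r)$, i.e. $r=\theta(s)$. $\nabla^\ddagger$, $R^\ddagger_{\alpha\beta}$, $\Gamma^{\ddagger\gamma}_{\alpha\beta}$ are the connection, Ricci tensor and Christoffel symbols of $g^\ddagger$; in $\nabla^{\ddagger\alpha}$ the index is raised with $g^\ddagger$. $F_{\alpha\beta}$ is the expression, quadratic in first derivatives, determined by the identity (valid for any metric $g$) $R_{\alpha\beta}=-\frac12g^{\alpha'\beta'}\partial_{\alpha'}\partial_{\beta'}g_{\alpha\beta}+\frac12(\partial_\alpha\Gamma_\beta+\partial_\beta\Gamma_\alpha)+\frac12F_{\alpha\beta}(g;\partial g,\partial g)$, with $\Gamma_\lambda=g_{\lambda\lambda'}g^{\alpha\beta}\Gamma^{\lambda'}_{\alpha\beta}$. The tensor $N^\ddagger$ is defined by $N^\ddagger_{\alpha\beta}-\frac12g_{\alpha\beta}\mathrm{tr}(N^\ddagger)=e^{2\varrho}R^\ddagger_{\alpha\beta}-6e^{2\varrho}\partial_\alpha\varrho\partial_\beta\varrho+\frac12g^\ddagger_{\alpha\beta}W_2(\varrho)$. Cauchy adapted frame: $e_i=\partial_i$ $(i=1,2,3)$ and $e_0=\partial_t-\beta^i\partial_i$, with $\beta^i$ chosen so that $e_0$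 is orthogonal to the slices $M_t$. Solutions of linear wave equations on $M$ are assumed to be uniquely determined by their Cauchy data on $M_0$ (global hyperbolicity). *)

theory Defs
  imports "HOL-Analysis.Analysis"
begin

text \<open>
  Points of space-time are elements of \<^typ>\<open>real^4\<close>. The index type \<^typ>\<open>4\<close> has the elements
  0, 1, 2, 3; component 0 is the time coordinate. The components of a covariant 2-tensor field
  \<open>S\<close> are \<open>S x $ \<alpha> $ \<beta>\<close>, those of the inverse metric \<open>matrix_inv (g x) $ \<alpha> $ \<beta>\<close>.
\<close>

definition slab :: "ereal \<Rightarrow> (real^4) set" where
  "slab t_max = {x. 0 \<le> x $ 0 \<and> ereal (x $ 0) < t_max}"

definition slice :: "real \<Rightarrow> (real^4) set" where
  "slice t = {x. x $ 0 = t}"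

text \<open>
  The derivative is taken within the domain, so that on the boundary \<open>x $ 0 = 0\<close> of a slab the
  time derivative is one-sided.
\<close>

definition pd :: "(real^4) set \<Rightarrow> 4 \<Rightarrow> (real^4 \<Rightarrow> real) \<Rightarrow> real^4 \<Rightarrow> real" where
  "pd M \<alpha> u x = frechet_derivative u (at x within M) (axis \<alpha> 1)"

primrec Ck_on :: "nat \<Rightarrow> (real^4) set \<Rightarrow> (real^4 \<Rightarrow> real) \<Rightarrow> bool" where
  "Ck_on 0 M u = continuous_on M u"
| "Ck_on (Suc k) M u = (u differentiable_on M \<and> (\<forall>\<alpha>. Ck_on k M (pd M \<alpha> u)))"

definition tensor_Ck_on :: "nat \<Rightarrow> (real^4) set \<Rightarrow> (real^4 \<Rightarrow> real^4^4) \<Rightarrow> bool" where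
  "tensor_Ck_on k M S \<longleftrightarrow> (\<forall>\<alpha> \<beta>. Ck_on k M (\<lambda>x. S x $ \<alpha> $ \<beta>))"

definition bil :: "real^4^4 \<Rightarrow> real^4 \<Rightarrow> real^4 \<Rightarrow> real" where
  "bil A v w = (\<Sum>\<alpha>\<in>UNIV. \<Sum>\<beta>\<in>UNIV. A $ \<alpha> $ \<beta> * v $ \<alpha> * w $ \<beta>)"

definition lorentzian :: "real^4^4 \<Rightarrow> bool" where
  "lorentzian A \<longleftrightarrow> transpose A = A \<and>
     (\<exists>P :: real^4^4. invertible P \<and>
        transpose P ** A ** P = (\<chi> \<alpha> \<beta>. if \<alpha> = \<beta> then (if \<alpha> = 0 then -1 else 1) else 0))"


subsection \<open>Causality\<close>

definition spacelike_slice :: "(real^4 \<Rightarrow> real^4^4) \<Rightarrow> real \<Rightarrow> bool" where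
  "spacelike_slice g t \<longleftrightarrow> (\<forall>x\<in>slice t. \<forall>v. v $ 0 = 0 \<and> v \<noteq> 0 \<longrightarrow> bil (g x) v v > 0)"

text \<open>
  Time orientation by increasing \<open>x $ 0\<close>. When the slices are spacelike, no causal vector has
  vanishing time component, so up to reversing the parameter every C1 causal curve is of this form.
\<close>

definition causal_curve ::
  "(real^4) set \<Rightarrow> (real^4 \<Rightarrow> real^4^4) \<Rightarrow> real set \<Rightarrow> (real \<Rightarrow> real^4) \<Rightarrow> bool" where
  "causal_curve M g J c \<longleftrightarrow> is_interval J \<and> J \<noteq> {} \<and> c ` J \<subseteq> M \<and>
     (\<exists>c'. continuous_on J c' \<and>
        (\<forall>s\<in>J. (c has_vector_derivative c' s) (at s within J) \<and>
           bil (g (c s)) (c' s) (c' s) \<le> 0 \<and> c' s $ 0 > 0))"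

definition future_endpoint :: "real set \<Rightarrow> (real \<Rightarrow> real^4) \<Rightarrow> real^4 \<Rightarrow> bool" where
  "future_endpoint J c p \<longleftrightarrow>
     (\<forall>U. open U \<and> p \<in> U \<longrightarrow> (\<exists>s\<in>J. \<forall>s'\<in>J. s \<le> s' \<longrightarrow> c s' \<in> U))"

definition past_endpoint :: "real set \<Rightarrow> (real \<Rightarrow> real^4) \<Rightarrow> real^4 \<Rightarrow> bool" where
  "past_endpoint J c p \<longleftrightarrow>
     (\<forall>U. open U \<and> p \<in> U \<longrightarrow> (\<exists>s\<in>J. \<forall>s'\<in>J. s' \<le> s \<longrightarrow> c s' \<in> U))"

text \<open>
  The manifold \<open>M = slab t_max\<close> has the boundary \<open>slice 0\<close>. A curve that starts on this boundary
  cannot be prolonged to the past within \<open>M\<close>; any other curve with an endpoint in \<open>M\<close> can be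
  prolonged.
\<close>

definition inextendible_causal_curve ::
  "(real^4) set \<Rightarrow> (real^4 \<Rightarrow> real^4^4) \<Rightarrow> real set \<Rightarrow> (real \<Rightarrow> real^4) \<Rightarrow> bool" where
  "inextendible_causal_curve M g J c \<longleftrightarrow> causal_curve M g J c \<and>
     \<not> (\<exists>p\<in>M. future_endpoint J c p) \<and>
     (\<forall>p\<in>M. past_endpoint J c p \<longrightarrow> p \<in> slice 0 \<and> (\<exists>s\<in>J. (\<forall>s'\<in>J. s \<le> s') \<and> c s = p))"

definition cauchy_hypersurface ::
  "(real^4) set \<Rightarrow> (real^4 \<Rightarrow> real^4^4) \<Rightarrow> (real^4) set \<Rightarrow> bool" where
  "cauchy_hypersurface M g S \<longleftrightarrow>
     S \<subseteq> M \<and> (\<forall>J c. inextendible_causal_curve M g J c \<longrightarrow> (\<exists>!s. s \<in> J \<and> c s \<in> S))"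

definition globally_hyperbolic :: "(real^4) set \<Rightarrow> (real^4 \<Rightarrow> real^4^4) \<Rightarrow> bool" where
  "globally_hyperbolic M g \<longleftrightarrow> (\<exists>S. cauchy_hypersurface M g S)"

text \<open>
  Linear systems of \<open>m\<close> second order equations with principal part \<open>g\<^sup>\<alpha>\<^sup>\<beta> \<partial>\<^sub>\<alpha> \<partial>\<^sub>\<beta>\<close> acting on each
  component and continuous lower order coefficients \<open>A\<close>, \<open>B\<close>.
\<close>

definition linear_wave_solution ::
  "(real^4) set \<Rightarrow> (real^4 \<Rightarrow> real^4^4) \<Rightarrow> nat \<Rightarrow> (nat \<Rightarrow> nat \<Rightarrow> 4 \<Rightarrow> real^4 \<Rightarrow> real) \<Rightarrow>
   (nat \<Rightarrow> nat \<Rightarrow> real^4 \<Rightarrow> real) \<Rightarrow> (nat \<Rightarrow> real^4 \<Rightarrow> real) \<Rightarrow> (nat \<Rightarrow> real^4 \<Rightarrow> real) \<Rightarrow> bool" where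
  "linear_wave_solution M g m A B h u \<longleftrightarrow> (\<forall>i<m. Ck_on 2 M (u i) \<and>
     (\<forall>x\<in>M. (\<Sum>\<alpha>\<in>UNIV. \<Sum>\<beta>\<in>UNIV. matrix_inv (g x) $ \<alpha> $ \<beta> * pd M \<alpha> (pd M \<beta> (u i)) x)
        + (\<Sum>j<m. \<Sum>\<alpha>\<in>UNIV. A i j \<alpha> x * pd M \<alpha> (u j) x) + (\<Sum>j<m. B i j x * u j x) = h i x))"

definition linear_wave_uniqueness :: "(real^4) set \<Rightarrow> (real^4 \<Rightarrow> real^4^4) \<Rightarrow> bool" where
  "linear_wave_uniqueness M g \<longleftrightarrow> (\<forall>m A B h u v.
     (\<forall>i<m. \<forall>j<m. continuous_on M (B i j) \<and> (\<forall>\<alpha>. continuous_on M (A i j \<alpha>))) \<and>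
     linear_wave_solution M g m A B h u \<and> linear_wave_solution M g m A B h v \<and>
     (\<forall>i<m. \<forall>x\<in>slice 0. u i x = v i x \<and> pd M 0 (u i) x = pd M 0 (v i) x)
     \<longrightarrow> (\<forall>i<m. \<forall>x\<in>M. u i x = v i x))"


subsection \<open>Curvature in coordinates\<close>

definition christoffel ::
  "(real^4) set \<Rightarrow> (real^4 \<Rightarrow> real^4^4) \<Rightarrow> 4 \<Rightarrow> 4 \<Rightarrow> 4 \<Rightarrow> real^4 \<Rightarrow> real" where
  "christoffel M g \<gamma> \<alpha> \<beta> x = (\<Sum>\<delta>\<in>UNIV. matrix_inv (g x) $ \<gamma> $ \<delta> / 2 *
     (pd M \<alpha> (\<lambda>y. g y $ \<beta> $ \<delta>) x + pd M \<beta> (\<lambda>y. g y $ \<alpha> $ \<delta>) x - pd M \<delta> (\<lambda>y. g y $ \<alpha> $ \<beta>) x))"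

definition ricci ::
  "(real^4) set \<Rightarrow> (real^4 \<Rightarrow> real^4^4) \<Rightarrow> 4 \<Rightarrow> 4 \<Rightarrow> real^4 \<Rightarrow> real" where
  "ricci M g \<alpha> \<beta> x =
     (\<Sum>\<gamma>\<in>UNIV. pd M \<gamma> (christoffel M g \<gamma> \<alpha> \<beta>) x) - (\<Sum>\<gamma>\<in>UNIV. pd M \<alpha> (christoffel M g \<gamma> \<beta> \<gamma>) x)
     + (\<Sum>\<gamma>\<in>UNIV. \<Sum>\<delta>\<in>UNIV. christoffel M g \<gamma> \<alpha> \<beta> x * christoffel M g \<delta> \<gamma> \<delta> x
          - christoffel M g \<gamma> \<alpha> \<delta> x * christoffel M g \<delta> \<beta> \<gamma> x)"

definition tr :: "real^4^4 \<Rightarrow> real^4^4 \<Rightarrow> real" where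
  "tr A S = (\<Sum>\<alpha>\<in>UNIV. \<Sum>\<beta>\<in>UNIV. matrix_inv A $ \<alpha> $ \<beta> * S $ \<alpha> $ \<beta>)"

definition scalar_curvature :: "(real^4) set \<Rightarrow> (real^4 \<Rightarrow> real^4^4) \<Rightarrow> real^4 \<Rightarrow> real" where
  "scalar_curvature M g x = tr (g x) (\<chi> \<alpha> \<beta>. ricci M g \<alpha> \<beta> x)"

definition covd2 :: "(real^4) set \<Rightarrow> (real^4 \<Rightarrow> real^4^4) \<Rightarrow> (real^4 \<Rightarrow> real^4^4) \<Rightarrow>
    4 \<Rightarrow> 4 \<Rightarrow> 4 \<Rightarrow> real^4 \<Rightarrow> real" where
  "covd2 M g S \<gamma> \<alpha> \<beta> x = pd M \<gamma> (\<lambda>y. S y $ \<alpha> $ \<beta>) x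
     - (\<Sum>\<delta>\<in>UNIV. christoffel M g \<delta> \<gamma> \<alpha> x * S x $ \<delta> $ \<beta>)
     - (\<Sum>\<delta>\<in>UNIV. christoffel M g \<delta> \<gamma> \<beta> x * S x $ \<alpha> $ \<delta>)"

definition divergence :: "(real^4) set \<Rightarrow> (real^4 \<Rightarrow> real^4^4) \<Rightarrow> (real^4 \<Rightarrow> real^4^4) \<Rightarrow>
    4 \<Rightarrow> real^4 \<Rightarrow> real" where
  "divergence M g S \<beta> x =
     (\<Sum>\<alpha>\<in>UNIV. \<Sum>\<gamma>\<in>UNIV. matrix_inv (g x) $ \<alpha> $ \<gamma> * covd2 M g S \<gamma> \<alpha> \<beta> x)"

definition wave_gauge :: "(real^4) set \<Rightarrow> (real^4 \<Rightarrow> real^4^4) \<Rightarrow> 4 \<Rightarrow> real^4 \<Rightarrow> real" where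
  "wave_gauge M g \<gamma> x =
     (\<Sum>\<alpha>\<in>UNIV. \<Sum>\<beta>\<in>UNIV. matrix_inv (g x) $ \<alpha> $ \<beta> * christoffel M g \<gamma> \<alpha> \<beta> x)"

definition wave_gauge_low :: "(real^4) set \<Rightarrow> (real^4 \<Rightarrow> real^4^4) \<Rightarrow> 4 \<Rightarrow> real^4 \<Rightarrow> real" where
  "wave_gauge_low M g \<gamma> x = (\<Sum>\<delta>\<in>UNIV. g x $ \<gamma> $ \<delta> * wave_gauge M g \<delta> x)"

definition reduced_wave :: "(real^4) set \<Rightarrow> (real^4 \<Rightarrow> real^4^4) \<Rightarrow> (real^4 \<Rightarrow> real) \<Rightarrow> real^4 \<Rightarrow> real" where
  "reduced_wave M g u x =
     (\<Sum>\<alpha>\<in>UNIV. \<Sum>\<beta>\<in>UNIV. matrix_inv (g x) $ \<alpha> $ \<beta> * pd M \<alpha> (pd M \<beta> u) x)"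


subsection \<open>The quadratic part of the Ricci tensor\<close>

text \<open>
  \<open>F\<^sub>\<alpha>\<^sub>\<beta>(A; D, D)\<close> at a point, for the metric components \<open>A\<close> and their first derivatives
  \<open>D \<gamma> \<alpha> \<beta> = \<partial>\<^sub>\<gamma> g\<^sub>\<alpha>\<^sub>\<beta>\<close>; \<open>chris_low D \<sigma> \<alpha> \<beta>\<close> is \<open>g\<^sub>\<sigma>\<^sub>\<delta> \<Gamma>\<^sup>\<delta>\<^sub>\<alpha>\<^sub>\<beta>\<close>. The formula is justified by the lemma
  \<open>ricci_wave_decomposition\<close> below.
\<close>

definition chris_low :: "(4 \<Rightarrow> 4 \<Rightarrow> 4 \<Rightarrow> real) \<Rightarrow> 4 \<Rightarrow> 4 \<Rightarrow> 4 \<Rightarrow> real" where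
  "chris_low D \<sigma> \<alpha> \<beta> = (D \<alpha> \<beta> \<sigma> + D \<beta> \<alpha> \<sigma> - D \<sigma> \<alpha> \<beta>) / 2"

definition F_quad :: "real^4^4 \<Rightarrow> (4 \<Rightarrow> 4 \<Rightarrow> 4 \<Rightarrow> real) \<Rightarrow> 4 \<Rightarrow> 4 \<Rightarrow> real" where
  "F_quad A D \<alpha> \<beta> =
     (\<Sum>\<sigma>\<in>UNIV. \<Sum>\<mu>\<in>UNIV. \<Sum>\<delta>\<in>UNIV. \<Sum>\<nu>\<in>UNIV. matrix_inv A $ \<sigma> $ \<mu> * matrix_inv A $ \<delta> $ \<nu> *
        (2 * chris_low D \<mu> \<alpha> \<beta> * chris_low D \<nu> \<sigma> \<delta> - 2 * chris_low D \<mu> \<alpha> \<delta> * chris_low D \<nu> \<beta> \<sigma>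
         - 2 * D \<sigma> \<mu> \<nu> * chris_low D \<delta> \<alpha> \<beta> + D \<alpha> \<mu> \<nu> * D \<sigma> \<beta> \<delta> + D \<beta> \<mu> \<nu> * D \<sigma> \<alpha> \<delta>))"

definition F_field :: "(real^4) set \<Rightarrow> (real^4 \<Rightarrow> real^4^4) \<Rightarrow> 4 \<Rightarrow> 4 \<Rightarrow> real^4 \<Rightarrow> real" where
  "F_field M g \<alpha> \<beta> x = F_quad (g x) (\<lambda>\<gamma> \<mu> \<nu>. pd M \<gamma> (\<lambda>y. g y $ \<mu> $ \<nu>) x) \<alpha> \<beta>"

lemma pd_has_derivative:
  assumes "open U" "x \<in> U" "(u has_derivative u') (at x)"
  shows "pd U \<alpha> u x = u' (axis \<alpha> 1)"
  unfolding pd_def at_within_open[OF assms(2,1)] frechet_derivative_at[OF assms(3), symmetric] ..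

lemma pd_has_derivative_frechet:
  assumes "open U" "x \<in> U" "u differentiable_on U"
  shows "(u has_derivative frechet_derivative u (at x)) (at x)" "pd U \<alpha> u x = frechet_derivative u (at x) (axis \<alpha> 1)"
proof -
  have "u differentiable (at x)"
    using assms by (metis at_within_open differentiable_on_def)
  then show "(u has_derivative frechet_derivative u (at x)) (at x)"
    by (simp add: frechet_derivative_works)
  show "pd U \<alpha> u x = frechet_derivative u (at x) (axis \<alpha> 1)"
    unfolding pd_def at_within_open[OF assms(2,1)] ..
qed

lemma pd_mult:
  assumes "open U" "x \<in> U" "u differentiable_on U" "v differentiable_on U"
  shows "pd U \<alpha> (\<lambda>y. u y * v y) x = pd U \<alpha> u x * v x + u x * pd U \<alpha> v x"
  using pd_has_derivative[OF assms(1,2) has_derivative_mult[OF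
        pd_has_derivative_frechet(1)[OF assms(1-3)] pd_has_derivative_frechet(1)[OF assms(1,2,4)]]]
    pd_has_derivative_frechet(2)[OF assms(1-3)] pd_has_derivative_frechet(2)[OF assms(1,2,4)]
  by simp

lemma pd_add:
  assumes "open U" "x \<in> U" "u differentiable_on U" "v differentiable_on U"
  shows "pd U \<alpha> (\<lambda>y. u y + v y) x = pd U \<alpha> u x + pd U \<alpha> v x"
  using pd_has_derivative[OF assms(1,2) has_derivative_add[OF
        pd_has_derivative_frechet(1)[OF assms(1-3)] pd_has_derivative_frechet(1)[OF assms(1,2,4)]]]
    pd_has_derivative_frechet(2)[OF assms(1-3)] pd_has_derivative_frechet(2)[OF assms(1,2,4)]
  by simp

lemma pd_diff:
  assumes "open U" "x \<in> U" "u differentiable_on U" "v differentiable_on U"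
  shows "pd U \<alpha> (\<lambda>y. u y - v y) x = pd U \<alpha> u x - pd U \<alpha> v x"
  using pd_has_derivative[OF assms(1,2) has_derivative_diff[OF
        pd_has_derivative_frechet(1)[OF assms(1-3)] pd_has_derivative_frechet(1)[OF assms(1,2,4)]]]
    pd_has_derivative_frechet(2)[OF assms(1-3)] pd_has_derivative_frechet(2)[OF assms(1,2,4)]
  by simp

lemma pd_sum:
  fixes u :: "4 \<Rightarrow> real^4 \<Rightarrow> real"
  assumes "open U" "x \<in> U" "\<And>i. u i differentiable_on U"
  shows "pd U \<alpha> (\<lambda>y. \<Sum>i\<in>UNIV. u i y) x = (\<Sum>i\<in>UNIV. pd U \<alpha> (u i) x)"
  using pd_has_derivative[OF assms(1,2) has_derivative_sum[of UNIV u, OF 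
        pd_has_derivative_frechet(1)[OF assms]]]
    pd_has_derivative_frechet(2)[OF assms]
  by simp

lemma pd_cong:
  assumes "open U" "x \<in> U" "u differentiable_on U" "\<And>y. y \<in> U \<Longrightarrow> v y = u y"
  shows "pd U \<alpha> v x = pd U \<alpha> u x"
proof -
  have "(v has_derivative frechet_derivative u (at x)) (at x)"
    by (rule has_derivative_transform_within_open[OF pd_has_derivative_frechet(1)[OF assms(1-3)] assms(1,2)])
      (simp add: assms(4))
  from pd_has_derivative[OF assms(1,2) this] pd_has_derivative_frechet(2)[OF assms(1-3)] show ?thesis by simp
qed

lemma differentiable_on_sum_UNIV:
  fixes u :: "'i::finite \<Rightarrow> real^4 \<Rightarrow> real"
  assumes "\<And>i. u i differentiable_on U"
  shows "(\<lambda>y. \<Sum>i\<in>UNIV. u i y) differentiable_on U"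
  using assms by (auto simp: differentiable_on_def)

lemma differentiable_on_prod_set:
  fixes u :: "'i \<Rightarrow> real^4 \<Rightarrow> real"
  assumes "finite S" "\<And>i. i \<in> S \<Longrightarrow> u i differentiable_on U"
  shows "(\<lambda>y. \<Prod>i\<in>S. u i y) differentiable_on U"
  using assms by (induction S) auto

lemma differentiable_on_det:
  fixes A :: "real^4 \<Rightarrow> real^'n^'n"
  assumes "\<And>i j. (\<lambda>y. A y $ i $ j) differentiable_on U"
  shows "(\<lambda>y. det (A y)) differentiable_on U"
proof -
  have "(\<lambda>y. of_int (sign p) * (\<Prod>i\<in>UNIV. A y $ i $ p i)) differentiable_on U" for p :: "'n \<Rightarrow> 'n"
    by (intro differentiable_on_mult differentiable_on_const differentiable_on_prod_set assms) simp
  then show ?thesis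
    unfolding det_def by (auto simp: differentiable_on_def intro!: differentiable_sum)
qed

lemma matrix_inv_props:
  fixes A :: "real^4^4"
  assumes "invertible A"
  shows "A ** matrix_inv A = mat 1" "matrix_inv A ** A = mat 1"
  using someI_ex[OF assms[unfolded invertible_def]] unfolding matrix_inv_def by auto

lemma matrix_inv_mult:
  fixes A :: "real^4^4"
  assumes "invertible A"
  shows "(\<Sum>k\<in>UNIV. matrix_inv A $ i $ k * A $ k $ j) = (if i = j then 1 else 0)"
    and "(\<Sum>k\<in>UNIV. A $ i $ k * matrix_inv A $ k $ j) = (if i = j then 1 else 0)"
  using matrix_inv_props(2)[OF assms] matrix_inv_props(1)[OF assms]
  by (auto simp: matrix_matrix_mult_def mat_def vec_eq_iff)

lemma matrix_inv_sym:
  fixes A :: "real^4^4"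
  assumes "invertible A" "transpose A = A"
  shows "matrix_inv A $ i $ j = matrix_inv A $ j $ i"
proof -
  let ?B = "matrix_inv A"
  have "transpose ?B ** A = transpose ?B ** transpose A"
    by (simp only: assms(2))
  also have "\<dots> = mat 1"
    unfolding matrix_transpose_mul[symmetric] matrix_inv_props(1)[OF assms(1)] by (rule transpose_mat)
  finally have "transpose ?B ** A ** ?B = ?B"
    by (simp only: matrix_mul_lid)
  then have "transpose ?B = ?B"
    unfolding matrix_mul_assoc[symmetric] matrix_inv_props(1)[OF assms(1)] by (simp only: matrix_mul_rid)
  then have "transpose (matrix_inv A) $ i $ j = matrix_inv A $ i $ j"
    by (simp only:)
  then show ?thesis by (simp add: transpose_def)
qed

lemma differentiable_on_matrix_inv:
  fixes g :: "real^4 \<Rightarrow> real^4^4"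
  assumes diff: "\<And>i j. (\<lambda>y. g y $ i $ j) differentiable_on U"
    and inv: "\<And>y. y \<in> U \<Longrightarrow> invertible (g y)"
  shows "(\<lambda>y. matrix_inv (g y) $ k $ j) differentiable_on U"
proof -
  let ?B = "\<lambda>y. (\<chi> i l. if l = k then axis j 1 $ i else g y $ i $ l) :: real^4^4"
  have eq: "matrix_inv (g y) $ k $ j = det (?B y) / det (g y)" if "y \<in> U" for y
  proof -
    have "g y *v (matrix_inv (g y) *v axis j 1) = axis j 1"
      by (simp add: matrix_vector_mul_assoc matrix_inv_props(1) inv that)
    then have "matrix_inv (g y) *v axis j 1 =
      (\<chi> k. det (\<chi> i l. if l = k then axis j 1 $ i else g y $ i $ l) / det (g y))"
      using cramer[of "g y"] inv[OF that] by (auto simp: invertible_det_nz)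
    then have "(matrix_inv (g y) *v axis j 1) $ k = det (?B y) / det (g y)"
      by simp
    then show ?thesis
      by (simp add: matrix_vector_mul_component inner_axis)
  qed
  have "(\<lambda>y. ?B y $ i $ l) differentiable_on U" for i l
    using diff by (cases "l = k") simp_all
  then have "(\<lambda>y. det (?B y) * inverse (det (g y))) differentiable_on U"
    by (intro differentiable_on_mult differentiable_on_inverse differentiable_on_det diff)
      (use inv in \<open>auto simp: invertible_det_nz\<close>)
  then have "(\<lambda>y. det (?B y) * inverse (det (g y))) differentiable (at y within U)" if "y \<in> U" for y
    using that unfolding differentiable_on_def by blast
  then show ?thesis
    unfolding differentiable_on_def
    by (intro ballI, rule differentiable_transform_within[OF _ zero_less_one])
      (simp_all only: eq divide_inverse)
qed

lemma pd_matrix_inv: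
  fixes g :: "real^4 \<Rightarrow> real^4^4"
  assumes U: "open U" "x \<in> U"
    and diff: "\<And>i j. (\<lambda>y. g y $ i $ j) differentiable_on U"
    and inv: "\<And>y. y \<in> U \<Longrightarrow> invertible (g y)"
  shows "pd U \<gamma> (\<lambda>y. matrix_inv (g y) $ a $ b) x =
    - (\<Sum>i\<in>UNIV. \<Sum>j\<in>UNIV. matrix_inv (g x) $ a $ i * pd U \<gamma> (\<lambda>y. g y $ i $ j) x * matrix_inv (g x) $ j $ b)"
proof -
  let ?h = "\<lambda>a b y. matrix_inv (g y) $ a $ b"
  note dh = differentiable_on_matrix_inv[OF diff inv]
  have 1: "(\<Sum>k\<in>UNIV. pd U \<gamma> (?h a k) x * g x $ k $ j) = - (\<Sum>k\<in>UNIV. ?h a k x * pd U \<gamma> (\<lambda>y. g y $ k $ j) x)" for j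
  proof -
    have "0 = pd U \<gamma> (\<lambda>y. \<Sum>k\<in>UNIV. ?h a k y * g y $ k $ j) x"
    proof -
      have "pd U \<gamma> (\<lambda>y. \<Sum>k\<in>UNIV. ?h a k y * g y $ k $ j) x = pd U \<gamma> (\<lambda>y. if a = j then 1 else 0) x"
        by (rule pd_cong[OF U]) (auto simp: matrix_inv_mult inv)
      also have "\<dots> = 0"
        by (rule pd_has_derivative[OF U, where u' = "\<lambda>_. 0"]) simp
      finally show ?thesis by simp
    qed
    also have "\<dots> = (\<Sum>k\<in>UNIV. pd U \<gamma> (?h a k) x * g x $ k $ j + ?h a k x * pd U \<gamma> (\<lambda>y. g y $ k $ j) x)"
      by (subst pd_sum[OF U]) (auto simp: pd_mult[OF U] dh diff)
    finally show ?thesis by (simp add: sum.distrib)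
  qed
  have "pd U \<gamma> (?h a b) x = (\<Sum>k\<in>UNIV. pd U \<gamma> (?h a k) x * (\<Sum>j\<in>UNIV. g x $ k $ j * ?h j b x))"
    by (simp add: matrix_inv_mult inv U if_distrib[of "\<lambda>t. _ * t"] cong: if_cong)
  also have "\<dots> = (\<Sum>j\<in>UNIV. (\<Sum>k\<in>UNIV. pd U \<gamma> (?h a k) x * g x $ k $ j) * ?h j b x)"
    unfolding sum_distrib_left sum_distrib_right by (subst sum.swap) (simp add: mult.assoc)
  also have "\<dots> = (\<Sum>j\<in>UNIV. \<Sum>i\<in>UNIV. - (?h a i x * pd U \<gamma> (\<lambda>y. g y $ i $ j) x * ?h j b x))"
    unfolding 1 by (simp add: sum_distrib_right sum_negf)
  also have "\<dots> = - (\<Sum>i\<in>UNIV. \<Sum>j\<in>UNIV. ?h a i x * pd U \<gamma> (\<lambda>y. g y $ i $ j) x * ?h j b x)"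
    by (subst sum.swap) (simp add: sum_negf)
  finally show ?thesis .
qed


lemma pd_line:
  assumes "open U" "x + t *\<^sub>R axis a 1 \<in> U" "u differentiable_on U"
  shows "((\<lambda>s. u (x + s *\<^sub>R axis a 1)) has_real_derivative pd U a u (x + t *\<^sub>R axis a 1)) (at t)"
proof -
  let ?y = "x + t *\<^sub>R axis a 1"
  have *: "((\<lambda>s. x + s *\<^sub>R axis a 1) has_derivative (\<lambda>s. s *\<^sub>R axis a 1)) (at t)"
    by (auto intro!: derivative_eq_intros)
  note d = pd_has_derivative_frechet[OF assms]
  have "((\<lambda>s. u (x + s *\<^sub>R axis a 1)) has_derivative
      (\<lambda>s. frechet_derivative u (at ?y) (s *\<^sub>R axis a 1))) (at t)"
    using diff_chain_at[OF * d(1)] by (simp add: o_def)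
  moreover have "(\<lambda>s. frechet_derivative u (at ?y) (s *\<^sub>R axis a 1)) = (\<lambda>s. pd U a u ?y * s)"
    using linear_scale[OF has_derivative_linear[OF d(1)]] d(2) by (simp add: mult.commute fun_eq_iff)
  ultimately show ?thesis by (simp add: has_field_derivative_def)
qed

lemma second_difference:
  assumes U: "open U" "ball x r \<subseteq> U" and u: "u differentiable_on U" "pd U a u differentiable_on U"
    and h: "0 < h" "2 * h < r"
  shows "\<exists>\<xi> \<eta>. 0 < \<xi> \<and> \<xi> < h \<and> 0 < \<eta> \<and> \<eta> < h \<and>
    u (x + h *\<^sub>R axis a 1 + h *\<^sub>R axis b 1) - u (x + h *\<^sub>R axis a 1) - u (x + h *\<^sub>R axis b 1) + u x =
    h * h * pd U b (pd U a u) (x + \<xi> *\<^sub>R axis a 1 + \<eta> *\<^sub>R axis b 1)"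
proof -
  have inU: "x + s *\<^sub>R axis a 1 + t *\<^sub>R axis b 1 \<in> U" if "0 \<le> s" "s \<le> h" "0 \<le> t" "t \<le> h" for s t
  proof -
    have "norm (s *\<^sub>R (axis a 1 :: real^4) + t *\<^sub>R axis b 1) \<le> s + t"
      by (rule order_trans[OF norm_triangle_ineq]) (use that in simp)
    moreover have "dist x (x + v) = norm v" for v :: "real^4"
      by (simp add: dist_norm)
    ultimately have "x + (s *\<^sub>R axis a 1 + t *\<^sub>R axis b 1) \<in> ball x r"
      using that h by (simp only: mem_ball)
    then have "x + s *\<^sub>R axis a 1 + t *\<^sub>R axis b 1 \<in> ball x r"
      by (simp only: add.assoc)
    with U show ?thesis by blast
  qed
  let ?p = "\<lambda>s. u (x + h *\<^sub>R axis b 1 + s *\<^sub>R axis a 1) - u (x + s *\<^sub>R axis a 1)"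
  have "\<exists>z>0. z < h \<and> ?p h - ?p 0 = (h - 0) * (pd U a u (x + h *\<^sub>R axis b 1 + z *\<^sub>R axis a 1) - pd U a u (x + z *\<^sub>R axis a 1))"
  proof (rule MVT2[OF h(1)])
    fix s assume s: "0 \<le> s" "s \<le> h"
    show "(?p has_real_derivative (pd U a u (x + h *\<^sub>R axis b 1 + s *\<^sub>R axis a 1) - pd U a u (x + s *\<^sub>R axis a 1))) (at s)"
      by (intro DERIV_diff pd_line U u)
        (use inU[of s h] inU[of s 0] s h in \<open>simp_all add: algebra_simps\<close>)
  qed
  then obtain \<xi> where xi: "0 < \<xi>" "\<xi> < h"
    "?p h - ?p 0 = h * (pd U a u (x + h *\<^sub>R axis b 1 + \<xi> *\<^sub>R axis a 1) - pd U a u (x + \<xi> *\<^sub>R axis a 1))"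
    by auto
  let ?q = "\<lambda>t. pd U a u (x + \<xi> *\<^sub>R axis a 1 + t *\<^sub>R axis b 1)"
  have "\<exists>z>0. z < h \<and> ?q h - ?q 0 = (h - 0) * pd U b (pd U a u) (x + \<xi> *\<^sub>R axis a 1 + z *\<^sub>R axis b 1)"
  proof (rule MVT2[OF h(1)])
    fix t assume t: "0 \<le> t" "t \<le> h"
    show "(?q has_real_derivative pd U b (pd U a u) (x + \<xi> *\<^sub>R axis a 1 + t *\<^sub>R axis b 1)) (at t)"
      by (intro pd_line U u) (use inU[of \<xi> t] t xi in simp)
  qed
  then obtain \<eta> where eta: "0 < \<eta>" "\<eta> < h"
    "?q h - ?q 0 = h * pd U b (pd U a u) (x + \<xi> *\<^sub>R axis a 1 + \<eta> *\<^sub>R axis b 1)"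
    by auto
  have "?p h - ?p 0 = h * (?q h - ?q 0)"
    using xi(3) by (simp add: algebra_simps)
  then have "?p h - ?p 0 = h * h * pd U b (pd U a u) (x + \<xi> *\<^sub>R axis a 1 + \<eta> *\<^sub>R axis b 1)"
    using eta(3) by simp
  then show ?thesis
    using xi(1,2) eta(1,2) by (intro exI[of _ \<xi>] exI[of _ \<eta>]) (simp add: algebra_simps)
qed

lemma pd_commute:
  assumes U: "open U" "x \<in> U" and u: "Ck_on 2 U u"
  shows "pd U a (pd U b u) x = pd U b (pd U a u) x"
proof (rule ccontr)
  let ?A = "pd U a (pd U b u)" and ?B = "pd U b (pd U a u)"
  assume ne: "?A x \<noteq> ?B x"
  define e where "e = \<bar>?A x - ?B x\<bar> / 2"
  have e: "e > 0" using ne by (simp add: e_def)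
  have d: "u differentiable_on U" "pd U c u differentiable_on U" "continuous_on U (pd U d (pd U c u))" for c d
    using u by (auto simp: numeral_2_eq_2)
  obtain r where r: "r > 0" "ball x r \<subseteq> U" using U open_contains_ball by blast
  have ex: "\<exists>\<delta>>0. \<forall>y\<in>U. dist y x < \<delta> \<longrightarrow> dist (pd U d (pd U c u) y) (pd U d (pd U c u) x) < e" for c d
    using d(3) U e by (auto simp: continuous_on_iff)
  obtain d1 where d1: "d1 > 0" "\<And>y. y \<in> U \<Longrightarrow> dist y x < d1 \<Longrightarrow> dist (?A y) (?A x) < e"
    using ex by blast
  obtain d2 where d2: "d2 > 0" "\<And>y. y \<in> U \<Longrightarrow> dist y x < d2 \<Longrightarrow> dist (?B y) (?B x) < e"
    using ex by blast
  define h where "h = min r (min d1 d2) / 3"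
  have h: "0 < h" "2 * h < r" "2 * h < d1" "2 * h < d2"
    using r d1 d2 by (auto simp: h_def min_def)
  have close: "dist (x + s *\<^sub>R axis i 1 + t *\<^sub>R axis j 1) x < 2 * h"
    if "0 < s" "s < h" "0 < t" "t < h" for s t i j
  proof -
    have "norm (s *\<^sub>R (axis i 1 :: real^4) + t *\<^sub>R axis j 1) \<le> s + t"
      by (rule order_trans[OF norm_triangle_ineq]) (use that in simp)
    then show ?thesis using that by (simp add: dist_norm add.assoc)
  qed
  obtain s1 t1 where 1: "0 < s1" "s1 < h" "0 < t1" "t1 < h"
    "u (x + h *\<^sub>R axis a 1 + h *\<^sub>R axis b 1) - u (x + h *\<^sub>R axis a 1) - u (x + h *\<^sub>R axis b 1) + u x =
    h * h * ?B (x + s1 *\<^sub>R axis a 1 + t1 *\<^sub>R axis b 1)"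
    using second_difference[OF U(1) r(2) d(1) d(2) h(1,2), of a b] by blast
  obtain s2 t2 where 2: "0 < s2" "s2 < h" "0 < t2" "t2 < h"
    "u (x + h *\<^sub>R axis b 1 + h *\<^sub>R axis a 1) - u (x + h *\<^sub>R axis b 1) - u (x + h *\<^sub>R axis a 1) + u x =
    h * h * ?A (x + s2 *\<^sub>R axis b 1 + t2 *\<^sub>R axis a 1)"
    using second_difference[OF U(1) r(2) d(1) d(2) h(1,2), of b a] by blast
  have "h * h * ?B (x + s1 *\<^sub>R axis a 1 + t1 *\<^sub>R axis b 1) = h * h * ?A (x + s2 *\<^sub>R axis b 1 + t2 *\<^sub>R axis a 1)"
    unfolding 1(5)[symmetric] 2(5)[symmetric] by (simp add: algebra_simps)
  then have eq: "?B (x + s1 *\<^sub>R axis a 1 + t1 *\<^sub>R axis b 1) = ?A (x + s2 *\<^sub>R axis b 1 + t2 *\<^sub>R axis a 1)"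
    using h(1) by simp
  have near: "x + s1 *\<^sub>R axis a 1 + t1 *\<^sub>R axis b 1 \<in> U" "x + s2 *\<^sub>R axis b 1 + t2 *\<^sub>R axis a 1 \<in> U"
    using close[OF 1(1-4), of a b] close[OF 2(1-4), of b a] h(2) r(2)
    by (auto simp: subset_iff dist_commute)
  have "dist (?B (x + s1 *\<^sub>R axis a 1 + t1 *\<^sub>R axis b 1)) (?B x) < e"
    using close[OF 1(1-4), of a b] near h d2(2) by simp
  moreover have "dist (?A (x + s2 *\<^sub>R axis b 1 + t2 *\<^sub>R axis a 1)) (?A x) < e"
    using close[OF 2(1-4), of b a] near h d1(2) by simp
  ultimately show False
    using dist_triangle3[of "?A x" "?B x" "?A (x + s2 *\<^sub>R axis b 1 + t2 *\<^sub>R axis a 1)"]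
    unfolding eq by (simp add: e_def dist_real_def)
qed

definition contr :: "(4 \<Rightarrow> 4 \<Rightarrow> real) \<Rightarrow> (4 \<Rightarrow> 4 \<Rightarrow> 4 \<Rightarrow> 4 \<Rightarrow> real) \<Rightarrow> real" where
  "contr h P = (\<Sum>\<sigma>\<in>UNIV. \<Sum>\<mu>\<in>UNIV. \<Sum>\<delta>\<in>UNIV. \<Sum>\<nu>\<in>UNIV. h \<sigma> \<mu> * h \<delta> \<nu> * P \<sigma> \<mu> \<delta> \<nu>)"

lemma contr_linear:
  "contr h (\<lambda>a b c d. P a b c d + Q a b c d) = contr h P + contr h Q"
  "contr h (\<lambda>a b c d. P a b c d - Q a b c d) = contr h P - contr h Q"
  "contr h (\<lambda>a b c d. k * P a b c d) = k * contr h P"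
  "contr h (\<lambda>a b c d. P a b c d / k) = contr h P / k"
  by (simp_all add: contr_def algebra_simps sum.distrib sum_subtractf sum_distrib_left
      sum_divide_distrib)

lemma contr_pair_swap: "contr h (\<lambda>a b c d. P c d a b) = contr h P"
proof -
  let ?t = "\<lambda>a b c d. h a b * h c d * P c d a b"
  have "contr h (\<lambda>a b c d. P c d a b) = (\<Sum>a\<in>UNIV. \<Sum>c\<in>UNIV. \<Sum>b\<in>UNIV. \<Sum>d\<in>UNIV. ?t a b c d)"
    unfolding contr_def by (rule sum.cong[OF refl]) (rule sum.swap)
  also have "\<dots> = (\<Sum>c\<in>UNIV. \<Sum>a\<in>UNIV. \<Sum>b\<in>UNIV. \<Sum>d\<in>UNIV. ?t a b c d)"
    by (rule sum.swap)
  also have "\<dots> = (\<Sum>c\<in>UNIV. \<Sum>a\<in>UNIV. \<Sum>d\<in>UNIV. \<Sum>b\<in>UNIV. ?t a b c d)"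
    by (rule sum.cong[OF refl], rule sum.cong[OF refl], rule sum.swap)
  also have "\<dots> = (\<Sum>c\<in>UNIV. \<Sum>d\<in>UNIV. \<Sum>a\<in>UNIV. \<Sum>b\<in>UNIV. ?t a b c d)"
    by (rule sum.cong[OF refl], rule sum.swap)
  also have "\<dots> = contr h P"
    unfolding contr_def by (simp add: mult.commute)
  finally show ?thesis .
qed

lemma contr_swap1:
  assumes "\<And>a b. h a b = h b a"
  shows "contr h (\<lambda>a b c d. P b a c d) = contr h P"
  unfolding contr_def by (subst sum.swap) (simp add: assms)

lemma contr_swap2:
  assumes "\<And>a b. h a b = h b a"
  shows "contr h (\<lambda>a b c d. P a b d c) = contr h P"
  using contr_swap1[OF assms, where P = "\<lambda>c d a b. P a b c d"] contr_pair_swap[of h P]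
    contr_pair_swap[of h "\<lambda>a b c d. P a b d c"] by simp

theorem ricci_wave_decomposition:
  fixes g :: "real^4 \<Rightarrow> real^4^4"
  assumes U: "open U" "x \<in> U" and C2: "tensor_Ck_on 2 U g"
    and sym: "\<And>y. y \<in> U \<Longrightarrow> transpose (g y) = g y" and inv: "\<And>y. y \<in> U \<Longrightarrow> invertible (g y)"
  shows "ricci U g \<alpha> \<beta> x = - (1/2) * reduced_wave U g (\<lambda>y. g y $ \<alpha> $ \<beta>) x
    + (1/2) * (pd U \<alpha> (wave_gauge_low U g \<beta>) x + pd U \<beta> (wave_gauge_low U g \<alpha>) x)
    + (1/2) * F_field U g \<alpha> \<beta> x"
proof -
  define h where "h y a b = matrix_inv (g y) $ a $ b" for y a b
  define D where "D y c a b = pd U c (\<lambda>y. g y $ a $ b) y" for y c a b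
  define E where "E c d a b = pd U c (pd U d (\<lambda>y. g y $ a $ b)) x" for c d a b
  define H where "H = h x"
  define d where "d = D x"
  have Ck: "Ck_on 2 U (\<lambda>y. g y $ a $ b)" for a b using C2 by (simp add: tensor_Ck_on_def)
  then have dg: "(\<lambda>y. g y $ a $ b) differentiable_on U"
    and dD: "(\<lambda>y. D y c a b) differentiable_on U" for a b c
    by (auto simp: numeral_2_eq_2 D_def)
  have dh: "(\<lambda>y. h y a b) differentiable_on U" for a b
    unfolding h_def by (rule differentiable_on_matrix_inv[OF dg inv])
  have hsym: "h y a b = h y b a" if "y \<in> U" for y a b
    unfolding h_def by (rule matrix_inv_sym) (use inv sym that in auto)
  have Hsym: "H a b = H b a" for a b using hsym[OF U(2)] by (simp add: H_def)
  have gsym: "g y $ a $ b = g y $ b $ a" if "y \<in> U" for y a b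
  proof -
    have "transpose (g y) $ a $ b = g y $ a $ b"
      by (simp only: sym[OF that])
    then show ?thesis by (simp add: transpose_def)
  qed
  have Dsym: "D y c a b = D y c b a" if "y \<in> U" for y a b c
    unfolding D_def by (rule pd_cong[OF U(1) that dg]) (rule gsym)
  have dsym: "d c a b = d c b a" for a b c using Dsym[OF U(2)] by (simp add: d_def)
  have E_D: "E c e a b = pd U c (\<lambda>y. D y e a b) x" for a b c e
    by (simp add: E_def D_def)
  have Esym: "E c e a b = E c e b a" for a b c e
    unfolding E_D by (rule pd_cong[OF U dD]) (rule Dsym)
  have Ecomm: "E c e a b = E e c a b" for a b c e
    unfolding E_def by (rule pd_commute[OF U Ck])
  have pdh: "pd U c (\<lambda>y. h y a b) x = - (\<Sum>i\<in>UNIV. \<Sum>j\<in>UNIV. H a i * d c i j * H j b)" for c a b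
    unfolding h_def H_def d_def D_def by (rule pd_matrix_inv[OF U dg inv])

  define C where "C y c a b = chris_low (D y) c a b" for y c a b
  have dC: "(\<lambda>y. C y c a b) differentiable_on U" for a b c
    unfolding C_def chris_low_def divide_inverse
    by (intro differentiable_on_mult differentiable_on_add differentiable_on_diff dD differentiable_on_const)
  have pdC: "pd U e (\<lambda>y. C y c a b) x = (E e a b c + E e b a c - E e c a b) / 2" for a b c e
  proof -
    have "pd U e (\<lambda>y. (D y a b c + D y b a c - D y c a b) * inverse 2) x =
      pd U e (\<lambda>y. D y a b c + D y b a c - D y c a b) x * inverse 2 +
      (D x a b c + D x b a c - D x c a b) * pd U e (\<lambda>y. inverse 2) x"
      by (rule pd_mult[OF U]) (intro differentiable_on_add differentiable_on_diff dD differentiable_on_const)+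
    moreover have "pd U e (\<lambda>y. inverse 2) x = 0"
      by (rule pd_has_derivative[OF U, where u' = "\<lambda>_. 0"]) simp
    moreover have "pd U e (\<lambda>y. D y a b c + D y b a c - D y c a b) x = E e a b c + E e b a c - E e c a b"
      by (simp add: pd_diff[OF U] pd_add[OF U] dD differentiable_on_add E_D)
    ultimately show ?thesis
      by (simp only: C_def chris_low_def divide_inverse mult_zero_right add_0_right)
  qed
  define c0 where "c0 = chris_low d"
  have C0: "C x = c0" by (simp add: fun_eq_iff C_def c0_def d_def)
  have chr: "christoffel U g c a b y = (\<Sum>e\<in>UNIV. h y c e * C y e a b)" if "y \<in> U" for c a b y
    unfolding christoffel_def h_def C_def chris_low_def D_def
    by (simp only: times_divide_eq_left times_divide_eq_right)
  have dchr: "(\<lambda>y. \<Sum>e\<in>UNIV. h y c e * C y e a b) differentiable_on U" for c a b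
    by (intro differentiable_on_sum_UNIV differentiable_on_mult dh dC)
  have pd_hC: "pd U k (\<lambda>y. h y c e * C y e' a b) x =
      - (\<Sum>i\<in>UNIV. \<Sum>j\<in>UNIV. H c i * H e j * (d k i j * c0 e' a b))
      + H c e * ((E k a b e' + E k b a e' - E k e' a b) / 2)" for k c e e' a b
    by (simp add: pd_mult[OF U dh dC] pdh pdC C0 H_def[symmetric] sum_distrib_right sum_distrib_left
        Hsym[of e] mult_ac)
  have pd_chr: "pd U k (christoffel U g c a b) x =
      (\<Sum>e\<in>UNIV. - (\<Sum>i\<in>UNIV. \<Sum>j\<in>UNIV. H c i * H e j * (d k i j * c0 e a b))
      + H c e * ((E k a b e + E k b a e - E k e a b) / 2))" for k c a b
  proof -
    have "pd U k (christoffel U g c a b) x = pd U k (\<lambda>y. \<Sum>e\<in>UNIV. h y c e * C y e a b) x"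
      by (rule pd_cong[OF U dchr chr])
    then show ?thesis
      by (simp add: pd_sum[OF U] dh dC differentiable_on_mult pd_hC)
  qed
  define S where "S P = (\<Sum>a\<in>UNIV. \<Sum>b\<in>UNIV. H a b * P a b)" for P
  have S_lin: "S (\<lambda>a b. P a b + Q a b) = S P + S Q" "S (\<lambda>a b. P a b - Q a b) = S P - S Q"
    "S (\<lambda>a b. P a b / k) = S P / k" for P Q k
    by (simp_all add: S_def algebra_simps sum.distrib sum_subtractf sum_divide_distrib)
  have S_swap: "S (\<lambda>a b. P b a) = S P" for P
    unfolding S_def by (subst sum.swap) (simp add: Hsym)
  have contr_S: "(\<Sum>a\<in>UNIV. \<Sum>b\<in>UNIV. - (\<Sum>i\<in>UNIV. \<Sum>j\<in>UNIV. H a i * H b j * P a i b j) + H a b * Q a b)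
      = S Q - contr H P" for P Q
  proof -
    have "(\<Sum>a\<in>UNIV. \<Sum>b\<in>UNIV. \<Sum>i\<in>UNIV. \<Sum>j\<in>UNIV. H a i * H b j * P a i b j) = contr H P"
      unfolding contr_def by (rule sum.cong[OF refl], rule sum.swap)
    then show ?thesis by (simp add: S_def sum_subtractf)
  qed
  have t1: "(\<Sum>c\<in>UNIV. pd U c (christoffel U g c \<alpha> \<beta>) x) =
      S (\<lambda>a b. (E a \<alpha> \<beta> b + E a \<beta> \<alpha> b - E a b \<alpha> \<beta>) / 2) - contr H (\<lambda>a i b j. d a i j * c0 b \<alpha> \<beta>)"
    unfolding pd_chr by (rule contr_S)
  have t2: "(\<Sum>c\<in>UNIV. pd U \<alpha> (christoffel U g c \<beta> c) x) =
      S (\<lambda>a b. (E \<alpha> \<beta> a b + E \<alpha> a \<beta> b - E \<alpha> b \<beta> a) / 2) - contr H (\<lambda>a i b j. d \<alpha> i j * c0 b \<beta> a)"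
    unfolding pd_chr by (rule contr_S)
  have chr0: "christoffel U g c a b x = (\<Sum>e\<in>UNIV. H c e * c0 e a b)" for c a b
    by (simp add: chr[OF U(2)] C0 H_def)
  have prod: "(\<Sum>c\<in>UNIV. \<Sum>e\<in>UNIV. (\<Sum>i\<in>UNIV. H c i * P c i e) * (\<Sum>j\<in>UNIV. H e j * Q c e j)) =
      contr H (\<lambda>c i e j. P c i e * Q c e j)" for P Q
  proof -
    have "(\<Sum>c\<in>UNIV. \<Sum>e\<in>UNIV. (\<Sum>i\<in>UNIV. H c i * P c i e) * (\<Sum>j\<in>UNIV. H e j * Q c e j)) =
        (\<Sum>c\<in>UNIV. \<Sum>e\<in>UNIV. \<Sum>i\<in>UNIV. \<Sum>j\<in>UNIV. H c i * H e j * (P c i e * Q c e j))"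
      by (simp add: sum_product mult_ac)
    also have "\<dots> = contr H (\<lambda>c i e j. P c i e * Q c e j)"
      unfolding contr_def by (rule sum.cong[OF refl], rule sum.swap)
    finally show ?thesis .
  qed
  have t3: "(\<Sum>c\<in>UNIV. \<Sum>e\<in>UNIV. christoffel U g c \<alpha> \<beta> x * christoffel U g e c e x) =
      contr H (\<lambda>c i e j. c0 i \<alpha> \<beta> * c0 j c e)"
    unfolding chr0 by (rule prod[of "\<lambda>c i e. c0 i \<alpha> \<beta>" "\<lambda>c e j. c0 j c e"])
  have t4: "(\<Sum>c\<in>UNIV. \<Sum>e\<in>UNIV. christoffel U g c \<alpha> e x * christoffel U g e \<beta> c x) =
      contr H (\<lambda>c i e j. c0 i \<alpha> e * c0 j \<beta> c)"
    unfolding chr0 by (rule prod[of "\<lambda>c i e. c0 i \<alpha> e" "\<lambda>c e j. c0 j \<beta> c"])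
  have ric: "ricci U g \<alpha> \<beta> x =
      S (\<lambda>a b. (E a \<alpha> \<beta> b + E a \<beta> \<alpha> b - E a b \<alpha> \<beta>) / 2) - contr H (\<lambda>a i b j. d a i j * c0 b \<alpha> \<beta>)
      - (S (\<lambda>a b. (E \<alpha> \<beta> a b + E \<alpha> a \<beta> b - E \<alpha> b \<beta> a) / 2) - contr H (\<lambda>a i b j. d \<alpha> i j * c0 b \<beta> a))
      + (contr H (\<lambda>c i e j. c0 i \<alpha> \<beta> * c0 j c e) - contr H (\<lambda>c i e j. c0 i \<alpha> e * c0 j \<beta> c))"
    unfolding ricci_def sum_subtractf t1 t2 t3 t4 by simp
  have gauge: "wave_gauge_low U g k y = (\<Sum>a\<in>UNIV. \<Sum>b\<in>UNIV. h y a b * C y k a b)" if y: "y \<in> U" for k y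
  proof -
    have "wave_gauge_low U g k y =
        (\<Sum>c\<in>UNIV. \<Sum>a\<in>UNIV. \<Sum>b\<in>UNIV. \<Sum>e\<in>UNIV. g y $ k $ c * h y c e * (h y a b * C y e a b))"
      unfolding wave_gauge_low_def wave_gauge_def chr[OF y] h_def[symmetric]
      by (simp add: sum_distrib_left mult_ac)
    also have "\<dots> = (\<Sum>a\<in>UNIV. \<Sum>c\<in>UNIV. \<Sum>b\<in>UNIV. \<Sum>e\<in>UNIV. g y $ k $ c * h y c e * (h y a b * C y e a b))"
      by (rule sum.swap)
    also have "\<dots> = (\<Sum>a\<in>UNIV. \<Sum>b\<in>UNIV. \<Sum>c\<in>UNIV. \<Sum>e\<in>UNIV. g y $ k $ c * h y c e * (h y a b * C y e a b))"
      by (rule sum.cong[OF refl], rule sum.swap)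
    also have "\<dots> = (\<Sum>a\<in>UNIV. \<Sum>b\<in>UNIV. \<Sum>e\<in>UNIV. (\<Sum>c\<in>UNIV. g y $ k $ c * h y c e) * (h y a b * C y e a b))"
      unfolding sum_distrib_right by (rule sum.cong[OF refl], rule sum.cong[OF refl], rule sum.swap)
    also have "\<dots> = (\<Sum>a\<in>UNIV. \<Sum>b\<in>UNIV. h y a b * C y k a b)"
      unfolding h_def matrix_inv_mult(2)[OF inv[OF y]]
      by (simp add: if_distrib[of "\<lambda>t. t * _"] cong: if_cong)
    finally show ?thesis .
  qed
  have pd_gauge: "pd U e (wave_gauge_low U g k) x =
      S (\<lambda>a b. (E e a b k + E e b a k - E e k a b) / 2) - contr H (\<lambda>a i b j. d e i j * c0 k a b)" for e k
  proof -
    have "pd U e (wave_gauge_low U g k) x = pd U e (\<lambda>y. \<Sum>a\<in>UNIV. \<Sum>b\<in>UNIV. h y a b * C y k a b) x"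
      by (rule pd_cong[OF U _ gauge]) (intro differentiable_on_sum_UNIV differentiable_on_mult dh dC)
    also have "\<dots> = (\<Sum>a\<in>UNIV. \<Sum>b\<in>UNIV. pd U e (\<lambda>y. h y a b * C y k a b) x)"
      by (simp add: pd_sum[OF U] differentiable_on_sum_UNIV differentiable_on_mult dh dC)
    also have "\<dots> = S (\<lambda>a b. (E e a b k + E e b a k - E e k a b) / 2) - contr H (\<lambda>a i b j. d e i j * c0 k a b)"
      unfolding pd_hC by (rule contr_S)
    finally show ?thesis .
  qed
  have box: "reduced_wave U g (\<lambda>y. g y $ \<alpha> $ \<beta>) x = S (\<lambda>a b. E a b \<alpha> \<beta>)"
    by (simp add: reduced_wave_def S_def E_def H_def h_def)
  have F: "F_field U g \<alpha> \<beta> x = contr H (\<lambda>a i b j.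
      2 * (c0 i \<alpha> \<beta> * c0 j a b) - 2 * (c0 i \<alpha> b * c0 j \<beta> a)
      - 2 * (d a i j * c0 b \<alpha> \<beta>) + d \<alpha> i j * d a \<beta> b + d \<beta> i j * d a \<alpha> b)"
    unfolding F_field_def F_quad_def contr_def c0_def d_def D_def H_def h_def
    by (simp add: mult.assoc)

  have second: "S (\<lambda>a b. (E a \<alpha> \<beta> b + E a \<beta> \<alpha> b - E a b \<alpha> \<beta>) / 2)
      - S (\<lambda>a b. (E \<alpha> \<beta> a b + E \<alpha> a \<beta> b - E \<alpha> b \<beta> a) / 2) =
      - (1/2) * S (\<lambda>a b. E a b \<alpha> \<beta>) + (1/2) * (S (\<lambda>a b. (E \<alpha> a b \<beta> + E \<alpha> b a \<beta> - E \<alpha> \<beta> a b) / 2)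
        + S (\<lambda>a b. (E \<beta> a b \<alpha> + E \<beta> b a \<alpha> - E \<beta> \<alpha> a b) / 2))"
  proof -
    have "E a \<alpha> \<beta> b = E \<alpha> a \<beta> b" "E a \<beta> \<alpha> b = E \<beta> a \<alpha> b" "E \<alpha> a b \<beta> = E \<alpha> a \<beta> b"
      "E \<beta> a b \<alpha> = E \<beta> a \<alpha> b" "E \<beta> \<alpha> a b = E \<alpha> \<beta> a b" for a b
      by (rule Ecomm Esym)+
    then show ?thesis
      using S_swap[of "\<lambda>a b. E \<alpha> a \<beta> b"] S_swap[of "\<lambda>a b. E \<beta> a \<alpha> b"] by (simp add: S_lin field_simps)
  qed
  have q1: "contr H (\<lambda>a i b j. d k i j * c0 b l a) = contr H (\<lambda>a i b j. d k i j * d l a b) / 2" for k l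
  proof -
    have "contr H (\<lambda>a i b j. d k i j * d a l b) = contr H (\<lambda>a i b j. d k i j * d b l a)"
      using contr_pair_swap[of H "\<lambda>a i b j. d k i j * d b l a"] by (simp add: dsym[of k])
    then show ?thesis
      by (simp add: c0_def chris_low_def distrib_left right_diff_distrib contr_linear)
  qed
  have q2: "contr H (\<lambda>a i b j. d k i j * c0 l a b) =
      contr H (\<lambda>a i b j. d k i j * d a l b) - contr H (\<lambda>a i b j. d k i j * d l a b) / 2" for k l
  proof -
    have c: "c0 l a b = (d a l b + d b l a - d l a b) / 2" for a b
      unfolding c0_def chris_low_def dsym[of a b l] dsym[of b a l] ..
    have "contr H (\<lambda>a i b j. d k i j * d a l b) = contr H (\<lambda>a i b j. d k i j * d b l a)"
      using contr_pair_swap[of H "\<lambda>a i b j. d k i j * d b l a"] by (simp add: dsym[of k])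
    then show ?thesis
      unfolding c by (simp add: distrib_left right_diff_distrib contr_linear field_simps)
  qed
  have q3: "contr H (\<lambda>a i b j. d \<beta> i j * d \<alpha> a b) = contr H (\<lambda>a i b j. d \<alpha> i j * d \<beta> a b)"
  proof -
    have "contr H (\<lambda>a i b j. d \<beta> i j * d \<alpha> a b) = contr H (\<lambda>a i b j. d \<alpha> a b * d \<beta> i j)"
      by (simp only: mult.commute)
    also have "\<dots> = contr H (\<lambda>a i b j. d \<alpha> a j * d \<beta> i b)"
      by (rule contr_swap2[OF Hsym, where P = "\<lambda>a i b j. d \<alpha> a j * d \<beta> i b"])
    also have "\<dots> = contr H (\<lambda>a i b j. d \<alpha> i j * d \<beta> a b)"
      by (rule contr_swap1[OF Hsym, where P = "\<lambda>a i b j. d \<alpha> i j * d \<beta> a b"])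
    finally show ?thesis .
  qed
  show ?thesis
    unfolding box F ric pd_gauge contr_linear
    using second q1[of \<alpha> \<beta>] q2[of \<alpha> \<beta>] q2[of \<beta> \<alpha>] q3
    by (simp add: field_simps)
qed

subsection \<open>The function f and the Cauchy adapted frame\<close>

definition smooth_convex_increasing_on :: "real set \<Rightarrow> (real \<Rightarrow> real) \<Rightarrow> bool" where
  "smooth_convex_increasing_on I f \<longleftrightarrow>
     (\<forall>k. \<forall>r\<in>I. (deriv ^^ k) f differentiable (at r)) \<and>
     (\<forall>r\<in>I. deriv f r > 0 \<and> deriv (deriv f) r > 0)"

definition s_map :: "(real \<Rightarrow> real) \<Rightarrow> real \<Rightarrow> real" where
  "s_map f r = ln (deriv f r) / 2"

definition theta :: "real set \<Rightarrow> (real \<Rightarrow> real) \<Rightarrow> real \<Rightarrow> real" where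
  "theta I f = the_inv_into I (s_map f)"

definition W2 :: "real set \<Rightarrow> (real \<Rightarrow> real) \<Rightarrow> real \<Rightarrow> real" where
  "W2 I f s = (let r = theta I f s in (f r - r * deriv f r) / deriv f r)"

definition adapted_e0 :: "(4 \<Rightarrow> real) \<Rightarrow> real^4" where
  "adapted_e0 b = axis 0 1 - (\<Sum>i\<in>{1, 2, 3}. b i *\<^sub>R axis i 1)"

end

theory Submission
  imports Defs
begin

text \<open>
  Write \<open>\<Gamma>\<^sup>c = g\<^sup>a\<^sup>b \<Gamma>\<^sup>c\<^sub>a\<^sub>b\<close>, \<open>\<Gamma>\<^sub>b\<close> for the lowered functions and
  \<open>P\<^sub>a\<^sub>b = (\<partial>\<^sub>a \<Gamma>\<^sub>b + \<partial>\<^sub>b \<Gamma>\<^sub>a) / 2\<close>, all for the Einstein frame metric \<open>gd\<close>,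
  which is called \<open>g\<close> in the formulas below. By the wave decomposition of the Ricci tensor, the reduced
  equation for the metric is the conformal field equation with the additional term
  \<open>e\<^sup>2\<^sup>\<rho> P\<^sub>a\<^sub>b\<close>. The theorem says that this term vanishes.
  
  The contracted Bianchi identity turns this into an evolution equation for \<open>\<Gamma>\<^sub>b\<close>. For a
  symmetric \<open>S\<close> let \<open>L(S)\<^sub>b = \<nabla>\<^sup>a S\<^sub>a\<^sub>b - \<partial>\<^sub>b (tr S) / 2\<close>, so that \<open>L(Ric) = 0\<close>. In coordinates the
  Christoffel symbols in \<open>L\<close> combine to the gauge functions:
  \<open>L(S)\<^sub>b = g\<^sup>a\<^sup>c (\<partial>\<^sub>c S\<^sub>a\<^sub>b - \<partial>\<^sub>b S\<^sub>a\<^sub>c / 2) - \<Gamma>\<^sup>d S\<^sub>d\<^sub>b\<close>. With this formula every term of the reduced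
  equation is evaluated in one line: \<open>L(P)\<close> is half of \<open>g\<^sup>a\<^sup>c \<partial>\<^sub>a \<partial>\<^sub>c \<Gamma>\<^sub>b\<close> plus first order terms in
  \<open>\<Gamma>\<close>, \<open>L(\<phi> g) = - d\<phi>\<close>, \<open>L(d\<rho> \<otimes> d\<rho>)\<close> is \<open>d\<rho>\<close> times the wave operator applied to \<open>\<rho>\<close>, and the matter
  term produces the divergence of \<open>T\<close>. The equations for \<open>T\<close> and \<open>\<rho>\<close> together with
  \<open>W\<^sub>2' (s) = - 2 f (\<theta> s) e\<^sup>-\<^sup>2\<^sup>s\<close> make the sum of these terms cancel up to multiples of \<open>\<Gamma>\<close>; the multiple
  of \<open>\<Gamma>\<close> arises since the equation for \<open>\<rho>\<close> contains \<open>g\<^sup>a\<^sup>b \<partial>\<^sub>a \<partial>\<^sub>b \<rho>\<close> and not the covariant wave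
  operator. What is left is a homogeneous linear wave system for \<open>\<Gamma>\<^sub>b\<close> (\<open>gauge_wave_equation\<close>).
  
  On the initial slice \<open>\<Gamma>\<^sub>b\<close> vanishes, hence so do its tangential derivatives, and only \<open>\<partial>\<^sub>0 \<Gamma>\<^sub>b\<close> is left
  in \<open>P\<close>. The constraints say that the trace-reversed \<open>P\<close> vanishes when one argument is normal to the
  slice, and this kills \<open>\<partial>\<^sub>0 \<Gamma>\<^sub>b\<close> as well (\<open>constraints_imply_gauge_derivative\<close>). Uniqueness for linear
  wave systems gives \<open>\<Gamma> = 0\<close>, so \<open>P = 0\<close> and the field equations hold. Their trace, the equation
  for \<open>\<rho>\<close> and the behaviour of scalar curvature under a conformal change
  (\<open>scalar_curvature_conformal\<close>) give \<open>R = f (\<theta> \<rho>) e\<^sup>-\<^sup>2\<^sup>\<rho> - W\<^sub>2(\<rho>) = \<theta>(\<rho>)\<close> for the conformal metric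
  \<open>e\<^sup>-\<^sup>2\<^sup>\<rho> g\<close>, which is the relation \<open>\<rho> = ln (f' R) / 2\<close>.
\<close>

section \<open>Partial derivatives within a domain with boundary\<close>

lemma pd_congr:
  assumes "x \<in> M" "\<And>y. y \<in> M \<Longrightarrow> u y = v y"
  shows "pd M a u x = pd M a v x"
proof -
  have "(u has_derivative u') (at x within M) \<longleftrightarrow> (v has_derivative u') (at x within M)" for u'
    using assms has_derivative_transform by metis
  then show ?thesis
    unfolding pd_def frechet_derivative_def by simp
qed

lemma pd_interior:
  assumes "x \<in> interior M" "\<And>y. y \<in> interior M \<Longrightarrow> u y = v y"
  shows "pd (interior M) a u x = pd M a v x"
proof -
  have "pd (interior M) a u x = pd (interior M) a v x"
    using assms by (rule pd_congr)
  also have "\<dots> = pd M a v x"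
    unfolding pd_def at_within_interior[OF assms(1)] at_within_open[OF assms(1) open_interior] ..
  finally show ?thesis .
qed

lemma differentiable_on_congr:
  assumes "u differentiable_on M" "\<And>y. y \<in> M \<Longrightarrow> u y = v y"
  shows "v differentiable_on M"
  unfolding differentiable_on_def
proof
  fix x assume "x \<in> M"
  then obtain u' where "(u has_derivative u') (at x within M)"
    using assms(1) unfolding differentiable_on_def differentiable_def by blast
  then have "(v has_derivative u') (at x within M)"
    using \<open>x \<in> M\<close> assms(2) has_derivative_transform by metis
  then show "v differentiable at x within M"
    unfolding differentiable_def by blast
qed

lemma Ck_on_congr:
  assumes "Ck_on k M u" "\<And>y. y \<in> M \<Longrightarrow> u y = v y"
  shows "Ck_on k M v"
  using assms
proof (induction k arbitrary: u v)
  case 0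
  then show ?case using continuous_on_cong by force
next
  case (Suc k)
  have "Ck_on k M (pd M a v)" for a
    by (rule Suc.IH[of "pd M a u"]) (use Suc.prems pd_congr[of _ M u v] in auto)
  moreover have "v differentiable_on M"
    using Suc.prems differentiable_on_congr by fastforce
  ultimately show ?case by simp
qed

lemma Ck_on_Suc_D:
  assumes "Ck_on (Suc k) M u"
  shows "Ck_on k M u"
  using assms
  by (induction k arbitrary: u) (auto intro: differentiable_imp_continuous_on)

lemma Ck_on_le:
  assumes "Ck_on k M u" "j \<le> k"
  shows "Ck_on j M u"
  using assms(2,1) by (induction rule: dec_induct) (blast dest: Ck_on_Suc_D)+

lemma Ck_on_interior:
  assumes "Ck_on k M u" "\<And>y. y \<in> interior M \<Longrightarrow> u y = v y"
  shows "Ck_on k (interior M) v"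
  using assms
proof (induction k arbitrary: u v)
  case 0
  have "continuous_on (interior M) u"
    by (rule continuous_on_subset[OF _ interior_subset]) (use 0(1) in simp)
  then have "continuous_on (interior M) v"
    using 0(2) by (rule continuous_on_eq)
  then show ?case by simp
next
  case (Suc k)
  have "Ck_on k (interior M) (pd (interior M) a v)" for a
  proof (rule Suc.IH[of "pd M a u"])
    show "pd M a u y = pd (interior M) a v y" if "y \<in> interior M" for y
      using pd_interior[OF that, of v u a] Suc.prems(2) by simp
  qed (use Suc.prems(1) in simp)
  moreover have "u differentiable_on interior M"
    by (rule differentiable_on_subset[OF _ interior_subset]) (use Suc.prems(1) in simp)
  then have "v differentiable_on interior M"
    using Suc.prems(2) by (rule differentiable_on_congr)
  ultimately show ?case by simp
qed

text \<open>
  On a slab that contains its initial slice the derivative within the domain is still unique, because from every point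
  one can move a little along each axis, and the values on the boundary are limits of values in the
  interior. These two properties are all that the calculus below uses.
\<close>

locale regular_domain =
  fixes M :: "(real^4) set"
  assumes dense_interior: "M \<subseteq> closure (interior M)"
    and axis_approach: "x \<in> M \<Longrightarrow> 0 < e \<Longrightarrow> \<exists>d. 0 < \<bar>d\<bar> \<and> \<bar>d\<bar> < e \<and> x + d *\<^sub>R axis i 1 \<in> M"
begin

lemma eq_on_by_density:
  fixes u v :: "real^4 \<Rightarrow> real"
  assumes "continuous_on M u" "continuous_on M v"
    and eq: "\<And>y. y \<in> interior M \<Longrightarrow> u y = v y" and x: "x \<in> M"
  shows "u x = v x"
proof -
  have "x \<in> closure (interior M)"
    using dense_interior x by blast
  then obtain s where s: "\<And>n. s n \<in> interior M" "s \<longlonglongrightarrow> x"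
    by (auto simp: closure_sequential)
  then have sM: "\<And>n. s n \<in> M"
    using interior_subset by blast
  have "(\<lambda>n. u (s n)) \<longlonglongrightarrow> u x" "(\<lambda>n. v (s n)) \<longlonglongrightarrow> v x"
    using assms(1,2) s(2) sM x unfolding continuous_on_sequentially by (auto simp: o_def)
  then show ?thesis
    using eq[OF s(1)] LIMSEQ_unique by simp
qed

lemma pd_eq:
  assumes "x \<in> M" "(u has_derivative u') (at x within M)"
  shows "pd M a u x = u' (axis a 1)"
proof -
  have "(u has_derivative frechet_derivative u (at x within M)) (at x within M)"
    using assms(2) frechet_derivative_works differentiable_def by blast
  then have "frechet_derivative u (at x within M) = u'"
  proof (rule frechet_derivative_unique_within[OF _ assms(2)])
    fix i :: "real^4" and e :: real
    assume "i \<in> Basis" "0 < e"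
    then show "\<exists>d. 0 < \<bar>d\<bar> \<and> \<bar>d\<bar> < e \<and> x + d *\<^sub>R i \<in> M"
      using axis_approach[OF assms(1)] by (auto simp: Basis_vec_def)
  qed
  then show ?thesis by (simp add: pd_def)
qed

lemma pd_works:
  assumes "x \<in> M" "u differentiable_on M"
  obtains u' where "(u has_derivative u') (at x within M)" "\<And>a. pd M a u x = u' (axis a 1)"
  using assms pd_eq unfolding differentiable_on_def differentiable_def by blast

lemma pd_within_const: "x \<in> M \<Longrightarrow> pd M a (\<lambda>y. c) x = 0"
  using pd_eq[OF _ has_derivative_const] .

lemma pd_within_add:
  assumes "x \<in> M" "u differentiable_on M" "v differentiable_on M"
  shows "pd M a (\<lambda>y. u y + v y) x = pd M a u x + pd M a v x"
proof -
  obtain u' v' where "(u has_derivative u') (at x within M)" "\<And>a. pd M a u x = u' (axis a 1)"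
    "(v has_derivative v') (at x within M)" "\<And>a. pd M a v x = v' (axis a 1)"
    using pd_works assms by metis
  then show ?thesis
    using pd_eq[OF assms(1) has_derivative_add] by simp
qed

lemma pd_within_diff:
  assumes "x \<in> M" "u differentiable_on M" "v differentiable_on M"
  shows "pd M a (\<lambda>y. u y - v y) x = pd M a u x - pd M a v x"
proof -
  obtain u' v' where "(u has_derivative u') (at x within M)" "\<And>a. pd M a u x = u' (axis a 1)"
    "(v has_derivative v') (at x within M)" "\<And>a. pd M a v x = v' (axis a 1)"
    using pd_works assms by metis
  then show ?thesis
    using pd_eq[OF assms(1) has_derivative_diff] by simp
qed

lemma pd_within_mult:
  assumes "x \<in> M" "u differentiable_on M" "v differentiable_on M"
  shows "pd M a (\<lambda>y. u y * v y) x = pd M a u x * v x + u x * pd M a v x"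
proof -
  obtain u' v' where "(u has_derivative u') (at x within M)" "\<And>a. pd M a u x = u' (axis a 1)"
    "(v has_derivative v') (at x within M)" "\<And>a. pd M a v x = v' (axis a 1)"
    using pd_works assms by metis
  then show ?thesis
    using pd_eq[OF assms(1) has_derivative_mult] by simp
qed

lemma pd_within_cmult:
  assumes "x \<in> M" "u differentiable_on M"
  shows "pd M a (\<lambda>y. c * u y) x = c * pd M a u x"
  using pd_within_mult[OF assms(1) differentiable_on_const assms(2)] pd_within_const[OF assms(1)]
  by simp

lemma pd_within_sum:
  fixes u :: "'i::finite \<Rightarrow> real^4 \<Rightarrow> real"
  assumes "x \<in> M" "\<And>i. u i differentiable_on M"
  shows "pd M a (\<lambda>y. \<Sum>i\<in>UNIV. u i y) x = (\<Sum>i\<in>UNIV. pd M a (u i) x)"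
proof -
  have "(u i has_derivative frechet_derivative (u i) (at x within M)) (at x within M)" for i
    using assms frechet_derivative_works unfolding differentiable_on_def by blast
  from pd_eq[OF assms(1) has_derivative_sum, of UNIV u, OF this] show ?thesis
    by (simp add: pd_def)
qed

lemma pd_within_chain:
  assumes "x \<in> M" "u differentiable_on M" "(F has_real_derivative F') (at (u x))"
  shows "pd M a (\<lambda>y. F (u y)) x = F' * pd M a u x"
proof -
  obtain u' where u': "(u has_derivative u') (at x within M)" "\<And>a. pd M a u x = u' (axis a 1)"
    using pd_works assms by metis
  have "((\<lambda>y. F (u y)) has_derivative (\<lambda>v. F' * u' v)) (at x within M)"
    using has_derivative_compose[OF u'(1) assms(3)[unfolded has_field_derivative_def]] .
  then show ?thesis
    using pd_eq[OF assms(1)] u'(2) by simp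
qed

lemma differentiable_within_chain:
  assumes "u differentiable_on M" "\<And>x. x \<in> M \<Longrightarrow> (F has_real_derivative F' x) (at (u x))"
  shows "(\<lambda>y. F (u y)) differentiable_on M"
  unfolding differentiable_on_def
proof
  fix x assume "x \<in> M"
  then obtain u' where u': "(u has_derivative u') (at x within M)"
    using pd_works assms by metis
  show "(\<lambda>y. F (u y)) differentiable at x within M"
    using has_derivative_compose[OF u' assms(2)[OF \<open>x \<in> M\<close>, unfolded has_field_derivative_def]]
    unfolding differentiable_def by blast
qed

lemma Ck_on_const: "Ck_on k M (\<lambda>y. c)"
proof (induction k arbitrary: c)
  case (Suc k)
  have "Ck_on k M (pd M a (\<lambda>y. c))" for a
    by (rule Ck_on_congr[OF Suc[of 0]]) (simp add: pd_within_const)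
  then show ?case by simp
qed simp

lemma Ck_on_add:
  assumes "Ck_on k M u" "Ck_on k M v"
  shows "Ck_on k M (\<lambda>y. u y + v y)"
  using assms
proof (induction k arbitrary: u v)
  case (Suc k)
  have "Ck_on k M (\<lambda>y. pd M a u y + pd M a v y)" for a
    using Suc.prems by (intro Suc.IH) auto
  then have "Ck_on k M (pd M a (\<lambda>y. u y + v y))" for a
    by (rule Ck_on_congr) (use Suc.prems in \<open>auto simp: pd_within_add\<close>)
  then show ?case using Suc.prems by simp
qed (simp add: continuous_on_add)

lemma Ck_on_mult:
  assumes "Ck_on k M u" "Ck_on k M v"
  shows "Ck_on k M (\<lambda>y. u y * v y)"
  using assms
proof (induction k arbitrary: u v)
  case (Suc k)
  have "Ck_on k M (\<lambda>y. pd M a u y * v y + u y * pd M a v y)" for a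
    using Suc.prems by (intro Ck_on_add Suc.IH) (auto intro: Ck_on_Suc_D)
  then have "Ck_on k M (pd M a (\<lambda>y. u y * v y))" for a
    by (rule Ck_on_congr) (use Suc.prems in \<open>auto simp: pd_within_mult\<close>)
  then show ?case using Suc.prems by simp
qed (simp add: continuous_on_mult)

lemma Ck_on_minus: "Ck_on k M u \<Longrightarrow> Ck_on k M (\<lambda>y. - u y)"
  using Ck_on_mult[OF Ck_on_const[of k "-1"]] by simp

lemma Ck_on_diff: "Ck_on k M u \<Longrightarrow> Ck_on k M v \<Longrightarrow> Ck_on k M (\<lambda>y. u y - v y)"
  using Ck_on_add[OF _ Ck_on_minus] by simp

lemma Ck_on_sum:
  fixes u :: "'i::finite \<Rightarrow> real^4 \<Rightarrow> real"
  assumes "\<And>i. Ck_on k M (u i)"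
  shows "Ck_on k M (\<lambda>y. \<Sum>i\<in>UNIV. u i y)"
proof -
  have "Ck_on k M (\<lambda>y. \<Sum>i\<in>S. u i y)" if "finite S" for S
    using that by (induction S) (auto intro: Ck_on_const Ck_on_add assms)
  then show ?thesis by simp
qed

lemma Ck_on_divide: "Ck_on k M u \<Longrightarrow> Ck_on k M (\<lambda>y. u y / c)"
  using Ck_on_mult[OF _ Ck_on_const[of k "inverse c"]] by (simp add: divide_inverse)

lemmas Ck_on_intros = Ck_on_const Ck_on_add Ck_on_mult Ck_on_minus Ck_on_diff Ck_on_sum Ck_on_divide

text \<open>Both sides are continuous, so Schwarz's theorem in the interior extends to the boundary.\<close>

lemma pd_within_commute:
  assumes "Ck_on 2 M u" "x \<in> M"
  shows "pd M a (pd M b u) x = pd M b (pd M a u) x"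
proof (rule eq_on_by_density[OF _ _ _ assms(2)])
  fix y assume y: "y \<in> interior M"
  have *: "pd (interior M) c (pd (interior M) d u) y = pd M c (pd M d u) y" for c d
    by (rule pd_interior[OF y], rule pd_interior) simp_all
  show "pd M a (pd M b u) y = pd M b (pd M a u) y"
    using pd_commute[OF open_interior y Ck_on_interior[OF assms(1) refl], of a b]
    unfolding * .
next
  have "continuous_on M (pd M c (pd M d u))" for c d
    using assms(1) by (auto simp: numeral_2_eq_2)
  then show "continuous_on M (pd M a (pd M b u))" "continuous_on M (pd M b (pd M a u))"
    by blast+
qed

end

text \<open>
  A convex set with nonempty interior lies in the closure of its interior. Steps along the axes can
  be taken in the positive direction, which leads away from the boundary.
\<close>

lemma regular_domain_slab:
  assumes "0 < t_max"
  shows "regular_domain (slab t_max)"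
proof
  show "slab t_max \<subseteq> closure (interior (slab t_max))"
  proof -
    have conv: "convex (slab t_max)"
    proof (rule convexI)
      fix x y :: "real^4" and u v :: real
      assume xy: "x \<in> slab t_max" "y \<in> slab t_max" and uv: "0 \<le> u" "0 \<le> v" "u + v = 1"
      have "u * x $ 0 + v * y $ 0 \<le> max (x $ 0) (y $ 0)"
        using convex_bound_le[of "x $ 0" "max (x $ 0) (y $ 0)" "y $ 0" u v] uv by simp
      then have "ereal (u * x $ 0 + v * y $ 0) \<le> ereal (max (x $ 0) (y $ 0))" by (simp only: ereal_less_eq)
      also have "\<dots> < t_max" using xy by (auto simp: slab_def max_def)
      finally show "u *\<^sub>R x + v *\<^sub>R y \<in> slab t_max"
        using xy uv by (auto simp: slab_def)
    qed
    obtain r where r: "0 < ereal r" "ereal r < t_max"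
      using assms ereal_dense2[of 0 t_max] by blast
    let ?U = "{x :: real^4. 0 < x $ 0} \<inter> {x. x $ 0 < r}"
    have "open ?U"
      by (intro open_Int open_Collect_less continuous_intros)
    moreover have "?U \<subseteq> slab t_max"
    proof
      fix x :: "real^4" assume "x \<in> ?U"
      then have "0 \<le> x $ 0" "ereal (x $ 0) < ereal r" by simp_all
      then show "x \<in> slab t_max"
        using r(2) unfolding slab_def by (blast intro: less_trans)
    qed
    moreover have "axis 0 (r/2) \<in> ?U" using r by simp
    ultimately have "axis 0 (r/2) \<in> interior (slab t_max)"
      by (blast intro: interiorI)
    then have "interior (slab t_max) \<noteq> {}"
      by blast
    then have "closure (interior (slab t_max)) = closure (slab t_max)"
      by (rule convex_closure_interior[OF conv])
    then show ?thesis
      by (simp only: closure_subset)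
  qed
next
  fix x :: "real^4" and e :: real and i :: 4
  assume x: "x \<in> slab t_max" and e: "0 < e"
  then obtain r where r: "ereal (x $ 0) < ereal r" "ereal r < t_max"
    using ereal_dense2[of "ereal (x $ 0)" t_max] unfolding slab_def by blast
  define d where "d = min (e / 2) (r - x $ 0)"
  have "x $ 0 < r" using r(1) by simp
  then have d: "0 < d" "d < e" "x $ 0 + d \<le> r"
    using e unfolding d_def by linarith+
  have "x + d *\<^sub>R axis i 1 \<in> slab t_max"
  proof -
    have "ereal (x $ 0 + d) < t_max"
      using d(3) r(2) by (meson ereal_less_eq(3) le_less_trans)
    moreover have "(x + d *\<^sub>R axis i 1) $ 0 = (if i = 0 then x $ 0 + d else x $ 0)"
      by (simp add: axis_def)
    ultimately show ?thesis
      using x d(1) unfolding slab_def by simp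
  qed
  then show "\<exists>d. 0 < \<bar>d\<bar> \<and> \<bar>d\<bar> < e \<and> x + d *\<^sub>R axis i 1 \<in> slab t_max"
    using d by (intro exI[of _ d]) auto
qed

section \<open>Matrix fields\<close>

definition matrix_pd :: "(real^4) set \<Rightarrow> 4 \<Rightarrow> (real^4 \<Rightarrow> real^4^4) \<Rightarrow> real^4 \<Rightarrow> real^4^4" where
  "matrix_pd M c A x = (\<chi> i j. pd M c (\<lambda>y. A y $ i $ j) x)"

lemma matrix_pd_nth: "matrix_pd M c A x $ i $ j = pd M c (\<lambda>y. A y $ i $ j) x"
  by (simp add: matrix_pd_def)

lemma matrix_pd_congr: "x \<in> M \<Longrightarrow> (\<And>y. y \<in> M \<Longrightarrow> A y = B y) \<Longrightarrow> matrix_pd M c A x = matrix_pd M c B x"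
  unfolding matrix_pd_def vec_eq_iff by (auto intro!: pd_congr)

lemma matrix_mult_nth: "(A ** B) $ i $ j = (\<Sum>k\<in>UNIV. A $ i $ k * B $ k $ j)"
  by (simp add: matrix_matrix_mult_def)

lemma kronecker_sum:
  fixes P :: "'i::finite \<Rightarrow> real"
  shows "(\<Sum>d\<in>UNIV. (if k = d then 1 else 0) * P d) = P k" "(\<Sum>d\<in>UNIV. P d * (if k = d then 1 else 0)) = P k"
    "(\<Sum>d\<in>UNIV. (if d = k then 1 else 0) * P d) = P k" "(\<Sum>d\<in>UNIV. P d * (if d = k then 1 else 0)) = P k"
  by (simp_all add: if_distrib[of "\<lambda>t. t * _"] if_distrib[of "\<lambda>t. _ * t"] cong: if_cong)

lemma transpose_nth: "transpose A $ i $ j = A $ j $ i"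
  by (simp add: transpose_def)

lemma matrix_mult_ring:
  fixes A B C :: "real^4^4"
  shows "A ** (B + C) = A ** B + A ** C" "(A + B) ** C = A ** C + B ** C"
    "A ** (B - C) = A ** B - A ** C" "(A - B) ** C = A ** C - B ** C"
    "(- A) ** B = - (A ** B)" "A ** (- B) = - (A ** B)"
    "A ** (B ** C) = A ** B ** C"
  by (auto simp: vec_eq_iff matrix_mult_nth algebra_simps sum.distrib sum_subtractf sum_negf
      matrix_mul_assoc)

lemma transpose_additive:
  fixes A B :: "real^4^4"
  shows "transpose (A + B) = transpose A + transpose B"
    "transpose (A - B) = transpose A - transpose B"
    "transpose (- A) = - transpose A"
  by (simp_all add: vec_eq_iff transpose_nth)

lemma tensor_Ck_on_le: "tensor_Ck_on k M A \<Longrightarrow> j \<le> k \<Longrightarrow> tensor_Ck_on j M A"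
  unfolding tensor_Ck_on_def using Ck_on_le by blast

lemma tensor_Ck_on_congr:
  assumes "tensor_Ck_on k M A" "\<And>y. y \<in> M \<Longrightarrow> A y = B y"
  shows "tensor_Ck_on k M B"
  unfolding tensor_Ck_on_def
proof (intro allI)
  fix i j
  show "Ck_on k M (\<lambda>y. B y $ i $ j)"
    by (rule Ck_on_congr[of k M "\<lambda>y. A y $ i $ j"]) (use assms in \<open>auto simp: tensor_Ck_on_def\<close>)
qed

lemma tensor_Ck_on_transpose: "tensor_Ck_on k M A \<Longrightarrow> tensor_Ck_on k M (\<lambda>y. transpose (A y))"
  by (simp add: tensor_Ck_on_def transpose_nth)

lemma tensor_Ck_on_differentiable:
  "tensor_Ck_on (Suc k) M A \<Longrightarrow> (\<lambda>y. A y $ i $ j) differentiable_on M"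
  by (simp add: tensor_Ck_on_def)

lemma tensor_Ck_on_matrix_pd: "tensor_Ck_on (Suc k) M A \<Longrightarrow> tensor_Ck_on k M (matrix_pd M c A)"
  by (simp add: tensor_Ck_on_def matrix_pd_nth)

context regular_domain
begin

lemma tensor_Ck_on_add:
  "tensor_Ck_on k M A \<Longrightarrow> tensor_Ck_on k M B \<Longrightarrow> tensor_Ck_on k M (\<lambda>y. A y + B y)"
  by (simp add: tensor_Ck_on_def Ck_on_add)

lemma tensor_Ck_on_diff:
  "tensor_Ck_on k M A \<Longrightarrow> tensor_Ck_on k M B \<Longrightarrow> tensor_Ck_on k M (\<lambda>y. A y - B y)"
  by (simp add: tensor_Ck_on_def Ck_on_diff)

lemma tensor_Ck_on_minus: "tensor_Ck_on k M A \<Longrightarrow> tensor_Ck_on k M (\<lambda>y. - A y)"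
  by (simp add: tensor_Ck_on_def Ck_on_minus)

lemma tensor_Ck_on_mult:
  "tensor_Ck_on k M A \<Longrightarrow> tensor_Ck_on k M B \<Longrightarrow> tensor_Ck_on k M (\<lambda>y. A y ** B y)"
  by (simp add: tensor_Ck_on_def matrix_mult_nth Ck_on_sum Ck_on_mult)

lemmas tensor_Ck_on_intros = tensor_Ck_on_add tensor_Ck_on_diff tensor_Ck_on_minus
  tensor_Ck_on_mult tensor_Ck_on_transpose

lemma matrix_pd_add:
  "x \<in> M \<Longrightarrow> tensor_Ck_on 1 M A \<Longrightarrow> tensor_Ck_on 1 M B \<Longrightarrow>
    matrix_pd M c (\<lambda>y. A y + B y) x = matrix_pd M c A x + matrix_pd M c B x"
  by (simp add: vec_eq_iff matrix_pd_nth pd_within_add tensor_Ck_on_differentiable)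

lemma matrix_pd_diff:
  "x \<in> M \<Longrightarrow> tensor_Ck_on 1 M A \<Longrightarrow> tensor_Ck_on 1 M B \<Longrightarrow>
    matrix_pd M c (\<lambda>y. A y - B y) x = matrix_pd M c A x - matrix_pd M c B x"
  by (simp add: vec_eq_iff matrix_pd_nth pd_within_diff tensor_Ck_on_differentiable)

lemma matrix_pd_minus:
  "x \<in> M \<Longrightarrow> tensor_Ck_on 1 M A \<Longrightarrow> matrix_pd M c (\<lambda>y. - A y) x = - matrix_pd M c A x"
  using pd_within_cmult[of x _ c "-1"] tensor_Ck_on_differentiable[of 0 M A]
  by (simp add: vec_eq_iff matrix_pd_nth)

lemma matrix_pd_mult:
  assumes "x \<in> M" "tensor_Ck_on 1 M A" "tensor_Ck_on 1 M B"
  shows "matrix_pd M c (\<lambda>y. A y ** B y) x = matrix_pd M c A x ** B x + A x ** matrix_pd M c B x"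
proof -
  have "(\<lambda>y. A y $ i $ j) differentiable_on M" "(\<lambda>y. B y $ i $ j) differentiable_on M" for i j
    using assms by (simp_all add: tensor_Ck_on_def)
  then show ?thesis
    using assms(1)
    by (simp add: vec_eq_iff matrix_pd_nth matrix_mult_nth pd_within_sum pd_within_mult sum.distrib)
qed

lemma matrix_pd_transpose: "matrix_pd M c (\<lambda>y. transpose (A y)) x = transpose (matrix_pd M c A x)"
  by (simp add: vec_eq_iff matrix_pd_nth transpose_nth)

lemma matrix_pd_commute:
  "x \<in> M \<Longrightarrow> tensor_Ck_on 2 M A \<Longrightarrow> matrix_pd M c (matrix_pd M d A) x = matrix_pd M d (matrix_pd M c A) x"
  unfolding vec_eq_iff matrix_pd_nth by (simp add: tensor_Ck_on_def pd_within_commute)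

end


section \<open>The Levi-Civita connection and its curvature\<close>

text \<open>
  The connection as matrix-valued one-form, with entries \<open>\<Gamma>\<^sup>a\<^sub>c\<^sub>b\<close>, and its curvature
  \<open>R\<^sup>a\<^sub>b\<^sub>c\<^sub>d\<close> as matrix-valued two-form. In this form metric compatibility and the Bianchi identity
  are identities of matrix algebra.
\<close>

definition connection :: "(real^4) set \<Rightarrow> (real^4 \<Rightarrow> real^4^4) \<Rightarrow> 4 \<Rightarrow> real^4 \<Rightarrow> real^4^4" where
  "connection M G c x = (\<chi> a b. christoffel M G a c b x)"

definition curvature :: "(real^4) set \<Rightarrow> (real^4 \<Rightarrow> real^4^4) \<Rightarrow> 4 \<Rightarrow> 4 \<Rightarrow> real^4 \<Rightarrow> real^4^4" where
  "curvature M G c d x = matrix_pd M c (connection M G d) x - matrix_pd M d (connection M G c) x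
     + connection M G c x ** connection M G d x - connection M G d x ** connection M G c x"

lemma connection_nth: "connection M G c x $ a $ b = christoffel M G a c b x"
  by (simp add: connection_def)

locale metric_domain = regular_domain +
  fixes G :: "real^4 \<Rightarrow> real^4^4"
  assumes G_C2: "tensor_Ck_on 2 M G"
    and G_transpose: "x \<in> M \<Longrightarrow> transpose (G x) = G x"
    and G_invertible: "x \<in> M \<Longrightarrow> invertible (G x)"
begin

abbreviation "ginv x \<equiv> matrix_inv (G x)"

lemma G_sym: "x \<in> M \<Longrightarrow> G x $ a $ b = G x $ b $ a"
  by (metis G_transpose transpose_nth)

lemma h_sym: "x \<in> M \<Longrightarrow> ginv x $ a $ b = ginv x $ b $ a"
  by (rule matrix_inv_sym) (auto simp: G_invertible G_transpose)

lemma h_transpose: "x \<in> M \<Longrightarrow> transpose (ginv x) = ginv x"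
  by (simp add: vec_eq_iff transpose_nth h_sym)

lemmas h_G = matrix_inv_props[OF G_invertible]
lemmas h_G_nth = matrix_inv_mult[OF G_invertible]

lemma dG_sym: "x \<in> M \<Longrightarrow> pd M c (\<lambda>y. G y $ a $ b) x = pd M c (\<lambda>y. G y $ b $ a) x"
  by (rule pd_congr) (auto intro: G_sym)

lemma G_C1: "tensor_Ck_on 1 M G"
  by (rule tensor_Ck_on_le[OF G_C2]) simp

lemma G_differentiable: "(\<lambda>y. G y $ a $ b) differentiable_on M"
  using G_C1 by (simp add: tensor_Ck_on_def)

lemma h_differentiable: "(\<lambda>y. ginv y $ a $ b) differentiable_on M"
  by (rule differentiable_on_matrix_inv[OF G_differentiable G_invertible])

text \<open>
  Differentiate \<open>h G = 1\<close>, where \<open>h\<close> is the inverse metric.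
\<close>

lemma matrix_pd_h_raw:
  assumes x: "x \<in> M"
  shows "matrix_pd M c ginv x = - (ginv x ** matrix_pd M c G x ** ginv x)"
proof -
  have "matrix_pd M c (\<lambda>y. ginv y ** G y) x = matrix_pd M c ginv x ** G x + ginv x ** matrix_pd M c G x"
    using x h_differentiable G_differentiable
    by (simp add: vec_eq_iff matrix_pd_nth matrix_mult_nth pd_within_sum pd_within_mult sum.distrib)
  moreover have "matrix_pd M c (\<lambda>y. ginv y ** G y) x = matrix_pd M c (\<lambda>y. mat 1) x"
    by (rule matrix_pd_congr[OF x]) (simp add: h_G)
  moreover have "matrix_pd M c (\<lambda>y. mat 1) x = 0"
    by (simp add: vec_eq_iff matrix_pd_nth pd_within_const[OF x])
  ultimately have "(matrix_pd M c ginv x ** G x + ginv x ** matrix_pd M c G x) ** ginv x = 0 ** ginv x" by simp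
  then have "matrix_pd M c ginv x ** (G x ** ginv x) + ginv x ** matrix_pd M c G x ** ginv x = 0"
    by (simp add: matrix_mult_ring)
  then show ?thesis
    by (simp add: h_G[OF x] eq_neg_iff_add_eq_0)
qed

text \<open>
  The derivative formula expresses \<open>\<partial>h\<close> through \<open>h\<close> and \<open>\<partial>G\<close>, so the inverse metric gains one degree of
  regularity at a time until it reaches that of the metric.
\<close>

lemma h_Ck:
  assumes "tensor_Ck_on k M G"
  shows "tensor_Ck_on k M ginv"
  using assms
proof (induction k)
  case 0
  then show ?case
    by (simp add: tensor_Ck_on_def differentiable_imp_continuous_on[OF h_differentiable])
next
  case (Suc k)
  have "tensor_Ck_on k M (\<lambda>y. - (ginv y ** matrix_pd M c G y ** ginv y))" for c
    using Suc tensor_Ck_on_matrix_pd tensor_Ck_on_le[OF Suc.prems, of k]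
    by (intro tensor_Ck_on_intros) auto
  then have "tensor_Ck_on k M (matrix_pd M c ginv)" for c
    by (rule tensor_Ck_on_congr) (simp add: matrix_pd_h_raw)
  then show ?case
    using h_differentiable by (simp add: tensor_Ck_on_def matrix_pd_nth)
qed

lemma christoffel_sym: "x \<in> M \<Longrightarrow> christoffel M G a b c x = christoffel M G a c b x"
  unfolding christoffel_def using dG_sym[of x _ b c] by (simp add: algebra_simps)

lemma G_christoffel:
  assumes "x \<in> M"
  shows "(\<Sum>e\<in>UNIV. G x $ k $ e * christoffel M G e a b x) =
    (pd M a (\<lambda>y. G y $ b $ k) x + pd M b (\<lambda>y. G y $ a $ k) x - pd M k (\<lambda>y. G y $ a $ b) x) / 2"
proof -
  let ?D = "\<lambda>d. (pd M a (\<lambda>y. G y $ b $ d) x + pd M b (\<lambda>y. G y $ a $ d) x - pd M d (\<lambda>y. G y $ a $ b) x) / 2"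
  have "(\<Sum>e\<in>UNIV. G x $ k $ e * christoffel M G e a b x) =
      (\<Sum>e\<in>UNIV. \<Sum>d\<in>UNIV. G x $ k $ e * ginv x $ e $ d * ?D d)"
    unfolding christoffel_def sum_distrib_left by (simp add: mult_ac)
  also have "\<dots> = (\<Sum>d\<in>UNIV. (\<Sum>e\<in>UNIV. G x $ k $ e * ginv x $ e $ d) * ?D d)"
    unfolding sum_distrib_right by (rule sum.swap)
  also have "\<dots> = ?D k"
    unfolding h_G_nth(2)[OF assms] by (rule kronecker_sum)
  finally show ?thesis .
qed

lemma connection_Ck:
  assumes "tensor_Ck_on (Suc k) M G"
  shows "tensor_Ck_on k M (connection M G c)"
proof -
  have "Ck_on k M (\<lambda>y. ginv y $ a $ b)" for a b
    using h_Ck[OF tensor_Ck_on_le[OF assms, of k]] by (simp add: tensor_Ck_on_def)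
  moreover have "Ck_on k M (pd M c (\<lambda>y. G y $ a $ b))" for a b c
    using assms by (simp add: tensor_Ck_on_def)
  ultimately show ?thesis
    unfolding tensor_Ck_on_def connection_nth christoffel_def
    by (intro allI Ck_on_intros)
qed

lemma christoffel_Ck: "tensor_Ck_on (Suc k) M G \<Longrightarrow> Ck_on k M (christoffel M G a b c)"
  using connection_Ck[of k b] unfolding tensor_Ck_on_def connection_nth by blast

lemma connection_C1: "tensor_Ck_on 1 M (connection M G c)"
  using connection_Ck[of 1] G_C2 by (simp add: numeral_2_eq_2)

text \<open>
  \<open>\<nabla>G = 0\<close> and \<open>\<nabla>h = 0\<close>, the first here and the second in \<open>matrix_pd_h\<close>.
\<close>

lemma metric_compatible:
  assumes "x \<in> M"
  shows "matrix_pd M c G x = G x ** connection M G c x + transpose (connection M G c x) ** G x"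
proof -
  have "matrix_pd M c G x $ a $ b = (G x ** connection M G c x + transpose (connection M G c x) ** G x) $ a $ b" for a b
  proof -
    have "(transpose (connection M G c x) ** G x) $ a $ b = (\<Sum>e\<in>UNIV. G x $ b $ e * christoffel M G e c a x)"
      by (simp add: matrix_mult_nth transpose_nth connection_nth G_sym[OF assms, of b] mult.commute)
    moreover have "(G x ** connection M G c x) $ a $ b = (\<Sum>e\<in>UNIV. G x $ a $ e * christoffel M G e c b x)"
      by (simp add: matrix_mult_nth connection_nth)
    ultimately show ?thesis
      unfolding vector_add_component G_christoffel[OF assms]
      by (simp add: matrix_pd_nth dG_sym[OF assms, of _ b a])
  qed
  then show ?thesis by (simp add: vec_eq_iff)
qed

lemma matrix_pd_h:
  assumes x: "x \<in> M"
  shows "matrix_pd M c ginv x = - (connection M G c x ** ginv x + ginv x ** transpose (connection M G c x))"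
proof -
  have "matrix_pd M c ginv x = - (ginv x ** G x ** connection M G c x ** ginv x
      + ginv x ** transpose (connection M G c x) ** (G x ** ginv x))"
    unfolding matrix_pd_h_raw[OF x] metric_compatible[OF x] by (simp add: matrix_mult_ring)
  then show ?thesis by (simp add: h_G[OF x])
qed

lemma pd_h:
  assumes "x \<in> M"
  shows "pd M c (\<lambda>y. ginv y $ a $ b) x =
    - (\<Sum>f\<in>UNIV. christoffel M G a c f x * ginv x $ f $ b + christoffel M G b c f x * ginv x $ a $ f)"
  using arg_cong[OF matrix_pd_h[OF assms], of "\<lambda>A. A $ a $ b" c]
  by (simp add: matrix_pd_nth matrix_mult_nth transpose_nth connection_nth sum.distrib mult.commute)

lemma curvature_Ck:
  assumes "tensor_Ck_on (Suc (Suc k)) M G"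
  shows "tensor_Ck_on k M (curvature M G c d)"
proof -
  note connection_Ck[OF assms] connection_Ck[OF tensor_Ck_on_le[OF assms, of "Suc k"]]
  then show ?thesis
    unfolding curvature_def by (intro tensor_Ck_on_intros tensor_Ck_on_matrix_pd) auto
qed

lemma curvature_antisym: "curvature M G d c x = - curvature M G c d x"
  by (simp add: curvature_def)

text \<open>
  The two second derivatives of the inverse metric, both computed from \<open>\<nabla>h = 0\<close>, differ by the
  curvature acting on the two indices of \<open>h\<close>.
\<close>

lemma curvature_h_skew:
  assumes x: "x \<in> M"
  shows "curvature M G c d x ** ginv x + ginv x ** transpose (curvature M G c d x) = 0"
proof -
  let ?A = "\<lambda>c. connection M G c x" and ?h = "ginv x"
  have h1: "tensor_Ck_on 1 M ginv" and h2: "tensor_Ck_on 2 M ginv"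
    using h_Ck G_C1 G_C2 by blast+
  have *: "matrix_pd M e (matrix_pd M f ginv) x =
     - (matrix_pd M e (connection M G f) x ** ?h - ?A f ** (?A e ** ?h + ?h ** transpose (?A e))
        - (?A e ** ?h + ?h ** transpose (?A e)) ** transpose (?A f) + ?h ** transpose (matrix_pd M e (connection M G f) x))"
    for e f
  proof -
    have "matrix_pd M e (matrix_pd M f ginv) x =
        matrix_pd M e (\<lambda>y. - (connection M G f y ** ginv y) - ginv y ** transpose (connection M G f y)) x"
      by (rule matrix_pd_congr[OF x]) (simp add: matrix_pd_h)
    also have "\<dots> = - (matrix_pd M e (connection M G f) x ** ?h + ?A f ** matrix_pd M e ginv x)
        - (matrix_pd M e ginv x ** transpose (?A f) + ?h ** transpose (matrix_pd M e (connection M G f) x))"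
      by (simp only: matrix_pd_minus[OF x] matrix_pd_diff[OF x] matrix_pd_mult[OF x] matrix_pd_transpose tensor_Ck_on_intros h1 connection_C1)
    finally show ?thesis
      unfolding matrix_pd_h[OF x] by (simp add: matrix_mult_ring algebra_simps)
  qed
  have "matrix_pd M c (matrix_pd M d ginv) x = matrix_pd M d (matrix_pd M c ginv) x"
    by (rule matrix_pd_commute[OF x h2])
  then show ?thesis
    unfolding * curvature_def by (simp add: matrix_mult_ring matrix_transpose_mul transpose_additive algebra_simps)
qed

text \<open>
  The Ricci tensor is the contraction of the upper index of the curvature with the first index of
  the two-form. Only the symmetry of the Christoffel symbols separates this from the coordinate formula.
\<close>

lemma ricci_curvature:
  assumes x: "x \<in> M"
  shows "ricci M G a b x = (\<Sum>c\<in>UNIV. curvature M G c a x $ c $ b)"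
proof -
  have 1: "pd M a (christoffel M G c b c) x = pd M a (christoffel M G c c b) x" for c
    by (rule pd_congr[OF x christoffel_sym])
  have 2: "(\<Sum>c\<in>UNIV. \<Sum>d\<in>UNIV. christoffel M G c a b x * christoffel M G d c d x) =
      (\<Sum>c\<in>UNIV. \<Sum>d\<in>UNIV. christoffel M G c c d x * christoffel M G d a b x)"
    by (subst sum.swap) (simp add: christoffel_sym[OF x, of _ _ "_"] mult.commute)
  have 3: "(\<Sum>c\<in>UNIV. \<Sum>d\<in>UNIV. christoffel M G c a d x * christoffel M G d b c x) =
      (\<Sum>c\<in>UNIV. \<Sum>d\<in>UNIV. christoffel M G c a d x * christoffel M G d c b x)"
    by (simp add: christoffel_sym[OF x, of _ b])
  show ?thesis
    unfolding ricci_def curvature_def sum_subtractf 1 2 3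
    by (simp add: matrix_pd_nth connection_nth matrix_mult_nth sum.distrib sum_subtractf)
qed

end

section \<open>The contracted Bianchi identity\<close>

lemma sum_skew:
  fixes P :: "4 \<Rightarrow> 4 \<Rightarrow> real"
  assumes "\<And>i j. P j i = - P i j"
  shows "(\<Sum>i\<in>UNIV. \<Sum>j\<in>UNIV. P i j) = 0"
proof -
  have "(\<Sum>i\<in>UNIV. \<Sum>j\<in>UNIV. P i j) = (\<Sum>j\<in>UNIV. \<Sum>i\<in>UNIV. P i j)"
    by (rule sum.swap)
  also have "\<dots> = - (\<Sum>i\<in>UNIV. \<Sum>j\<in>UNIV. P i j)"
    by (subst assms) (simp add: sum_negf)
  finally show ?thesis by simp
qed

context metric_domain
begin

text \<open>
  The curvature with both matrix indices raised. The identity \<open>curvature_h_skew\<close> then becomes plain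
  skew symmetry, and in its covariant derivative both matrix indices are treated alike.
\<close>

definition curvature_up :: "4 \<Rightarrow> 4 \<Rightarrow> real^4 \<Rightarrow> real^4^4" where
  "curvature_up c d x = curvature M G c d x ** ginv x"

text \<open>
  The covariant derivative with respect to the matrix indices only. The terms for the two-form
  indices cancel in the cyclic sum because the connection is torsion free, so they are left out.
\<close>

definition D_curvature_up :: "4 \<Rightarrow> 4 \<Rightarrow> 4 \<Rightarrow> real^4 \<Rightarrow> real^4^4" where
  "D_curvature_up e c d x = matrix_pd M e (curvature_up c d) x + connection M G e x ** curvature_up c d x
     + curvature_up c d x ** transpose (connection M G e x)"

lemma curvature_up_Ck:
  assumes "tensor_Ck_on (Suc (Suc k)) M G"
  shows "tensor_Ck_on k M (curvature_up c d)"
  unfolding curvature_up_def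
  by (intro tensor_Ck_on_mult curvature_Ck h_Ck assms tensor_Ck_on_le[OF assms, of k]) simp

lemma curvature_up_flip: "curvature_up d c x = - curvature_up c d x"
  by (simp add: curvature_up_def curvature_antisym[of d c] matrix_mult_ring)

lemma curvature_up_skew:
  assumes "x \<in> M"
  shows "curvature_up c d x $ j $ i = - curvature_up c d x $ i $ j"
proof -
  have "transpose (curvature_up c d x) = ginv x ** transpose (curvature M G c d x)"
    by (simp add: curvature_up_def matrix_transpose_mul h_transpose[OF assms])
  then have "transpose (curvature_up c d x) = - curvature_up c d x"
    using curvature_h_skew[OF assms, of c d] by (simp add: curvature_up_def eq_neg_iff_add_eq_0 add.commute)
  then have "transpose (curvature_up c d x) $ i $ j = (- curvature_up c d x) $ i $ j" by simp
  then show ?thesis by (simp add: transpose_nth)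
qed

lemma ricci_curvature_up:
  assumes "x \<in> M"
  shows "(\<Sum>b\<in>UNIV. ricci M G e b x * ginv x $ b $ c) = (\<Sum>d\<in>UNIV. curvature_up d e x $ d $ c)"
  unfolding ricci_curvature[OF assms] curvature_up_def matrix_mult_nth sum_distrib_right
  by (rule sum.swap)

text \<open>
  Since \<open>\<nabla>h = 0\<close>, raising an index commutes with the derivative, and the claim reduces to the matrix
  identity \<open>D\<^sub>e F\<^sub>c\<^sub>d + D\<^sub>c F\<^sub>d\<^sub>e + D\<^sub>d F\<^sub>e\<^sub>c = 0\<close> for \<open>F\<^sub>c\<^sub>d = \<partial>\<^sub>c A\<^sub>d - \<partial>\<^sub>d A\<^sub>c + [A\<^sub>c, A\<^sub>d]\<close>. There the second
  derivatives of \<open>A\<close> cancel by Schwarz's theorem and the commutators by the Jacobi identity.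
\<close>

lemma bianchi_cyclic:
  assumes C3: "tensor_Ck_on 3 M G" and x: "x \<in> M"
  shows "D_curvature_up e c d x + D_curvature_up c d e x + D_curvature_up d e c x = 0"
proof -
  let ?A = "\<lambda>c. connection M G c x" and ?dA = "\<lambda>e c. matrix_pd M e (connection M G c) x"
    and ?F = "\<lambda>c d. curvature M G c d x" and ?h = "ginv x"
  have A2: "tensor_Ck_on 2 M (connection M G c)" for c
    using connection_Ck[of 2] C3 by (simp add: numeral_3_eq_3 numeral_2_eq_2)
  have dA: "tensor_Ck_on 1 M (matrix_pd M e (connection M G c))" for e c
    using tensor_Ck_on_matrix_pd[of 1] A2 by (simp add: numeral_2_eq_2)
  have F1: "tensor_Ck_on 1 M (curvature M G c d)" for c d
    using curvature_Ck[of 1] C3 by (simp add: numeral_3_eq_3)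
  have h1: "tensor_Ck_on 1 M ginv"
    by (rule h_Ck[OF G_C1])
  have dF: "matrix_pd M e (curvature M G c d) x = matrix_pd M e (matrix_pd M c (connection M G d)) x - matrix_pd M e (matrix_pd M d (connection M G c)) x
      + (?dA e c ** ?A d + ?A c ** ?dA e d) - (?dA e d ** ?A c + ?A d ** ?dA e c)" for e c d
    unfolding curvature_def
    by (simp only: matrix_pd_diff[OF x] matrix_pd_add[OF x] matrix_pd_mult[OF x] tensor_Ck_on_intros dA connection_C1)
  have comm: "matrix_pd M e (matrix_pd M c (connection M G d)) x = matrix_pd M c (matrix_pd M e (connection M G d)) x" for e c d
    by (rule matrix_pd_commute[OF x A2])
  have D: "D_curvature_up e c d x = (matrix_pd M e (curvature M G c d) x + ?A e ** ?F c d - ?F c d ** ?A e) ** ?h" for e c d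
  proof -
    have "matrix_pd M e (curvature_up c d) x = matrix_pd M e (curvature M G c d) x ** ?h + ?F c d ** matrix_pd M e ginv x"
      unfolding curvature_up_def by (rule matrix_pd_mult[OF x F1 h1])
    then show ?thesis
      unfolding D_curvature_up_def matrix_pd_h[OF x] curvature_up_def by (simp add: matrix_mult_ring algebra_simps)
  qed
  have cyc: "(matrix_pd M e (curvature M G c d) x + ?A e ** ?F c d - ?F c d ** ?A e)
     + (matrix_pd M c (curvature M G d e) x + ?A c ** ?F d e - ?F d e ** ?A c)
     + (matrix_pd M d (curvature M G e c) x + ?A d ** ?F e c - ?F e c ** ?A d) = 0"
    unfolding dF curvature_def comm[of d c] comm[of d e] comm[of c e]
    by (simp add: matrix_mult_ring algebra_simps)
  show ?thesis
    unfolding D matrix_mult_ring(2)[symmetric] cyc by (simp add: vec_eq_iff matrix_mult_nth)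
qed

text \<open>
  Contract the two raised matrix indices with the indices \<open>c\<close>, \<open>d\<close> of the cyclic sum. Skew symmetry in
  both pairs makes the second and third term of the sum equal, and every contraction of the curvature
  that remains is a mixed Ricci tensor \<open>q\<close>. Up to a factor of 2 the result is
  \<open>\<nabla>\<^sub>c q\<^sub>e\<^sup>c = \<partial>\<^sub>e R / 2\<close>, with the Christoffel symbols for the lower index of \<open>q\<close> on the left-hand side.
\<close>

lemma contracted_bianchi:
  assumes C3: "tensor_Ck_on 3 M G" and x: "x \<in> M"
  defines "q \<equiv> \<lambda>e c y. \<Sum>b\<in>UNIV. ricci M G e b y * ginv y $ b $ c"
  shows "pd M e (\<lambda>y. \<Sum>c\<in>UNIV. q c c y) x + 2 * (\<Sum>c\<in>UNIV. \<Sum>f\<in>UNIV. christoffel M G c e f x * q c f x)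
    = 2 * (\<Sum>c\<in>UNIV. pd M c (q e c) x) + 2 * (\<Sum>c\<in>UNIV. \<Sum>f\<in>UNIV. christoffel M G c c f x * q e f x)"
proof -
  let ?K = "\<lambda>c d. curvature_up c d x" and ?A = "\<lambda>c. connection M G c x"
  have K1: "tensor_Ck_on 1 M (curvature_up c d)" for c d
    using curvature_up_Ck[of 1] C3 by (simp add: numeral_3_eq_3)
  then have dK: "(\<lambda>y. curvature_up c d y $ i $ j) differentiable_on M" for c d i j
    by (simp add: tensor_Ck_on_def)
  have q1: "(\<Sum>d\<in>UNIV. curvature_up d e y $ d $ c) = q e c y" if "y \<in> M" for e c y
    using ricci_curvature_up[OF that] by (simp add: q_def)
  have q2: "(\<Sum>d\<in>UNIV. curvature_up d e y $ c $ d) = - q e c y" if "y \<in> M" for e c y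
    unfolding q1[OF that, symmetric] sum_negf[symmetric] by (simp add: curvature_up_skew[OF that, of _ _ _ c])
  have q3: "(\<Sum>d\<in>UNIV. curvature_up e d y $ c $ d) = q e c y" if "y \<in> M" for e c y
    using q2[OF that, of e c] by (simp add: curvature_up_flip[of e] sum_negf)
  have dK_flip: "matrix_pd M e (curvature_up d c) x $ i $ j = matrix_pd M e (curvature_up c d) x $ j $ i" for e c d i j
    unfolding matrix_pd_nth by (rule pd_congr[OF x]) (simp add: curvature_up_flip[of d] curvature_up_skew[of _ c d i j])
  have K_flip: "?K d c $ i $ j = ?K c d $ j $ i" for c d i j
    by (simp add: curvature_up_flip[of d] curvature_up_skew[OF x, of c d i j])
  have D_flip: "D_curvature_up e d c x $ i $ j = D_curvature_up e c d x $ j $ i" for e c d i j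
    by (simp add: D_curvature_up_def dK_flip[of e d] matrix_mult_nth transpose_nth K_flip[of d c] mult.commute)
  define S where "S P = (\<Sum>c\<in>UNIV. \<Sum>d\<in>UNIV. P c d)" for P :: "4 \<Rightarrow> 4 \<Rightarrow> real"
  have "S (\<lambda>c d. (D_curvature_up e c d x + D_curvature_up c d e x + D_curvature_up d e c x) $ c $ d) = 0"
    unfolding bianchi_cyclic[OF C3 x] S_def by simp
  then have "S (\<lambda>c d. D_curvature_up e c d x $ c $ d) + S (\<lambda>c d. D_curvature_up c d e x $ c $ d)
      + S (\<lambda>c d. D_curvature_up d e c x $ c $ d) = 0"
    by (simp add: S_def sum.distrib)
  moreover have "S (\<lambda>c d. D_curvature_up d e c x $ c $ d) = S (\<lambda>c d. D_curvature_up c d e x $ c $ d)"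
    unfolding S_def by (subst sum.swap) (simp add: D_flip[of _ e])
  ultimately have main: "S (\<lambda>c d. D_curvature_up e c d x $ c $ d) + 2 * S (\<lambda>c d. D_curvature_up c d e x $ c $ d) = 0"
    by simp
  have T1: "S (\<lambda>c d. D_curvature_up e c d x $ c $ d) = pd M e (\<lambda>y. \<Sum>c\<in>UNIV. q c c y) x
     + 2 * (\<Sum>c\<in>UNIV. \<Sum>f\<in>UNIV. christoffel M G c e f x * q c f x)"
  proof -
    have "S (\<lambda>c d. matrix_pd M e (curvature_up c d) x $ c $ d) = pd M e (\<lambda>y. \<Sum>c\<in>UNIV. \<Sum>d\<in>UNIV. curvature_up c d y $ c $ d) x"
      by (simp add: S_def matrix_pd_nth pd_within_sum[OF x] dK differentiable_on_sum_UNIV)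
    also have "\<dots> = pd M e (\<lambda>y. \<Sum>c\<in>UNIV. q c c y) x"
      by (rule pd_congr[OF x]) (simp add: q3)
    finally have 1: "S (\<lambda>c d. matrix_pd M e (curvature_up c d) x $ c $ d) = \<dots>" .
    have "S (\<lambda>c d. (?A e ** ?K c d) $ c $ d) =
        (\<Sum>c\<in>UNIV. \<Sum>f\<in>UNIV. \<Sum>d\<in>UNIV. ?A e $ c $ f * ?K c d $ f $ d)"
      unfolding S_def matrix_mult_nth by (rule sum.cong[OF refl], rule sum.swap)
    then have 2: "S (\<lambda>c d. (?A e ** ?K c d) $ c $ d) = (\<Sum>c\<in>UNIV. \<Sum>f\<in>UNIV. christoffel M G c e f x * q c f x)"
      unfolding sum_distrib_left[symmetric] q3[OF x] by (simp add: connection_nth)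
    have "S (\<lambda>c d. (?K c d ** transpose (?A e)) $ c $ d) = S (\<lambda>c d. (?K d c ** transpose (?A e)) $ d $ c)"
      unfolding S_def by (rule sum.swap)
    also have "\<dots> = S (\<lambda>c d. (?A e ** ?K c d) $ c $ d)"
      by (simp add: S_def matrix_mult_nth transpose_nth K_flip[of _ c for c] mult.commute)
    finally show ?thesis
      using 1 2 by (simp add: D_curvature_up_def S_def sum.distrib)
  qed
  have T2: "S (\<lambda>c d. D_curvature_up c d e x $ c $ d) = - (\<Sum>c\<in>UNIV. pd M c (q e c) x)
     - (\<Sum>c\<in>UNIV. \<Sum>f\<in>UNIV. christoffel M G c c f x * q e f x)"
  proof -
    have "(\<Sum>d\<in>UNIV. matrix_pd M c (curvature_up d e) x $ c $ d) = - pd M c (q e c) x" for c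
    proof -
      have "(\<Sum>d\<in>UNIV. matrix_pd M c (curvature_up e d) x $ c $ d) = pd M c (\<lambda>y. \<Sum>d\<in>UNIV. curvature_up e d y $ c $ d) x"
        by (simp add: matrix_pd_nth pd_within_sum[OF x] dK)
      also have "\<dots> = pd M c (q e c) x"
        by (rule pd_congr[OF x q3])
      finally show ?thesis
        unfolding curvature_up_flip[of _ e, abs_def] by (simp add: matrix_pd_minus[OF x K1] sum_negf)
    qed
    then have 1: "S (\<lambda>c d. matrix_pd M c (curvature_up d e) x $ c $ d) = - (\<Sum>c\<in>UNIV. pd M c (q e c) x)"
      by (simp add: S_def sum_negf)
    have "S (\<lambda>c d. (?A c ** ?K d e) $ c $ d) =
        (\<Sum>c\<in>UNIV. \<Sum>f\<in>UNIV. \<Sum>d\<in>UNIV. ?A c $ c $ f * ?K d e $ f $ d)"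
      unfolding S_def matrix_mult_nth by (rule sum.cong[OF refl], rule sum.swap)
    then have 2: "S (\<lambda>c d. (?A c ** ?K d e) $ c $ d) = - (\<Sum>c\<in>UNIV. \<Sum>f\<in>UNIV. christoffel M G c c f x * q e f x)"
      unfolding sum_distrib_left[symmetric] q2[OF x] by (simp add: connection_nth sum_negf)
    have "S (\<lambda>c d. (?K d e ** transpose (?A c)) $ c $ d) =
        (\<Sum>d\<in>UNIV. \<Sum>c\<in>UNIV. \<Sum>f\<in>UNIV. ?K d e $ c $ f * christoffel M G d c f x)"
      unfolding S_def matrix_mult_nth transpose_nth connection_nth by (rule sum.swap)
    also have "\<dots> = (\<Sum>d\<in>(UNIV :: 4 set). 0)"
    proof (rule sum.cong[OF refl], rule sum_skew)
      fix d i j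
      show "?K d e $ j $ i * christoffel M G d j i x = - (?K d e $ i $ j * christoffel M G d i j x)"
        using curvature_up_skew[OF x, of d e i j] christoffel_sym[OF x, of d i j] by simp
    qed
    \<comment> \<open>The connection is symmetric and the curvature skew in the same two indices.\<close>
    finally have 3: "S (\<lambda>c d. (?K d e ** transpose (?A c)) $ c $ d) = 0" by simp
    show ?thesis
      using 1 2 3 by (simp add: D_curvature_up_def S_def sum.distrib)
  qed
  show ?thesis
    using main unfolding T1 T2 by simp
qed

text \<open>
  The cyclic sum of the curvature over its three lower indices vanishes because the connection is
  torsion free. Contracting it leaves the two transposed Ricci tensors and the matrix trace of the
  curvature, which is the contraction of a skew tensor with the metric.
\<close>

lemma ricci_sym:
  assumes x: "x \<in> M"
  shows "ricci M G a b x = ricci M G b a x"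
proof -
  let ?F = "\<lambda>c d. curvature M G c d x" and ?A = "\<lambda>c. connection M G c x"
  have Asym: "?A c $ a $ b = ?A b $ a $ c" for a b c
    by (simp add: connection_nth christoffel_sym[OF x])
  have dA: "matrix_pd M e (connection M G c) x $ a $ b = matrix_pd M e (connection M G b) x $ a $ c" for a b c e
    unfolding matrix_pd_nth by (rule pd_congr[OF x]) (simp add: connection_nth christoffel_sym)
  have AA: "(?A c ** ?A d) $ a $ b = (?A c ** ?A b) $ a $ d" for a b c d
    unfolding matrix_mult_nth by (intro sum.cong refl) (metis Asym)
  have cyc: "?F c d $ a $ b + ?F d b $ a $ c + ?F b c $ a $ d = 0" for a b c d
    unfolding curvature_def vector_add_component vector_minus_component
    using dA[of c d a b] dA[of d b a c] dA[of b c a d] AA[of c d a b] AA[of d b a c] AA[of b c a d] by simp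
  have tr0: "(\<Sum>c\<in>UNIV. ?F a b $ c $ c) = 0"
  proof -
    have "?F a b = curvature_up a b x ** G x"
      unfolding curvature_up_def by (simp add: matrix_mul_assoc[symmetric] h_G[OF x])
    then have "(\<Sum>c\<in>UNIV. ?F a b $ c $ c) = (\<Sum>c\<in>UNIV. \<Sum>d\<in>UNIV. curvature_up a b x $ c $ d * G x $ d $ c)"
      by (simp add: matrix_mult_nth)
    also have "\<dots> = 0"
      by (rule sum_skew) (subst curvature_up_skew[OF x], subst G_sym[OF x], simp)
    finally show ?thesis .
  qed
  have "(\<Sum>c\<in>UNIV. ?F c a $ c $ b + ?F a b $ c $ c + ?F b c $ c $ a) = 0"
    by (simp add: cyc)
  then show ?thesis
    unfolding ricci_curvature[OF x] curvature_antisym[of b] sum.distrib tr0 by (simp add: sum_negf)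
qed

end

section \<open>The reduced divergence\<close>

context metric_domain
begin

definition contract :: "real^4 \<Rightarrow> (4 \<Rightarrow> 4 \<Rightarrow> real) \<Rightarrow> real" where
  "contract x P = (\<Sum>a\<in>UNIV. \<Sum>b\<in>UNIV. ginv x $ a $ b * P a b)"

lemma contract_linear:
  "contract x (\<lambda>a b. P a b + Q a b) = contract x P + contract x Q"
  "contract x (\<lambda>a b. P a b - Q a b) = contract x P - contract x Q"
  "contract x (\<lambda>a b. k * P a b) = k * contract x P"
  "contract x (\<lambda>a b. P a b * k) = contract x P * k"
  "contract x (\<lambda>a b. P a b / k) = contract x P / k"
  by (simp_all add: contract_def algebra_simps sum.distrib sum_subtractf sum_distrib_left
      sum_distrib_right sum_divide_distrib)

lemma contract_swap: "x \<in> M \<Longrightarrow> contract x (\<lambda>a b. P b a) = contract x P"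
  unfolding contract_def by (subst sum.swap) (simp add: h_sym)

lemma contract_G_index: "x \<in> M \<Longrightarrow> contract x (\<lambda>a c. v c * G x $ a $ b) = v b"
  unfolding contract_def
proof (subst sum.swap)
  assume x: "x \<in> M"
  have "(\<Sum>a\<in>UNIV. ginv x $ a $ c * (v c * G x $ a $ b)) = v c * (\<Sum>a\<in>UNIV. ginv x $ c $ a * G x $ a $ b)" for c
    by (simp add: sum_distrib_left h_sym[OF x, of _ c] mult_ac)
  then show "(\<Sum>c\<in>UNIV. \<Sum>a\<in>UNIV. ginv x $ a $ c * (v c * G x $ a $ b)) = v b"
    by (simp only: h_G_nth(1)[OF x] kronecker_sum)
qed

lemma contract_G:
  assumes x: "x \<in> M"
  shows "contract x (\<lambda>a c. G x $ a $ c) = 4"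
proof -
  have "(\<Sum>c\<in>UNIV. ginv x $ a $ c * G x $ a $ c) = (\<Sum>c\<in>UNIV. ginv x $ a $ c * G x $ c $ a)" for a
    by (rule sum.cong[OF refl]) (subst G_sym[OF x], rule refl)
  then show ?thesis
    by (simp add: contract_def h_G_nth(1)[OF x])
qed

lemma pd_contract:
  assumes x: "x \<in> M" and S: "\<And>a b. S a b differentiable_on M"
  shows "pd M e (\<lambda>y. contract y (\<lambda>a b. S a b y)) x =
    (\<Sum>a\<in>UNIV. \<Sum>b\<in>UNIV. pd M e (\<lambda>y. ginv y $ a $ b) x * S a b x) + contract x (\<lambda>a b. pd M e (S a b) x)"
  by (simp add: contract_def pd_within_sum[OF x] pd_within_mult[OF x] h_differentiable S
      differentiable_on_sum_UNIV differentiable_on_mult sum.distrib)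

lemma contract_differentiable:
  "(\<And>a b. S a b differentiable_on M) \<Longrightarrow> (\<lambda>y. contract y (\<lambda>a b. S a b y)) differentiable_on M"
  unfolding contract_def by (intro differentiable_on_sum_UNIV differentiable_on_mult h_differentiable)

lemma reduced_wave_contract: "reduced_wave M G u x = contract x (\<lambda>a b. pd M a (pd M b u) x)"
  by (simp add: reduced_wave_def contract_def)

lemma wave_gauge_contract: "wave_gauge M G c x = contract x (\<lambda>a b. christoffel M G c a b x)"
  by (simp add: wave_gauge_def contract_def)

lemma sum_contract: "(\<Sum>i\<in>UNIV. contract x (P i)) = contract x (\<lambda>a b. \<Sum>i\<in>UNIV. P i a b)"
  unfolding contract_def sum_distrib_left
  by (subst sum.swap, rule sum.cong[OF refl], rule sum.swap)

lemma wave_gauge_low_eq: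
  assumes x: "x \<in> M"
  shows "wave_gauge_low M G k x =
    contract x (\<lambda>a b. pd M a (\<lambda>y. G y $ b $ k) x) - contract x (\<lambda>a b. pd M k (\<lambda>y. G y $ a $ b) x) / 2"
proof -
  have "wave_gauge_low M G k x = contract x (\<lambda>a b. \<Sum>d\<in>UNIV. G x $ k $ d * christoffel M G d a b x)"
    unfolding wave_gauge_low_def wave_gauge_contract by (simp add: contract_linear sum_contract[symmetric])
  also have "\<dots> = (contract x (\<lambda>a b. pd M a (\<lambda>y. G y $ b $ k) x) + contract x (\<lambda>a b. pd M b (\<lambda>y. G y $ a $ k) x)
      - contract x (\<lambda>a b. pd M k (\<lambda>y. G y $ a $ b) x)) / 2"
    unfolding G_christoffel[OF x] by (simp add: contract_linear)
  also have "contract x (\<lambda>a b. pd M b (\<lambda>y. G y $ a $ k) x) = contract x (\<lambda>a b. pd M a (\<lambda>y. G y $ b $ k) x)"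
    using contract_swap[OF x, of "\<lambda>a b. pd M a (\<lambda>y. G y $ b $ k) x"] .
  finally show ?thesis by simp
qed

lemma wave_gauge_eq:
  assumes x: "x \<in> M"
  shows "wave_gauge M G c x = (\<Sum>d\<in>UNIV. ginv x $ c $ d * wave_gauge_low M G d x)"
proof -
  have "(\<Sum>d\<in>UNIV. ginv x $ c $ d * wave_gauge_low M G d x) =
      (\<Sum>d\<in>UNIV. \<Sum>e\<in>UNIV. ginv x $ c $ d * G x $ d $ e * wave_gauge M G e x)"
    by (simp add: wave_gauge_low_def sum_distrib_left mult_ac)
  also have "\<dots> = (\<Sum>e\<in>UNIV. (\<Sum>d\<in>UNIV. ginv x $ c $ d * G x $ d $ e) * wave_gauge M G e x)"
    unfolding sum_distrib_right by (rule sum.swap)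
  finally show ?thesis
    by (simp only: h_G_nth(1)[OF x] kronecker_sum)
qed

lemma wave_gauge_Ck:
  assumes "tensor_Ck_on (Suc k) M G"
  shows "Ck_on k M (wave_gauge M G c)" "Ck_on k M (wave_gauge_low M G c)"
proof -
  have h: "Ck_on k M (\<lambda>y. ginv y $ a $ b)" and G: "Ck_on k M (\<lambda>y. G y $ a $ b)" for a b
    using h_Ck[OF tensor_Ck_on_le[OF assms, of k]] tensor_Ck_on_le[OF assms, of k]
    by (simp_all add: tensor_Ck_on_def)
  show *: "Ck_on k M (wave_gauge M G c)" for c
    unfolding wave_gauge_def[abs_def] by (intro Ck_on_sum Ck_on_mult h christoffel_Ck[OF assms])
  show "Ck_on k M (wave_gauge_low M G c)"
    unfolding wave_gauge_low_def[abs_def] by (intro Ck_on_sum Ck_on_mult G *)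
qed

text \<open>
  Contracting \<open>\<nabla>h = 0\<close> produces the gauge functions; this is how they enter all divergences below.
\<close>

lemma div_h:
  assumes x: "x \<in> M"
  shows "(\<Sum>c\<in>UNIV. pd M c (\<lambda>y. ginv y $ b $ c) x) =
    - wave_gauge M G b x - (\<Sum>c\<in>UNIV. \<Sum>f\<in>UNIV. christoffel M G c c f x * ginv x $ b $ f)"
  unfolding pd_h[OF x] wave_gauge_def
  by (simp add: sum_negf sum.distrib sum_subtractf h_sym[OF x] mult.commute)

text \<open>
  For symmetric \<open>S\<close> this is \<open>\<nabla>\<^sup>a S\<^sub>a\<^sub>b - \<partial>\<^sub>b (tr S) / 2\<close>. The derivatives of the metric in the second term
  cancel against one of the two Christoffel terms of the divergence, and the other one contracts to
  \<open>\<Gamma>\<^sup>d\<close>; so no Christoffel symbol appears except through the gauge functions.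
\<close>

definition reduced_div :: "(4 \<Rightarrow> 4 \<Rightarrow> real^4 \<Rightarrow> real) \<Rightarrow> 4 \<Rightarrow> real^4 \<Rightarrow> real" where
  "reduced_div S b x = contract x (\<lambda>a c. pd M c (S a b) x - pd M b (S a c) x / 2)
     - (\<Sum>d\<in>UNIV. wave_gauge M G d x * S d b x)"

lemma reduced_div_congr:
  assumes "x \<in> M" "\<And>a b y. y \<in> M \<Longrightarrow> S a b y = S' a b y"
  shows "reduced_div S b x = reduced_div S' b x"
  unfolding reduced_div_def using assms by (simp add: pd_congr[OF assms(1), of "S _ _" "S' _ _"])

lemma reduced_div_add:
  assumes "x \<in> M" "\<And>a b. S a b differentiable_on M" "\<And>a b. S' a b differentiable_on M"
  shows "reduced_div (\<lambda>a b y. S a b y + S' a b y) b x = reduced_div S b x + reduced_div S' b x"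
  using assms by (simp add: reduced_div_def pd_within_add contract_linear algebra_simps sum.distrib add_divide_distrib)

lemma reduced_div_cmult:
  assumes "x \<in> M" "\<And>a b. S a b differentiable_on M"
  shows "reduced_div (\<lambda>a b y. k * S a b y) b x = k * reduced_div S b x"
proof -
  have "reduced_div (\<lambda>a b y. k * S a b y) b x = contract x (\<lambda>a c. k * (pd M c (S a b) x - pd M b (S a c) x / 2))
     - (\<Sum>d\<in>UNIV. k * (wave_gauge M G d x * S d b x))"
    using assms by (simp add: reduced_div_def pd_within_cmult algebra_simps)
  then show ?thesis
    unfolding contract_linear(3) sum_distrib_left[symmetric] reduced_div_def by (simp add: right_diff_distrib)
qed

lemma reduced_div_mult:
  assumes x: "x \<in> M" and S: "\<And>a b. S a b differentiable_on M" and \<phi>: "\<phi> differentiable_on M"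
  shows "reduced_div (\<lambda>a b y. \<phi> y * S a b y) b x = \<phi> x * reduced_div S b x
     + contract x (\<lambda>a c. pd M c \<phi> x * S a b x) - pd M b \<phi> x * contract x (\<lambda>a c. S a c x) / 2"
proof -
  have "reduced_div (\<lambda>a b y. \<phi> y * S a b y) b x =
      contract x (\<lambda>a c. \<phi> x * (pd M c (S a b) x - pd M b (S a c) x / 2) + pd M c \<phi> x * S a b x
        - pd M b \<phi> x * S a c x / 2) - (\<Sum>d\<in>UNIV. \<phi> x * (wave_gauge M G d x * S d b x))"
    by (simp add: reduced_div_def pd_within_mult[OF x] S \<phi> algebra_simps add_divide_distrib)
  then show ?thesis
    unfolding contract_linear sum_distrib_left[symmetric] reduced_div_def contract_linear by (simp add: algebra_simps)
qed

lemma ricci_Ck: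
  assumes "tensor_Ck_on (Suc (Suc k)) M G"
  shows "Ck_on k M (ricci M G a b)"
proof (rule Ck_on_congr)
  show "Ck_on k M (\<lambda>y. \<Sum>c\<in>UNIV. curvature M G c a y $ c $ b)"
    using curvature_Ck[OF assms] by (intro Ck_on_sum) (simp add: tensor_Ck_on_def)
qed (simp add: ricci_curvature)

text \<open>
  The contracted Bianchi identity once more. Its left-hand side is \<open>g\<^sup>a\<^sup>c \<partial>\<^sub>e R\<^sub>a\<^sub>c\<close> (fact \<open>tr\<close>), since the
  derivative of the inverse metric in \<open>\<partial>\<^sub>e R\<close> cancels the connection term; on the right-hand side the
  divergence of the inverse metric leaves only the gauge functions (fact \<open>div\<close>).
\<close>

lemma reduced_div_ricci:
  assumes C3: "tensor_Ck_on 3 M G" and x: "x \<in> M"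
  shows "reduced_div (ricci M G) e x = 0"
proof -
  let ?R = "ricci M G" and ?C = "\<lambda>a b c. christoffel M G a b c x" and ?h = "\<lambda>a b. ginv x $ a $ b"
  have R1: "?R a b differentiable_on M" for a b
    using ricci_Ck[of 1] C3 by (simp add: numeral_3_eq_3)
  have q: "pd M c (\<lambda>y. \<Sum>b\<in>UNIV. ?R e b y * ginv y $ b $ f) x =
     (\<Sum>b\<in>UNIV. pd M c (?R e b) x * ?h b f) + (\<Sum>b\<in>UNIV. ?R e b x * pd M c (\<lambda>y. ginv y $ b $ f) x)" for e c f
    by (simp add: pd_within_sum[OF x] pd_within_mult[OF x] R1 h_differentiable
        differentiable_on_mult sum.distrib)
  have dR: "pd M c (?R e b) x = pd M c (?R b e) x" for b c
    by (rule pd_congr[OF x ricci_sym])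
  have div: "(\<Sum>c\<in>UNIV. pd M c (\<lambda>y. \<Sum>b\<in>UNIV. ?R e b y * ginv y $ b $ c) x)
     + (\<Sum>c\<in>UNIV. \<Sum>f\<in>UNIV. ?C c c f * (\<Sum>b\<in>UNIV. ?R e b x * ?h b f))
     = contract x (\<lambda>a c. pd M c (?R a e) x) - (\<Sum>d\<in>UNIV. wave_gauge M G d x * ?R d e x)"
  proof -
    have 1: "(\<Sum>c\<in>UNIV. \<Sum>b\<in>UNIV. pd M c (?R e b) x * ?h b c) = contract x (\<lambda>a c. pd M c (?R a e) x)"
      unfolding contract_def
      by (subst sum.swap) (simp only: dR mult.commute)
    have 2: "(\<Sum>c\<in>UNIV. \<Sum>b\<in>UNIV. ?R e b x * pd M c (\<lambda>y. ginv y $ b $ c) x) =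
        (\<Sum>b\<in>UNIV. ?R e b x * (- wave_gauge M G b x - (\<Sum>c\<in>UNIV. \<Sum>f\<in>UNIV. ?C c c f * ?h b f)))"
      unfolding div_h[OF x, symmetric] sum_distrib_left by (rule sum.swap)
    have 3: "(\<Sum>b\<in>UNIV. ?R e b x * (\<Sum>c\<in>UNIV. \<Sum>f\<in>UNIV. ?C c c f * ?h b f)) =
        (\<Sum>c\<in>UNIV. \<Sum>f\<in>UNIV. ?C c c f * (\<Sum>b\<in>UNIV. ?R e b x * ?h b f))"
    proof -
      have "(\<Sum>b\<in>UNIV. ?R e b x * (\<Sum>c\<in>UNIV. \<Sum>f\<in>UNIV. ?C c c f * ?h b f)) =
          (\<Sum>b\<in>UNIV. \<Sum>c\<in>UNIV. \<Sum>f\<in>UNIV. ?C c c f * (?R e b x * ?h b f))"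
        by (simp add: sum_distrib_left mult_ac)
      also have "\<dots> = (\<Sum>c\<in>UNIV. \<Sum>b\<in>UNIV. \<Sum>f\<in>UNIV. ?C c c f * (?R e b x * ?h b f))"
        by (rule sum.swap)
      also have "\<dots> = (\<Sum>c\<in>UNIV. \<Sum>f\<in>UNIV. \<Sum>b\<in>UNIV. ?C c c f * (?R e b x * ?h b f))"
        by (rule sum.cong[OF refl], rule sum.swap)
      finally show ?thesis by (simp add: sum_distrib_left)
    qed
    show ?thesis
      unfolding q sum.distrib 1 2 right_diff_distrib sum_subtractf 3
      by (simp add: ricci_sym[OF x, of e] mult.commute sum_negf)
  qed
  have tr: "pd M e (\<lambda>y. \<Sum>c\<in>UNIV. \<Sum>b\<in>UNIV. ?R c b y * ginv y $ b $ c) x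
     + 2 * (\<Sum>c\<in>UNIV. \<Sum>f\<in>UNIV. ?C c e f * (\<Sum>b\<in>UNIV. ?R c b x * ?h b f))
     = contract x (\<lambda>a c. pd M e (?R a c) x)"
  proof -
    have *: "(\<Sum>c\<in>UNIV. \<Sum>b\<in>UNIV. ?R c b y * ginv y $ b $ c) = contract y (\<lambda>a b. ?R a b y)" if "y \<in> M" for y
      by (simp add: contract_def h_sym[OF that] mult.commute)
    have "pd M e (\<lambda>y. \<Sum>c\<in>UNIV. \<Sum>b\<in>UNIV. ?R c b y * ginv y $ b $ c) x =
        (\<Sum>a\<in>UNIV. \<Sum>b\<in>UNIV. pd M e (\<lambda>y. ginv y $ a $ b) x * ?R a b x) + contract x (\<lambda>a b. pd M e (?R a b) x)"
      unfolding pd_contract[OF x R1, symmetric] by (rule pd_congr[OF x *])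
    moreover have "(\<Sum>a\<in>UNIV. \<Sum>b\<in>UNIV. pd M e (\<lambda>y. ginv y $ a $ b) x * ?R a b x) =
        - (\<Sum>a\<in>UNIV. \<Sum>b\<in>UNIV. \<Sum>f\<in>UNIV. ?C a e f * (?R a b x * ?h b f))
        - (\<Sum>a\<in>UNIV. \<Sum>b\<in>UNIV. \<Sum>f\<in>UNIV. ?C b e f * (?R a b x * ?h a f))"
      unfolding pd_h[OF x]
      by (simp add: h_sym[OF x] sum_distrib_right sum_distrib_left sum_negf sum.distrib sum_subtractf algebra_simps)
    moreover have "(\<Sum>a\<in>UNIV. \<Sum>b\<in>UNIV. \<Sum>f\<in>UNIV. ?C b e f * (?R a b x * ?h a f)) =
        (\<Sum>a\<in>UNIV. \<Sum>b\<in>UNIV. \<Sum>f\<in>UNIV. ?C a e f * (?R a b x * ?h b f))"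
      by (subst sum.swap) (simp add: ricci_sym[OF x])
    moreover have "(\<Sum>c\<in>UNIV. \<Sum>f\<in>UNIV. ?C c e f * (\<Sum>b\<in>UNIV. ?R c b x * ?h b f)) =
        (\<Sum>a\<in>UNIV. \<Sum>b\<in>UNIV. \<Sum>f\<in>UNIV. ?C a e f * (?R a b x * ?h b f))"
      unfolding sum_distrib_left by (rule sum.cong[OF refl], rule sum.swap)
    ultimately show ?thesis by simp
  qed
  show ?thesis
    using contracted_bianchi[OF C3 x, of e] div tr unfolding reduced_div_def contract_linear by linarith
qed

text \<open>
  The Hessian terms \<open>\<partial>\<^sup>c\<rho> \<partial>\<^sub>c \<partial>\<^sub>b \<rho>\<close> from the divergence and from the gradient of the trace cancel.
\<close>

lemma reduced_div_gradient:
  assumes \<rho>: "Ck_on 2 M \<rho>" and x: "x \<in> M"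
  shows "reduced_div (\<lambda>a b y. pd M a \<rho> y * pd M b \<rho> y) b x =
    (reduced_wave M G \<rho> x - (\<Sum>d\<in>UNIV. wave_gauge M G d x * pd M d \<rho> x)) * pd M b \<rho> x"
proof -
  have d: "pd M a \<rho> differentiable_on M" for a
    using \<rho> by (simp add: numeral_2_eq_2)
  have "reduced_div (\<lambda>a b y. pd M a \<rho> y * pd M b \<rho> y) b x =
      contract x (\<lambda>a c. pd M c (pd M a \<rho>) x * pd M b \<rho> x
        + (pd M a \<rho> x * pd M b (pd M c \<rho>) x / 2 - pd M c \<rho> x * pd M b (pd M a \<rho>) x / 2))
      - (\<Sum>e\<in>UNIV. wave_gauge M G e x * pd M e \<rho> x * pd M b \<rho> x)"
    unfolding reduced_div_def by (simp add: pd_within_mult[OF x] d pd_within_commute[OF \<rho> x, of _ b] field_simps)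
  also have "\<dots> = contract x (\<lambda>a c. pd M c (pd M a \<rho>) x) * pd M b \<rho> x
      - (\<Sum>e\<in>UNIV. wave_gauge M G e x * pd M e \<rho> x) * pd M b \<rho> x"
    using contract_swap[OF x, of "\<lambda>a c. pd M a \<rho> x * pd M b (pd M c \<rho>) x / 2"]
    by (simp only: contract_linear sum_distrib_right)
  finally show ?thesis
    using contract_swap[OF x, of "\<lambda>a c. pd M a (pd M c \<rho>) x"]
    by (simp add: reduced_wave_contract left_diff_distrib)
qed

text \<open>
  For constant \<open>\<phi>\<close> the reduced divergence vanishes, which is the formula for \<open>\<Gamma>\<^sub>b\<close>. The gradient of \<open>\<phi>\<close>
  enters once through the divergence and, the dimension being 4, minus twice through the trace.
\<close>

lemma reduced_div_metric:
  assumes \<phi>: "\<phi> differentiable_on M" and x: "x \<in> M"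
  shows "reduced_div (\<lambda>a b y. \<phi> y * G y $ a $ b) b x = - pd M b \<phi> x"
proof -
  have "reduced_div (\<lambda>a b y. G y $ a $ b) b x = 0"
  proof -
    have "contract x (\<lambda>a c. pd M c (\<lambda>y. G y $ a $ b) x) = contract x (\<lambda>a c. pd M a (\<lambda>y. G y $ c $ b) x)"
      using contract_swap[OF x, of "\<lambda>a c. pd M a (\<lambda>y. G y $ c $ b) x"] .
    moreover have "(\<Sum>d\<in>UNIV. wave_gauge M G d x * G x $ d $ b) = wave_gauge_low M G b x"
      by (simp add: wave_gauge_low_def G_sym[OF x, of b] mult.commute)
    ultimately show ?thesis
      by (simp add: reduced_div_def contract_linear wave_gauge_low_eq[OF x])
  qed
  then show ?thesis
    using contract_G_index[OF x, of "\<lambda>c. pd M c \<phi> x" b]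
    by (simp add: reduced_div_mult[OF x G_differentiable \<phi>] contract_G[OF x])
qed

text \<open>
  The two sides differ by the contraction of \<open>T\<close> with a Christoffel symbol and by the term of
  \<open>\<partial>\<^sub>b (tr T)\<close> in which the inverse metric is differentiated. By \<open>\<nabla>h = 0\<close> these agree for symmetric \<open>T\<close>.
\<close>

lemma reduced_div_divergence:
  assumes T: "\<And>a b. (\<lambda>y. T y $ a $ b) differentiable_on M" and x: "x \<in> M"
    and sym: "\<And>a b. T x $ a $ b = T x $ b $ a"
  shows "reduced_div (\<lambda>a b y. T y $ a $ b) b x =
    divergence M G T b x - pd M b (\<lambda>y. contract y (\<lambda>a c. T y $ a $ c)) x / 2"
proof -
  let ?C = "\<lambda>a b c. christoffel M G a b c x" and ?h = "\<lambda>a b. ginv x $ a $ b"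
  have 1: "contract x (\<lambda>a c. \<Sum>d\<in>UNIV. ?C d c a * T x $ d $ b) = (\<Sum>d\<in>UNIV. wave_gauge M G d x * T x $ d $ b)"
    unfolding sum_contract[symmetric] contract_linear wave_gauge_contract
    using contract_swap[OF x, of "?C d" for d] by simp
  have "(\<Sum>a\<in>UNIV. \<Sum>d\<in>UNIV. pd M b (\<lambda>y. ginv y $ a $ d) x * T x $ a $ d) =
      - (\<Sum>a\<in>UNIV. \<Sum>d\<in>UNIV. \<Sum>f\<in>UNIV. ?C a b f * ?h f d * T x $ a $ d)
      - (\<Sum>a\<in>UNIV. \<Sum>d\<in>UNIV. \<Sum>f\<in>UNIV. ?C d b f * ?h a f * T x $ a $ d)"
    unfolding pd_h[OF x] by (simp add: sum_distrib_right sum_distrib_left sum_negf sum.distrib sum_subtractf algebra_simps)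
  also have "(\<Sum>a\<in>UNIV. \<Sum>d\<in>UNIV. \<Sum>f\<in>UNIV. ?C a b f * ?h f d * T x $ a $ d) =
      (\<Sum>a\<in>UNIV. \<Sum>d\<in>UNIV. \<Sum>f\<in>UNIV. ?C d b f * ?h a f * T x $ a $ d)"
    by (subst sum.swap) (simp add: sym h_sym[OF x])
  also have "(\<Sum>a\<in>UNIV. \<Sum>d\<in>UNIV. \<Sum>f\<in>UNIV. ?C d b f * ?h a f * T x $ a $ d) =
      contract x (\<lambda>a c. \<Sum>d\<in>UNIV. ?C d c b * T x $ a $ d)"
    unfolding contract_def sum_distrib_left
    by (rule sum.cong[OF refl], subst sum.swap) (simp add: christoffel_sym[OF x, of _ b] mult_ac)
  finally show ?thesis
    unfolding reduced_div_def divergence_def covd2_def pd_contract[OF x T]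
    unfolding contract_def[symmetric] contract_linear 1 by (simp add: diff_divide_distrib)
qed

text \<open>
  Reversing the trace of \<open>T\<close> undoes the trace reversal built into the reduced divergence, so only
  the divergence of \<open>T\<close> and a gradient term remain.
\<close>

lemma reduced_div_matter:
  assumes T: "\<And>a b. (\<lambda>y. T y $ a $ b) differentiable_on M" and \<phi>: "\<phi> differentiable_on M"
    and x: "x \<in> M" and sym: "\<And>a b. T x $ a $ b = T x $ b $ a"
  shows "reduced_div (\<lambda>a b y. \<phi> y * (T y $ a $ b - G y $ a $ b * contract y (\<lambda>a c. T y $ a $ c) / 2)) b x =
    \<phi> x * divergence M G T b x + contract x (\<lambda>a c. pd M c \<phi> x * T x $ a $ b)"
proof -
  let ?\<tau> = "\<lambda>y. contract y (\<lambda>a c. T y $ a $ c)"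
  let ?\<psi> = "\<lambda>y. - (1/2) * (\<phi> y * ?\<tau> y)"
  have \<tau>: "?\<tau> differentiable_on M" by (rule contract_differentiable[OF T])
  have \<phi>\<tau>: "(\<lambda>y. \<phi> y * ?\<tau> y) differentiable_on M"
    by (intro differentiable_on_mult \<tau> \<phi>)
  then have \<psi>: "?\<psi> differentiable_on M"
    by (rule differentiable_on_mult[OF differentiable_on_const])
  have "reduced_div (\<lambda>a b y. \<phi> y * (T y $ a $ b - G y $ a $ b * ?\<tau> y / 2)) b x =
      reduced_div (\<lambda>a b y. \<phi> y * T y $ a $ b + ?\<psi> y * G y $ a $ b) b x"
    by (rule reduced_div_congr[OF x]) (simp add: field_simps)
  also have "\<dots> = reduced_div (\<lambda>a b y. \<phi> y * T y $ a $ b) b x + reduced_div (\<lambda>a b y. ?\<psi> y * G y $ a $ b) b x"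
    by (rule reduced_div_add[OF x]; intro differentiable_on_mult T G_differentiable \<phi> \<psi>)
  also have "reduced_div (\<lambda>a b y. ?\<psi> y * G y $ a $ b) b x = (pd M b \<phi> x * ?\<tau> x + \<phi> x * pd M b ?\<tau> x) / 2"
    unfolding reduced_div_metric[OF \<psi> x] pd_within_cmult[OF x \<phi>\<tau>] pd_within_mult[OF x \<phi> \<tau>] by simp
  also have "reduced_div (\<lambda>a b y. \<phi> y * T y $ a $ b) b x = \<phi> x * (divergence M G T b x - pd M b ?\<tau> x / 2)
      + contract x (\<lambda>a c. pd M c \<phi> x * T x $ a $ b) - pd M b \<phi> x * ?\<tau> x / 2"
    unfolding reduced_div_mult[OF x T \<phi>] reduced_div_divergence[OF T x sym] ..
  finally show ?thesis by (simp add: field_simps)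
qed

text \<open>
  The two second derivatives in which \<open>b\<close> is one of the differentiations cancel after contraction,
  so the principal part is the wave operator on the single component \<open>v b\<close>.
\<close>

lemma reduced_div_gauge:
  assumes v: "\<And>b. Ck_on 2 M (v b)" and x: "x \<in> M"
  shows "reduced_div (\<lambda>a b y. (pd M a (v b) y + pd M b (v a) y) / 2) b x =
    (reduced_wave M G (v b) x
      - (\<Sum>d\<in>UNIV. wave_gauge M G d x * (pd M d (v b) x + pd M b (v d) x))) / 2"
proof -
  have d: "pd M a (v b) differentiable_on M" for a b
    using v[of b] by (simp add: numeral_2_eq_2)
  have pd2: "pd M c (\<lambda>y. (pd M a (v b) y + pd M b (v a) y) / 2) x =
      (pd M c (pd M a (v b)) x + pd M c (pd M b (v a)) x) / 2" for a b c
  proof -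
    have "pd M c (\<lambda>y. (1/2) * (pd M a (v b) y + pd M b (v a) y)) x =
        (1/2) * pd M c (\<lambda>y. pd M a (v b) y + pd M b (v a) y) x"
      by (rule pd_within_cmult[OF x]) (intro differentiable_on_add d)
    then show ?thesis by (simp add: pd_within_add[OF x d d])
  qed
  have comm: "pd M c (pd M b (v a)) x = pd M b (pd M c (v a)) x" for a c
    by (rule pd_within_commute[OF v x])
  have "contract x (\<lambda>a c. pd M c (\<lambda>y. (pd M a (v b) y + pd M b (v a) y) / 2) x
      - pd M b (\<lambda>y. (pd M a (v c) y + pd M c (v a) y) / 2) x / 2) =
    contract x (\<lambda>a c. pd M c (pd M a (v b)) x / 2 + (pd M b (pd M c (v a)) x / 4 - pd M b (pd M a (v c)) x / 4))"
    unfolding pd2 comm by (simp add: add_divide_distrib algebra_simps)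
  also have "\<dots> = reduced_wave M G (v b) x / 2"
    using contract_swap[OF x, of "\<lambda>a c. pd M b (pd M c (v a)) x / 4"]
      contract_swap[OF x, of "\<lambda>a c. pd M a (pd M c (v b)) x"]
    by (simp only: contract_linear reduced_wave_contract)
  finally show ?thesis
    unfolding reduced_div_def by (simp add: sum_divide_distrib diff_divide_distrib)
qed

end

section \<open>The wave decomposition of the Ricci tensor up to the boundary\<close>

context metric_domain
begin

text \<open>
  The identity is known on open sets, hence in the interior of the domain, and both sides are
  continuous up to the boundary. The boundary values matter: the constraints are used there.
\<close>

lemma ricci_decomposition:
  assumes x: "x \<in> M"
  shows "ricci M G a b x = - (1/2) * reduced_wave M G (\<lambda>y. G y $ a $ b) x
    + (1/2) * (pd M a (wave_gauge_low M G b) x + pd M b (wave_gauge_low M G a) x)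
    + (1/2) * F_field M G a b x"
proof (rule eq_on_by_density[OF _ _ _ x])
  have h: "Ck_on 1 M (\<lambda>y. ginv y $ i $ j)" and h0: "Ck_on 0 M (\<lambda>y. ginv y $ i $ j)" for i j
    using h_Ck[OF G_C1] h_Ck[OF tensor_Ck_on_le[OF G_C2, of 0]] by (simp_all only: tensor_Ck_on_def)
  have dG: "Ck_on 0 M (pd M c (\<lambda>y. G y $ i $ j))" and ddG: "Ck_on 0 M (pd M e (pd M c (\<lambda>y. G y $ i $ j)))"
    for e c i j
  proof -
    have "Ck_on 2 M (\<lambda>y. G y $ i $ j)"
      using G_C2 by (simp add: tensor_Ck_on_def)
    then show "Ck_on 0 M (pd M e (pd M c (\<lambda>y. G y $ i $ j)))" "Ck_on 0 M (pd M c (\<lambda>y. G y $ i $ j))"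
      by (auto simp: numeral_2_eq_2 differentiable_imp_continuous_on)
  qed
  have dGam: "Ck_on 0 M (pd M c (wave_gauge_low M G b))" for c b
    using wave_gauge_Ck(2)[of 1 b] G_C2 by (simp add: numeral_2_eq_2)
  have "Ck_on 0 M (ricci M G a b)"
    using ricci_Ck[of 0] G_C2 by (simp only: numeral_2_eq_2)
  then show "continuous_on M (ricci M G a b)" by simp
  have "Ck_on 0 M (\<lambda>x. - (1/2) * reduced_wave M G (\<lambda>y. G y $ a $ b) x
    + (1/2) * (pd M a (wave_gauge_low M G b) x + pd M b (wave_gauge_low M G a) x)
    + (1/2) * F_field M G a b x)"
    unfolding reduced_wave_def F_field_def F_quad_def chris_low_def
    by (intro Ck_on_intros h0 dG ddG dGam)
  then show "continuous_on M (\<lambda>x. - (1/2) * reduced_wave M G (\<lambda>y. G y $ a $ b) x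
    + (1/2) * (pd M a (wave_gauge_low M G b) x + pd M b (wave_gauge_low M G a) x)
    + (1/2) * F_field M G a b x)"
    by simp
next
  fix x assume x: "x \<in> interior M"
  let ?U = "interior M"
  have sub: "y \<in> ?U \<Longrightarrow> y \<in> M" for y
    using interior_subset by blast
  have C2: "tensor_Ck_on 2 ?U G"
    unfolding tensor_Ck_on_def
    by (intro allI Ck_on_interior[of 2 M "\<lambda>x. G x $ i $ j" for i j])
      (use G_C2 in \<open>auto simp: tensor_Ck_on_def\<close>)
  have dG: "pd ?U c (\<lambda>y. G y $ i $ j) y = pd M c (\<lambda>y. G y $ i $ j) y" if "y \<in> ?U" for c i j y
    by (rule pd_interior[OF that refl])
  have chr: "christoffel ?U G c i j y = christoffel M G c i j y" if "y \<in> ?U" for c i j y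
    unfolding christoffel_def by (simp only: dG[OF that])
  have dchr: "pd ?U e (christoffel ?U G c i j) x = pd M e (christoffel M G c i j) x" for e c i j
    by (rule pd_interior[OF x chr])
  have ric: "ricci ?U G a b x = ricci M G a b x"
    unfolding ricci_def by (simp only: dchr chr[OF x])
  have wg: "wave_gauge_low ?U G c y = wave_gauge_low M G c y" if "y \<in> ?U" for c y
    unfolding wave_gauge_low_def wave_gauge_def by (simp only: chr[OF that])
  have dwg: "pd ?U e (wave_gauge_low ?U G c) x = pd M e (wave_gauge_low M G c) x" for e c
    by (rule pd_interior[OF x wg])
  have ddG: "pd ?U e (pd ?U c (\<lambda>y. G y $ i $ j)) x = pd M e (pd M c (\<lambda>y. G y $ i $ j)) x" for e c i j
    by (rule pd_interior[OF x dG])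
  have "ricci ?U G a b x = - (1/2) * reduced_wave ?U G (\<lambda>y. G y $ a $ b) x
    + (1/2) * (pd ?U a (wave_gauge_low ?U G b) x + pd ?U b (wave_gauge_low ?U G a) x)
    + (1/2) * F_field ?U G a b x"
    by (rule ricci_wave_decomposition[OF open_interior x C2]) (auto dest: sub intro: G_transpose G_invertible)
  then show "ricci M G a b x = - (1/2) * reduced_wave M G (\<lambda>y. G y $ a $ b) x
    + (1/2) * (pd M a (wave_gauge_low M G b) x + pd M b (wave_gauge_low M G a) x)
    + (1/2) * F_field M G a b x"
    unfolding ric dwg reduced_wave_def F_field_def ddG dG[OF x] .
qed


section \<open>Scalar curvature under a conformal change\<close>

lemma matrix_inv_scaleR:
  assumes "x \<in> M" "k \<noteq> 0"
  shows "matrix_inv (k *\<^sub>R G x) = inverse k *\<^sub>R ginv x"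
proof -
  let ?A = "k *\<^sub>R G x" and ?B = "inverse k *\<^sub>R ginv x"
  have AB: "?A ** ?B = mat 1" "?B ** ?A = mat 1"
    using assms(2) by (simp_all add: scalar_matrix_assoc[symmetric] matrix_scalar_ac h_G[OF assms(1)])
  then have "invertible ?A"
    unfolding invertible_def by blast
  have "matrix_inv ?A = matrix_inv ?A ** (?A ** ?B)"
    by (simp only: AB matrix_mul_rid)
  also have "\<dots> = ?B"
    unfolding matrix_mul_assoc matrix_inv_props(2)[OF \<open>invertible ?A\<close>] by (rule matrix_mul_lid)
  finally show ?thesis .
qed

text \<open>
  The Christoffel symbols change by the tensor \<open>- S\<close>. The Ricci tensor of the new metric follows by
  inserting this into the definition: \<open>div\<close> and \<open>grad\<close> collect the differentiated terms, \<open>quad1\<close> and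
  \<open>quad2\<close> the products. The derivatives of the metric that do not belong to \<open>\<nabla>\<nabla>\<rho>\<close> or to the wave
  operator on \<open>\<rho>\<close> cancel between \<open>div\<close> and \<open>quad2\<close>, and the result is
  \<open>Ric + 2 \<nabla>\<nabla>\<rho> + 2 d\<rho> \<otimes> d\<rho> + (\<box>\<rho> - 2 |d\<rho>|\<^sup>2) G\<close>, of which the trace is taken.
\<close>

lemma scalar_curvature_conformal:
  assumes \<rho>: "Ck_on 2 M \<rho>" and g: "\<And>y. y \<in> M \<Longrightarrow> g y = exp (- 2 * \<rho> y) *\<^sub>R G y" and x: "x \<in> M"
  shows "scalar_curvature M g x = exp (2 * \<rho> x) * (contract x (\<lambda>a b. ricci M G a b x)
     + 6 * (reduced_wave M G \<rho> x - (\<Sum>d\<in>UNIV. wave_gauge M G d x * pd M d \<rho> x))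
     - 6 * contract x (\<lambda>a b. pd M a \<rho> x * pd M b \<rho> x))"
proof -
  let ?r = "\<lambda>a. pd M a \<rho>" and ?C = "\<lambda>a b c. christoffel M G a b c x"
  define s where "s c y = (\<Sum>d\<in>UNIV. ginv y $ c $ d * pd M d \<rho> y)" for c y
  define S where "S c a b y = (if c = a then 1 else 0) * ?r b y + (if c = b then 1 else 0) * ?r a y
    - G y $ a $ b * s c y" for c a b y
  define n where "n = contract x (\<lambda>a b. ?r a x * ?r b x)"
  define \<gamma> where "\<gamma> c = (\<Sum>d\<in>UNIV. ?C d c d)" for c
  have \<rho>1: "\<rho> differentiable_on M" and r1: "?r a differentiable_on M" for a
    using \<rho> by (simp_all add: numeral_2_eq_2)
  have s1: "s c differentiable_on M" for c
    unfolding s_def[abs_def] by (intro differentiable_on_sum_UNIV differentiable_on_mult h_differentiable r1)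
  have C1: "christoffel M G a b c differentiable_on M" for a b c
    using christoffel_Ck[of 1] G_C2 by (simp add: numeral_2_eq_2)
  have S1: "S c a b differentiable_on M" for c a b
    unfolding S_def[abs_def]
    by (intro differentiable_on_diff differentiable_on_add differentiable_on_mult differentiable_on_const
        r1 s1 G_differentiable)
  have lower: "(\<Sum>c\<in>UNIV. G y $ b $ c * s c y) = ?r b y" if y: "y \<in> M" for b y
  proof -
    have "(\<Sum>c\<in>UNIV. G y $ b $ c * s c y) = (\<Sum>c\<in>UNIV. \<Sum>d\<in>UNIV. G y $ b $ c * ginv y $ c $ d * ?r d y)"
      by (simp add: s_def sum_distrib_left mult_ac)
    also have "\<dots> = (\<Sum>d\<in>UNIV. (\<Sum>c\<in>UNIV. G y $ b $ c * ginv y $ c $ d) * ?r d y)"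
      unfolding sum_distrib_right by (rule sum.swap)
    finally show ?thesis by (simp only: h_G_nth(2)[OF y] kronecker_sum)
  qed
  have n_s: "(\<Sum>c\<in>UNIV. s c x * ?r c x) = n"
    by (simp add: s_def n_def contract_def sum_distrib_left sum_distrib_right mult_ac)

  have chr: "christoffel M g c a b y = christoffel M G c a b y - S c a b y" if y: "y \<in> M" for c a b y
  proof -
    let ?E = "exp (- 2 * \<rho> y)"
    have dE: "pd M e (\<lambda>y. exp (- 2 * \<rho> y)) y = - 2 * ?E * ?r e y" for e
      by (rule pd_within_chain[OF y \<rho>1]) (auto intro!: derivative_eq_intros)
    have E1: "(\<lambda>y. exp (- 2 * \<rho> y)) differentiable_on M"
      by (rule differentiable_within_chain[OF \<rho>1]) (auto intro!: derivative_eq_intros)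
    have dg: "pd M e (\<lambda>y. g y $ i $ j) y = ?E * (pd M e (\<lambda>y. G y $ i $ j) y - 2 * ?r e y * G y $ i $ j)"
      for e i j
    proof -
      have "pd M e (\<lambda>y. g y $ i $ j) y = pd M e (\<lambda>y. exp (- 2 * \<rho> y) * G y $ i $ j) y"
        by (rule pd_congr[OF y]) (simp add: g)
      then show ?thesis
        unfolding pd_within_mult[OF y E1 G_differentiable] dE by (simp add: algebra_simps)
    qed
    have inv: "matrix_inv (g y) = exp (2 * \<rho> y) *\<^sub>R ginv y"
      unfolding g[OF y] by (subst matrix_inv_scaleR[OF y]) (simp_all add: exp_minus)
    have EE: "exp (2 * \<rho> y) * ?E = 1"
      by (simp add: exp_minus)
    have summand: "matrix_inv (g y) $ c $ d / 2 * (pd M a (\<lambda>y. g y $ b $ d) y + pd M b (\<lambda>y. g y $ a $ d) y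
        - pd M d (\<lambda>y. g y $ a $ b) y) = (exp (2 * \<rho> y) * ?E) * (ginv y $ c $ d / 2 *
        (pd M a (\<lambda>y. G y $ b $ d) y + pd M b (\<lambda>y. G y $ a $ d) y - pd M d (\<lambda>y. G y $ a $ b) y)
        - (?r a y * (ginv y $ c $ d * G y $ d $ b) + ?r b y * (ginv y $ c $ d * G y $ d $ a)
           - G y $ a $ b * (ginv y $ c $ d * ?r d y)))" for d
      unfolding dg inv G_sym[OF y, of b d] G_sym[OF y, of a d] by (simp add: algebra_simps)
    have "christoffel M g c a b y = christoffel M G c a b y -
        (?r a y * (\<Sum>d\<in>UNIV. ginv y $ c $ d * G y $ d $ b) + ?r b y * (\<Sum>d\<in>UNIV. ginv y $ c $ d * G y $ d $ a)
           - G y $ a $ b * s c y)"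
      by (simp only: christoffel_def summand EE mult_1_left s_def sum_subtractf sum.distrib sum_distrib_left)
    then show ?thesis
      unfolding S_def h_G_nth(1)[OF y] by (simp add: mult.commute)
  qed

  have S_contr: "(\<Sum>c\<in>UNIV. S c a b y * P c) = ?r b y * P a + ?r a y * P b - G y $ a $ b * (\<Sum>c\<in>UNIV. s c y * P c)"
    for a b P y
  proof -
    have "(\<Sum>c\<in>UNIV. S c a b y * P c) = (\<Sum>c\<in>UNIV. (if c = a then 1 else 0) * (?r b y * P c))
        + (\<Sum>c\<in>UNIV. (if c = b then 1 else 0) * (?r a y * P c)) - G y $ a $ b * (\<Sum>c\<in>UNIV. s c y * P c)"
      unfolding S_def left_diff_distrib distrib_right sum_subtractf sum.distrib sum_distrib_left
      by (simp only: mult.assoc)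
    then show ?thesis by (simp only: kronecker_sum)
  qed
  have S_trace: "(\<Sum>c\<in>UNIV. S c b c y) = 4 * ?r b y" if y: "y \<in> M" for b y
  proof -
    have "(\<Sum>c\<in>UNIV. S c b c y) = (\<Sum>c\<in>UNIV. (if c = b then 1 else 0) * ?r c y) + (\<Sum>c\<in>(UNIV :: 4 set). ?r b y)
        - (\<Sum>c\<in>UNIV. G y $ b $ c * s c y)"
      by (simp add: S_def sum_subtractf sum.distrib)
    then show ?thesis by (simp add: kronecker_sum lower[OF y])
  qed
  have S_sym: "S c a b x = S c b a x" for a b c
    by (simp add: S_def G_sym[OF x, of a b])
  have s_S: "(\<Sum>c\<in>UNIV. s c x * S d b c x) = (if d = b then 1 else 0) * n" for d b
  proof -
    have "(\<Sum>c\<in>UNIV. s c x * S d b c x) = (if d = b then 1 else 0) * (\<Sum>c\<in>UNIV. s c x * ?r c x)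
        + (\<Sum>c\<in>UNIV. (if d = c then 1 else 0) * (s c x * ?r b x)) - (\<Sum>c\<in>UNIV. G x $ b $ c * s c x) * s d x"
      unfolding S_def sum_distrib_left sum_distrib_right
      by (simp add: algebra_simps sum.distrib sum_subtractf)
    then show ?thesis
      unfolding lower[OF x] kronecker_sum n_s by simp
  qed
  have SS: "(\<Sum>c\<in>UNIV. \<Sum>d\<in>UNIV. S c a d x * S d b c x) = 6 * (?r a x * ?r b x) - 2 * G x $ a $ b * n" for a b
  proof -
    have "(\<Sum>c\<in>UNIV. \<Sum>d\<in>UNIV. S c a d x * S d b c x) = (\<Sum>d\<in>UNIV. \<Sum>c\<in>UNIV. S c a d x * S d b c x)"
      by (rule sum.swap)
    also have "\<dots> = (\<Sum>d\<in>UNIV. S d b a x * ?r d x) + ?r a x * (\<Sum>d\<in>UNIV. S d b d x)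
        - (\<Sum>d\<in>UNIV. (if d = b then 1 else 0) * (G x $ a $ d * n))"
      unfolding S_contr[of a _ x "\<lambda>c. S _ b c x"] s_S
      by (simp only: sum_subtractf sum.distrib sum_distrib_left mult_ac)
    also have "\<dots> = 6 * (?r a x * ?r b x) - 2 * G x $ a $ b * n"
      unfolding S_contr S_trace[OF x] kronecker_sum n_s G_sym[OF x, of b a] by (simp add: algebra_simps)
    finally show ?thesis .
  qed
  have CS: "(\<Sum>c\<in>UNIV. \<Sum>d\<in>UNIV. ?C c a d * S d b c x) = (\<Sum>c\<in>UNIV. ?C c a b * ?r c x) + ?r b x * \<gamma> a
      - (\<Sum>d\<in>UNIV. s d x * ((pd M a (\<lambda>y. G y $ d $ b) x + pd M d (\<lambda>y. G y $ a $ b) x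
          - pd M b (\<lambda>y. G y $ a $ d) x) / 2))" for a b
  proof -
    have "(\<Sum>d\<in>UNIV. ?C c a d * S d b c x) = ?C c a b * ?r c x + ?r b x * ?C c a c
        - (\<Sum>d\<in>UNIV. s d x * (G x $ b $ c * ?C c a d))" for c
      using S_contr[of b c x "?C c a"] by (simp add: mult_ac sum_distrib_left)
    then have "(\<Sum>c\<in>UNIV. \<Sum>d\<in>UNIV. ?C c a d * S d b c x) = (\<Sum>c\<in>UNIV. ?C c a b * ?r c x) + ?r b x * \<gamma> a
        - (\<Sum>c\<in>UNIV. \<Sum>d\<in>UNIV. s d x * (G x $ b $ c * ?C c a d))"
      by (simp add: sum_subtractf sum.distrib sum_distrib_left \<gamma>_def)
    also have "(\<Sum>c\<in>UNIV. \<Sum>d\<in>UNIV. s d x * (G x $ b $ c * ?C c a d)) =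
        (\<Sum>d\<in>UNIV. s d x * (\<Sum>c\<in>UNIV. G x $ b $ c * ?C c a d))"
      unfolding sum_distrib_left by (rule sum.swap)
    finally show ?thesis
      unfolding G_christoffel[OF x] .
  qed
  have CS_sym: "(\<Sum>c\<in>UNIV. \<Sum>d\<in>UNIV. ?C c a d * S d b c x) + (\<Sum>c\<in>UNIV. \<Sum>d\<in>UNIV. S c a d x * ?C d b c) =
      2 * (\<Sum>c\<in>UNIV. ?C c a b * ?r c x) + ?r b x * \<gamma> a + ?r a x * \<gamma> b
      - (\<Sum>d\<in>UNIV. pd M d (\<lambda>y. G y $ a $ b) x * s d x)" for a b
  proof -
    have "(\<Sum>c\<in>UNIV. \<Sum>d\<in>UNIV. S c a d x * ?C d b c) = (\<Sum>d\<in>UNIV. \<Sum>c\<in>UNIV. ?C d b c * S c a d x)"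
      by (subst sum.swap) (simp only: mult.commute)
    moreover have "s d x * ((pd M a (\<lambda>y. G y $ d $ b) x + pd M d (\<lambda>y. G y $ a $ b) x - pd M b (\<lambda>y. G y $ a $ d) x) / 2)
       + s d x * ((pd M b (\<lambda>y. G y $ d $ a) x + pd M d (\<lambda>y. G y $ b $ a) x - pd M a (\<lambda>y. G y $ b $ d) x) / 2)
       = pd M d (\<lambda>y. G y $ a $ b) x * s d x" for d
      using dG_sym[OF x, of a d b] dG_sym[OF x, of b d a] dG_sym[OF x, of d b a] by (simp add: field_simps)
    then have "(\<Sum>d\<in>UNIV. s d x * ((pd M a (\<lambda>y. G y $ d $ b) x + pd M d (\<lambda>y. G y $ a $ b) x - pd M b (\<lambda>y. G y $ a $ d) x) / 2))
       + (\<Sum>d\<in>UNIV. s d x * ((pd M b (\<lambda>y. G y $ d $ a) x + pd M d (\<lambda>y. G y $ b $ a) x - pd M a (\<lambda>y. G y $ b $ d) x) / 2))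
       = (\<Sum>d\<in>UNIV. pd M d (\<lambda>y. G y $ a $ b) x * s d x)"
      by (simp only: sum.distrib[symmetric])
    moreover have "(\<Sum>c\<in>UNIV. ?C c b a * ?r c x) = (\<Sum>c\<in>UNIV. ?C c a b * ?r c x)"
      by (simp only: christoffel_sym[OF x, of _ b a])
    ultimately show ?thesis
      using CS[of a b] CS[of b a] by linarith
  qed

  have div: "(\<Sum>c\<in>UNIV. pd M c (christoffel M g c a b) x) = (\<Sum>c\<in>UNIV. pd M c (christoffel M G c a b) x)
      - 2 * pd M a (?r b) x + (\<Sum>c\<in>UNIV. pd M c (\<lambda>y. G y $ a $ b) x * s c x)
      + G x $ a $ b * (\<Sum>c\<in>UNIV. pd M c (s c) x)" for a b
  proof -
    have dS: "pd M c (S c a b) x = (if c = a then 1 else 0) * pd M c (?r b) x + (if c = b then 1 else 0) * pd M c (?r a) x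
        - (pd M c (\<lambda>y. G y $ a $ b) x * s c x + G x $ a $ b * pd M c (s c) x)" for c
    proof -
      have "(\<lambda>y. k * ?r i y) differentiable_on M" for k i
        by (intro differentiable_on_mult differentiable_on_const r1)
      moreover have "(\<lambda>y. G y $ a $ b * s c y) differentiable_on M"
        by (intro differentiable_on_mult G_differentiable s1)
      ultimately show ?thesis
        unfolding S_def[abs_def]
        by (simp only: pd_within_diff[OF x] pd_within_add[OF x] differentiable_on_add
            pd_within_mult[OF x G_differentiable s1] pd_within_cmult[OF x r1])
    qed
    have "pd M c (christoffel M g c a b) x = pd M c (christoffel M G c a b) x - pd M c (S c a b) x" for c
      unfolding pd_within_diff[OF x C1 S1, symmetric] by (rule pd_congr[OF x chr])
    then show ?thesis
      unfolding dS pd_within_commute[OF \<rho> x, of b a]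
      by (simp only: sum_subtractf sum.distrib kronecker_sum sum_distrib_left pd_within_commute[OF \<rho> x, of b a])
  qed
  have trace_chr: "(\<Sum>c\<in>UNIV. christoffel M g c b c y) = (\<Sum>c\<in>UNIV. christoffel M G c b c y) - 4 * ?r b y"
    if "y \<in> M" for b y
    by (simp add: chr[OF that] sum_subtractf S_trace[OF that])
  have grad: "(\<Sum>c\<in>UNIV. pd M a (christoffel M g c b c) x) =
      (\<Sum>c\<in>UNIV. pd M a (christoffel M G c b c) x) - 4 * pd M a (?r b) x" for a b
  proof -
    have "christoffel M g c b c differentiable_on M" for c
      by (rule differentiable_on_congr[OF differentiable_on_diff[OF C1 S1]]) (simp add: chr)
    then have "(\<Sum>c\<in>UNIV. pd M a (christoffel M g c b c) x) = pd M a (\<lambda>y. \<Sum>c\<in>UNIV. christoffel M g c b c y) x"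
      by (simp add: pd_within_sum[OF x])
    also have "\<dots> = pd M a (\<lambda>y. (\<Sum>c\<in>UNIV. christoffel M G c b c y) - 4 * ?r b y) x"
      by (rule pd_congr[OF x trace_chr])
    also have "\<dots> = (\<Sum>c\<in>UNIV. pd M a (christoffel M G c b c) x) - 4 * pd M a (?r b) x"
      by (simp add: pd_within_diff[OF x] pd_within_sum[OF x] pd_within_cmult[OF x] C1 r1
          differentiable_on_sum_UNIV differentiable_on_mult)
    finally show ?thesis .
  qed
  have quad1: "(\<Sum>c\<in>UNIV. \<Sum>d\<in>UNIV. christoffel M g c a b x * christoffel M g d c d x) =
      (\<Sum>c\<in>UNIV. \<Sum>d\<in>UNIV. ?C c a b * ?C d c d) - 4 * (\<Sum>c\<in>UNIV. ?C c a b * ?r c x)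
      - ?r b x * (\<gamma> a - 4 * ?r a x) - ?r a x * (\<gamma> b - 4 * ?r b x)
      + G x $ a $ b * ((\<Sum>c\<in>UNIV. s c x * \<gamma> c) - 4 * n)" for a b
  proof -
    have "(\<Sum>c\<in>UNIV. \<Sum>d\<in>UNIV. christoffel M g c a b x * christoffel M g d c d x) =
        (\<Sum>c\<in>UNIV. (?C c a b - S c a b x) * (\<gamma> c - 4 * ?r c x))"
      unfolding sum_distrib_left[symmetric] trace_chr[OF x] \<gamma>_def[symmetric] by (simp only: chr[OF x])
    also have "\<dots> = (\<Sum>c\<in>UNIV. ?C c a b * \<gamma> c) - 4 * (\<Sum>c\<in>UNIV. ?C c a b * ?r c x)
        - (\<Sum>c\<in>UNIV. S c a b x * (\<gamma> c - 4 * ?r c x))"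
      by (simp add: left_diff_distrib right_diff_distrib sum_subtractf sum_distrib_left mult_ac)
    also have "(\<Sum>c\<in>UNIV. ?C c a b * \<gamma> c) = (\<Sum>c\<in>UNIV. \<Sum>d\<in>UNIV. ?C c a b * ?C d c d)"
      by (simp add: \<gamma>_def sum_distrib_left)
    also have "(\<Sum>c\<in>UNIV. S c a b x * (\<gamma> c - 4 * ?r c x)) = ?r b x * (\<gamma> a - 4 * ?r a x) + ?r a x * (\<gamma> b - 4 * ?r b x)
        - G x $ a $ b * ((\<Sum>c\<in>UNIV. s c x * \<gamma> c) - 4 * n)"
      unfolding S_contr n_s[symmetric] by (simp add: right_diff_distrib sum_subtractf sum_distrib_left mult_ac)
    finally show ?thesis by simp
  qed
  have quad2: "(\<Sum>c\<in>UNIV. \<Sum>d\<in>UNIV. christoffel M g c a d x * christoffel M g d b c x) =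
      (\<Sum>c\<in>UNIV. \<Sum>d\<in>UNIV. ?C c a d * ?C d b c)
      - (2 * (\<Sum>c\<in>UNIV. ?C c a b * ?r c x) + ?r b x * \<gamma> a + ?r a x * \<gamma> b
         - (\<Sum>d\<in>UNIV. pd M d (\<lambda>y. G y $ a $ b) x * s d x))
      + (6 * (?r a x * ?r b x) - 2 * G x $ a $ b * n)" for a b
    unfolding SS[symmetric] CS_sym[symmetric] chr[OF x]
    by (simp add: left_diff_distrib right_diff_distrib sum_subtractf)
  have box: "(\<Sum>c\<in>UNIV. pd M c (s c) x) + (\<Sum>c\<in>UNIV. s c x * \<gamma> c) =
      reduced_wave M G \<rho> x - (\<Sum>d\<in>UNIV. wave_gauge M G d x * ?r d x)" (is "_ = ?box")
  proof -
    have "(\<Sum>c\<in>UNIV. pd M c (s c) x) = (\<Sum>c\<in>UNIV. \<Sum>d\<in>UNIV. ?r d x * pd M c (\<lambda>y. ginv y $ c $ d) x)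
        + (\<Sum>c\<in>UNIV. \<Sum>d\<in>UNIV. ginv x $ c $ d * pd M c (?r d) x)"
      unfolding s_def[abs_def]
      by (simp add: pd_within_sum[OF x] pd_within_mult[OF x] h_differentiable r1 differentiable_on_mult
          sum.distrib mult.commute)
    also have "(\<Sum>c\<in>UNIV. \<Sum>d\<in>UNIV. ?r d x * pd M c (\<lambda>y. ginv y $ c $ d) x) =
        (\<Sum>d\<in>UNIV. ?r d x * (\<Sum>c\<in>UNIV. pd M c (\<lambda>y. ginv y $ d $ c) x))"
    proof -
      have "pd M c (\<lambda>y. ginv y $ c $ d) x = pd M c (\<lambda>y. ginv y $ d $ c) x" for c d
        by (rule pd_congr[OF x h_sym])
      then show ?thesis
        unfolding sum_distrib_left by (subst sum.swap) (simp only:)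
    qed
    also have "\<dots> = - (\<Sum>d\<in>UNIV. wave_gauge M G d x * ?r d x)
        - (\<Sum>d\<in>UNIV. ?r d x * (\<Sum>c\<in>UNIV. \<Sum>f\<in>UNIV. ?C c c f * ginv x $ d $ f))"
      unfolding div_h[OF x] by (simp add: right_diff_distrib sum_subtractf sum_negf mult.commute)
    also have "(\<Sum>d\<in>UNIV. ?r d x * (\<Sum>c\<in>UNIV. \<Sum>f\<in>UNIV. ?C c c f * ginv x $ d $ f)) = (\<Sum>c\<in>UNIV. s c x * \<gamma> c)"
    proof -
      have "(\<Sum>d\<in>UNIV. ?r d x * (\<Sum>c\<in>UNIV. \<Sum>f\<in>UNIV. ?C c c f * ginv x $ d $ f)) =
          (\<Sum>d\<in>UNIV. ?r d x * (\<Sum>f\<in>UNIV. ginv x $ d $ f * \<gamma> f))"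
      proof -
        have "(\<Sum>c\<in>UNIV. \<Sum>f\<in>UNIV. ?C c c f * ginv x $ d $ f) = (\<Sum>f\<in>UNIV. ginv x $ d $ f * \<gamma> f)" for d
          unfolding \<gamma>_def sum_distrib_left
          by (subst sum.swap) (simp add: christoffel_sym[OF x] mult.commute)
        then show ?thesis by simp
      qed
      also have "\<dots> = (\<Sum>d\<in>UNIV. \<Sum>f\<in>UNIV. ginv x $ f $ d * ?r d x * \<gamma> f)"
        by (simp add: sum_distrib_left h_sym[OF x] mult_ac)
      also have "\<dots> = (\<Sum>f\<in>UNIV. s f x * \<gamma> f)"
        unfolding s_def sum_distrib_right by (rule sum.swap)
      finally show ?thesis .
    qed
    finally show ?thesis by (simp add: reduced_wave_def)
  qed
  have ric: "ricci M g a b x = ricci M G a b x + 2 * (pd M a (?r b) x - (\<Sum>c\<in>UNIV. ?C c a b * ?r c x))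
      + 2 * (?r a x * ?r b x) + (?box - 2 * n) * G x $ a $ b" for a b
    unfolding ricci_def sum_subtractf div grad quad1 quad2 box[symmetric] by (simp add: algebra_simps)
  have inv: "matrix_inv (g x) = exp (2 * \<rho> x) *\<^sub>R ginv x"
    unfolding g[OF x] by (subst matrix_inv_scaleR[OF x]) (simp_all add: exp_minus)
  have "scalar_curvature M g x = exp (2 * \<rho> x) * contract x (\<lambda>a b. ricci M g a b x)"
    by (simp add: scalar_curvature_def tr_def inv contract_def sum_distrib_left mult.assoc)
  also have "contract x (\<lambda>a b. ricci M g a b x) = contract x (\<lambda>a b. ricci M G a b x)
     + 2 * (reduced_wave M G \<rho> x - (\<Sum>c\<in>UNIV. wave_gauge M G c x * ?r c x)) + 2 * n + (?box - 2 * n) * 4"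
    unfolding ric contract_linear contract_G[OF x] sum_contract[symmetric] wave_gauge_contract[symmetric] reduced_wave_contract n_def ..
  finally show ?thesis
    unfolding n_def by (simp add: algebra_simps)
qed

end

section \<open>The potential\<close>

lemma smooth_convex_increasing_onD:
  assumes f: "smooth_convex_increasing_on I f" and r: "r \<in> I"
  shows "(f has_real_derivative deriv f r) (at r)"
    and "(deriv f has_real_derivative deriv (deriv f) r) (at r)"
    and "deriv f r > 0" "deriv (deriv f) r > 0"
proof -
  have "(deriv ^^ k) f differentiable at r" for k
    using f r by (simp add: smooth_convex_increasing_on_def)
  from this[of 0] this[of 1] show "(f has_real_derivative deriv f r) (at r)"
    "(deriv f has_real_derivative deriv (deriv f) r) (at r)"
    by (simp_all add: DERIV_deriv_iff_real_differentiable)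
  show "deriv f r > 0" "deriv (deriv f) r > 0"
    using f r by (simp_all add: smooth_convex_increasing_on_def)
qed

lemma DERIV_s_map:
  assumes f: "smooth_convex_increasing_on I f" and r: "r \<in> I"
  shows "(s_map f has_real_derivative deriv (deriv f) r / (2 * deriv f r)) (at r)"
proof -
  note D = smooth_convex_increasing_onD[OF f r]
  have "((\<lambda>r. ln (deriv f r) / 2) has_real_derivative deriv (deriv f) r / (2 * deriv f r)) (at r)"
    using D(3) by (auto intro!: derivative_eq_intros D(2))
  moreover have "s_map f = (\<lambda>r. ln (deriv f r) / 2)"
    by (rule ext) (rule s_map_def)
  ultimately show ?thesis by (simp only:)
qed

lemma s_map_inj:
  assumes f: "smooth_convex_increasing_on I f" and I: "is_interval I"
  shows "inj_on (s_map f) I"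
proof (rule linorder_inj_onI)
  fix r t assume rt: "r < t" "r \<in> I" "t \<in> I"
  have "s_map f r < s_map f t"
  proof (rule DERIV_pos_imp_increasing[OF rt(1)])
    fix z assume "r \<le> z" "z \<le> t"
    then have z: "z \<in> I"
      using I rt(2,3) mem_is_interval_1_I by blast
    show "\<exists>y. (s_map f has_real_derivative y) (at z) \<and> 0 < y"
      by (rule exI, rule conjI, rule DERIV_s_map[OF f z])
        (simp add: smooth_convex_increasing_onD(3,4)[OF f z])
  qed
  then show "s_map f r \<noteq> s_map f t" by simp
qed auto

lemma theta_s_map:
  assumes "smooth_convex_increasing_on I f" "is_interval I" "r \<in> I"
  shows "theta I f (s_map f r) = r"
  unfolding theta_def by (rule the_inv_into_f_f[OF s_map_inj[OF assms(1,2)] assms(3)])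

text \<open>
  The map \<open>s \<mapsto> f (\<theta> s) e\<^sup>-\<^sup>2\<^sup>s - \<theta> s\<close> is minus the Legendre transform of \<open>f\<close> divided by the
  slope \<open>e\<^sup>2\<^sup>s\<close>, which is why \<open>\<theta>'\<close> drops out of its derivative.
\<close>

lemma W2_facts:
  assumes f: "smooth_convex_increasing_on I f" and I: "is_interval I" "open I"
    and s: "s \<in> s_map f ` I"
  defines "r \<equiv> theta I f s"
  shows "r \<in> I" "s = ln (deriv f r) / 2" "W2 I f s = f r / exp (2 * s) - r"
    "(W2 I f has_real_derivative - 2 * f r / exp (2 * s)) (at s)"
proof -
  obtain r' where "r' \<in> I" "s = s_map f r'" using s by blast
  then have r: "r \<in> I" "s_map f r = s"
    using theta_s_map[OF f I(1)] by (auto simp: r_def)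
  note D = smooth_convex_increasing_onD[OF f r(1)]
  show "r \<in> I" by (rule r)
  show sr: "s = ln (deriv f r) / 2"
    using r(2) by (simp add: s_map_def)
  then have "2 * s = ln (deriv f r)" by linarith
  then have es: "exp (2 * s) = deriv f r"
    using D(3) by (simp only: exp_ln)
  show "W2 I f s = f r / exp (2 * s) - r"
    using D(3) by (simp add: W2_def Let_def r_def[symmetric] es diff_divide_distrib)
  have cont: "continuous_on I (s_map f)"
    by (rule continuous_at_imp_continuous_on) (auto intro: DERIV_isCont DERIV_s_map[OF f])
  have "(theta I f has_real_derivative inverse (deriv (deriv f) r / (2 * deriv f r))) (at (s_map f r))"
    unfolding has_field_derivative_def
  proof (rule has_derivative_inverse_strong[OF I(2) r(1) cont theta_s_map[OF f I(1)]])
    show "(s_map f has_derivative (*) (deriv (deriv f) r / (2 * deriv f r))) (at r)"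
      using DERIV_s_map[OF f r(1)] by (simp only: has_field_derivative_def)
    show "(*) (deriv (deriv f) r / (2 * deriv f r)) \<circ> (*) (inverse (deriv (deriv f) r / (2 * deriv f r))) = id"
      using D(3,4) by (simp add: fun_eq_iff)
  qed
  then have d\<theta>: "(theta I f has_real_derivative 2 * deriv f r / deriv (deriv f) r) (at s)"
    by (simp add: r(2))
  have "((\<lambda>r. f r / deriv f r - r) has_real_derivative - (f r * deriv (deriv f) r / (deriv f r)\<^sup>2)) (at r)"
    using D(3) by (auto intro!: derivative_eq_intros D(1,2) simp: power2_eq_square field_simps)
  from DERIV_chain2[OF this[unfolded r_def] d\<theta>[unfolded r_def]]
  have *: "((\<lambda>s. f (theta I f s) / deriv f (theta I f s) - theta I f s) has_real_derivative
      - (f r * deriv (deriv f) r / (deriv f r)\<^sup>2) * (2 * deriv f r / deriv (deriv f) r)) (at s)"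
    by (simp add: r_def)
  have val: "- (f r * deriv (deriv f) r / (deriv f r)\<^sup>2) * (2 * deriv f r / deriv (deriv f) r)
      = - 2 * f r / exp (2 * s)"
    unfolding es using D(3,4) by (simp add: power2_eq_square field_simps)
  have op: "open (s_map f ` I)"
    by (rule injective_into_1d_imp_open_map_UNIV[OF I(2) cont s_map_inj[OF f I(1)] order_refl])
  show "(W2 I f has_real_derivative - 2 * f r / exp (2 * s)) (at s)"
  proof (rule DERIV_cong_ev[THEN iffD1, OF refl _ refl *[unfolded val]])
    have "f (theta I f t) / deriv f (theta I f t) - theta I f t = W2 I f t" if "t \<in> s_map f ` I" for t
    proof -
      have "theta I f t \<in> I" using that theta_s_map[OF f I(1)] by auto
      then have "deriv f (theta I f t) > 0" by (rule smooth_convex_increasing_onD(3)[OF f])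
      then show ?thesis by (simp add: W2_def Let_def diff_divide_distrib)
    qed
    then show "\<forall>\<^sub>F t in nhds s. f (theta I f t) / deriv f (theta I f t) - theta I f t = W2 I f t"
      using eventually_nhds_in_open[OF op s] by (auto elim: eventually_mono)
  qed
qed


section \<open>Propagation of the gauge\<close>

context metric_domain
begin

text \<open>
  The reduced divergence of the Ricci tensor vanishes; the assumption \<open>ric\<close> splits it into four parts.
  The second derivatives of \<open>\<rho>\<close>, the potential and the trace of \<open>T\<close> all multiply \<open>\<partial>\<^sub>b \<rho>\<close>; by the assumption
  \<open>scalar\<close> they cancel up to a multiple of the gauge functions, while \<open>matter\<close> removes the divergence of \<open>T\<close> together with the gradient of the
  conformal factor in front of it.
\<close>

lemma gauge_wave_equation:
  fixes \<rho> :: "real^4 \<Rightarrow> real" and V :: "real \<Rightarrow> real"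
  assumes C3: "tensor_Ck_on 3 M G" and \<rho>: "Ck_on 2 M \<rho>" and T: "tensor_Ck_on 1 M T"
    and T_sym: "\<And>y a b. y \<in> M \<Longrightarrow> T y $ a $ b = T y $ b $ a"
    and V: "\<And>y. y \<in> M \<Longrightarrow> (V has_real_derivative V' y) (at (\<rho> y))"
    and ric: "\<And>y a b. y \<in> M \<Longrightarrow> ricci M G a b y = 6 * (pd M a \<rho> y * pd M b \<rho> y) + V (\<rho> y) * G y $ a $ b
      + k * exp (- 2 * \<rho> y) * (T y $ a $ b - G y $ a $ b * contract y (\<lambda>a c. T y $ a $ c) / 2)
      + (pd M a (wave_gauge_low M G b) y + pd M b (wave_gauge_low M G a) y) / 2"
    and matter: "\<And>y b. y \<in> M \<Longrightarrow> divergence M G T b y =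
      2 * contract y (\<lambda>a c. pd M c \<rho> y * T y $ a $ b) - contract y (\<lambda>a c. T y $ a $ c) * pd M b \<rho> y"
    and scalar: "\<And>y. y \<in> M \<Longrightarrow> 6 * reduced_wave M G \<rho> y =
      V' y + k * exp (- 2 * \<rho> y) * contract y (\<lambda>a c. T y $ a $ c)"
    and x: "x \<in> M"
  shows "reduced_wave M G (wave_gauge_low M G b) x =
    (\<Sum>d\<in>UNIV. wave_gauge M G d x * (pd M d (wave_gauge_low M G b) x + pd M b (wave_gauge_low M G d) x))
    + 12 * (\<Sum>d\<in>UNIV. wave_gauge M G d x * pd M d \<rho> x) * pd M b \<rho> x"
proof -
  let ?\<phi> = "\<lambda>y. k * exp (- 2 * \<rho> y)"
  let ?S1 = "\<lambda>a b y. 6 * (pd M a \<rho> y * pd M b \<rho> y)" and ?S2 = "\<lambda>a b y. V (\<rho> y) * G y $ a $ b"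
    and ?S3 = "\<lambda>a b y. ?\<phi> y * (T y $ a $ b - G y $ a $ b * contract y (\<lambda>a c. T y $ a $ c) / 2)"
    and ?S4 = "\<lambda>a b y. (pd M a (wave_gauge_low M G b) y + pd M b (wave_gauge_low M G a) y) / 2"
  have \<rho>1: "\<rho> differentiable_on M" and r1: "pd M a \<rho> differentiable_on M" for a
    using \<rho> by (simp_all add: numeral_2_eq_2)
  have rr1: "(\<lambda>y. pd M a \<rho> y * pd M b \<rho> y) differentiable_on M" for a b
    by (intro differentiable_on_mult r1)
  have T1: "(\<lambda>y. T y $ a $ b) differentiable_on M" for a b
    using T by (simp add: tensor_Ck_on_def)
  have d\<phi>: "((\<lambda>s. k * exp (- 2 * s)) has_real_derivative - 2 * (k * exp (- 2 * s))) (at s)" for s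
    by (auto intro!: derivative_eq_intros)
  have \<phi>1: "?\<phi> differentiable_on M"
    by (rule differentiable_within_chain[OF \<rho>1 d\<phi>])
  have \<phi>_pd: "pd M c ?\<phi> x = - 2 * ?\<phi> x * pd M c \<rho> x" for c
    using pd_within_chain[OF x \<rho>1 d\<phi>] by simp
  have V1: "(\<lambda>y. V (\<rho> y)) differentiable_on M"
    by (rule differentiable_within_chain[OF \<rho>1 V])
  have V_pd: "pd M b (\<lambda>y. V (\<rho> y)) x = V' x * pd M b \<rho> x"
    by (rule pd_within_chain[OF x \<rho>1 V[OF x]])
  have v: "Ck_on 2 M (wave_gauge_low M G c)" for c
    using wave_gauge_Ck(2)[of 2 c] C3 by (simp add: numeral_3_eq_3 numeral_2_eq_2)
  have S1: "?S1 a b differentiable_on M" for a b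
    by (intro differentiable_on_mult differentiable_on_const rr1)
  have S2: "?S2 a b differentiable_on M" for a b
    by (intro differentiable_on_mult V1 G_differentiable)
  have S3: "?S3 a b differentiable_on M" for a b
    unfolding divide_inverse
    by (intro differentiable_on_mult[OF \<phi>1] differentiable_on_diff T1 differentiable_on_mult
        G_differentiable contract_differentiable differentiable_on_const)
  have S4: "?S4 a b differentiable_on M" for a b
  proof -
    have "pd M a (wave_gauge_low M G b) differentiable_on M" for a b
      using v[of b] by (simp add: numeral_2_eq_2)
    then show ?thesis
      unfolding divide_inverse by (intro differentiable_on_mult differentiable_on_add differentiable_on_const)
  qed
  have "0 = reduced_div (\<lambda>a b y. ?S1 a b y + ?S2 a b y + ?S3 a b y + ?S4 a b y) b x"
    unfolding reduced_div_ricci[OF C3 x, of b, symmetric] by (rule reduced_div_congr[OF x ric])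
  also have "\<dots> = reduced_div ?S1 b x + reduced_div ?S2 b x + reduced_div ?S3 b x + reduced_div ?S4 b x"
    by (simp only: reduced_div_add[OF x] S1 S2 S3 S4 differentiable_on_add)
  also have "reduced_div ?S1 b x = 6 * ((reduced_wave M G \<rho> x - (\<Sum>d\<in>UNIV. wave_gauge M G d x * pd M d \<rho> x)) * pd M b \<rho> x)"
    unfolding reduced_div_cmult[OF x rr1] reduced_div_gradient[OF \<rho> x] ..
  also have "reduced_div ?S2 b x = - V' x * pd M b \<rho> x"
    unfolding reduced_div_metric[OF V1 x] V_pd by simp
  also have "reduced_div ?S3 b x = - ?\<phi> x * contract x (\<lambda>a c. T x $ a $ c) * pd M b \<rho> x"
  proof -
    have "reduced_div ?S3 b x = ?\<phi> x * divergence M G T b x + contract x (\<lambda>a c. pd M c ?\<phi> x * T x $ a $ b)"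
      by (rule reduced_div_matter[OF T1 \<phi>1 x T_sym[OF x]])
    also have "contract x (\<lambda>a c. pd M c ?\<phi> x * T x $ a $ b) = - 2 * ?\<phi> x * contract x (\<lambda>a c. pd M c \<rho> x * T x $ a $ b)"
      unfolding \<phi>_pd mult.assoc[of "- 2 * ?\<phi> x"] contract_linear ..
    finally show ?thesis
      unfolding matter[OF x] by (simp add: algebra_simps)
  qed
  also have "reduced_div ?S4 b x = (reduced_wave M G (wave_gauge_low M G b) x - (\<Sum>d\<in>UNIV. wave_gauge M G d x *
      (pd M d (wave_gauge_low M G b) x + pd M b (wave_gauge_low M G d) x))) / 2"
    by (rule reduced_div_gauge[OF v x])
  finally have "0 = (6 * reduced_wave M G \<rho> x - V' x - ?\<phi> x * contract x (\<lambda>a c. T x $ a $ c)) * pd M b \<rho> x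
      - 6 * (\<Sum>d\<in>UNIV. wave_gauge M G d x * pd M d \<rho> x) * pd M b \<rho> x
      + (reduced_wave M G (wave_gauge_low M G b) x - (\<Sum>d\<in>UNIV. wave_gauge M G d x *
      (pd M d (wave_gauge_low M G b) x + pd M b (wave_gauge_low M G d) x))) / 2"
    by (simp add: algebra_simps)
  then show ?thesis
    unfolding scalar[OF x] by simp
qed

text \<open>
  Linear wave systems are indexed by natural numbers, the gauge functions by \<^typ>\<open>4\<close>; the
  numbers below 4 represent the elements of this type, with \<open>4 = 0\<close>.
\<close>

lemma sum_of_nat_4: "(\<Sum>j<4. F (of_nat j :: 4)) = (\<Sum>d\<in>UNIV. F d :: real)"
proof -
  have "{..<4} = {0, 1, 2, 3 :: nat}" by auto
  moreover have "F 4 = F 0"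
    by (rule arg_cong[of 4 0]) simp
  ultimately show ?thesis by (simp add: sum_4)
qed

lemma of_nat_4_cases:
  fixes \<gamma> :: 4
  obtains j :: nat where "j < 4" "\<gamma> = of_nat j"
proof -
  have "(4 :: 4) = 0" by simp
  then have "\<gamma> = of_nat 1 \<or> \<gamma> = of_nat 2 \<or> \<gamma> = of_nat 3 \<or> \<gamma> = of_nat 0"
    using exhaust_4[of \<gamma>] by (simp only: of_nat_1 of_nat_0 of_nat_numeral)
  then show ?thesis
    using that[of 0] that[of 1] that[of 2] that[of 3] by auto
qed

text \<open>
  Read as a system in \<open>\<Gamma>\<^sub>b\<close>, the wave equation is linear: in the products of \<open>\<Gamma>\<^sup>d\<close> with \<open>\<partial>\<Gamma>\<close> the undifferentiated
  factor is taken as a known coefficient \<open>A\<close>, and in the remaining term \<open>\<Gamma>\<^sup>d = h\<^sup>d\<^sup>e \<Gamma>\<^sub>e\<close> gives the coefficient \<open>B\<close>.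
  The zero solution has the same Cauchy data.
\<close>

lemma gauge_vanishes:
  assumes C3: "tensor_Ck_on 3 M G" and \<rho>: "Ck_on 2 M \<rho>" and uniq: "linear_wave_uniqueness M G"
    and eq: "\<And>x b. x \<in> M \<Longrightarrow> reduced_wave M G (wave_gauge_low M G b) x =
      (\<Sum>d\<in>UNIV. wave_gauge M G d x * (pd M d (wave_gauge_low M G b) x + pd M b (wave_gauge_low M G d) x))
      + 12 * (\<Sum>d\<in>UNIV. wave_gauge M G d x * pd M d \<rho> x) * pd M b \<rho> x"
    and slice: "slice 0 \<subseteq> M"
    and init: "\<And>x b. x \<in> slice 0 \<Longrightarrow> wave_gauge_low M G b x = 0"
      "\<And>x b. x \<in> slice 0 \<Longrightarrow> pd M 0 (wave_gauge_low M G b) x = 0"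
    and x: "x \<in> M"
  shows "wave_gauge_low M G b x = 0"
proof -
  let ?v = "wave_gauge_low M G" and ?w = "wave_gauge M G"
  define A where "A b d \<alpha> y = - (if d = b then 1 else 0) * ?w \<alpha> y - (if \<alpha> = b then 1 else 0) * ?w d y"
    for b d \<alpha> :: 4 and y
  define B where "B b e y = - 12 * pd M b \<rho> y * (\<Sum>d\<in>UNIV. ginv y $ d $ e * pd M d \<rho> y)" for b e :: 4 and y
  have v2: "Ck_on 2 M (?v c)" and w0: "Ck_on 0 M (?w c)" for c
    using wave_gauge_Ck(2)[of 2 c] Ck_on_le[OF wave_gauge_Ck(1)[of 2 c], of 0] C3
    by (simp_all add: numeral_3_eq_3 numeral_2_eq_2)
  have h0: "Ck_on 0 M (\<lambda>y. ginv y $ a $ b)" and r0: "Ck_on 0 M (pd M a \<rho>)" for a b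
    using h_Ck[OF tensor_Ck_on_le[OF G_C2, of 0]] \<rho>
    by (simp_all add: tensor_Ck_on_def numeral_2_eq_2 differentiable_imp_continuous_on)
  have A0: "Ck_on 0 M (A b d \<alpha>)" for b d \<alpha>
    unfolding A_def[abs_def] by (intro Ck_on_intros w0)
  have B0: "Ck_on 0 M (B b e)" for b e
    unfolding B_def[abs_def] by (intro Ck_on_intros h0 r0)
  have sol: "reduced_wave M G (?v b) y + (\<Sum>d\<in>UNIV. \<Sum>\<alpha>\<in>UNIV. A b d \<alpha> y * pd M \<alpha> (?v d) y)
      + (\<Sum>e\<in>UNIV. B b e y * ?v e y) = 0" if y: "y \<in> M" for b y
  proof -
    have "(\<Sum>d\<in>UNIV. \<Sum>\<alpha>\<in>UNIV. A b d \<alpha> y * pd M \<alpha> (?v d) y) =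
        - (\<Sum>d\<in>UNIV. (if d = b then 1 else 0) * (\<Sum>\<alpha>\<in>UNIV. ?w \<alpha> y * pd M \<alpha> (?v d) y))
        - (\<Sum>d\<in>UNIV. (\<Sum>\<alpha>\<in>UNIV. (if \<alpha> = b then 1 else 0) * (?w d y * pd M \<alpha> (?v d) y)))"
      unfolding A_def left_diff_distrib sum_subtractf sum_distrib_left sum_negf[symmetric]
      by (simp only: mult_minus_left mult.assoc)
    moreover have "(\<Sum>e\<in>UNIV. B b e y * ?v e y) = - 12 * (\<Sum>d\<in>UNIV. ?w d y * pd M d \<rho> y) * pd M b \<rho> y"
    proof -
      have "(\<Sum>e\<in>UNIV. B b e y * ?v e y) =
          - 12 * pd M b \<rho> y * (\<Sum>e\<in>UNIV. \<Sum>d\<in>UNIV. ginv y $ d $ e * ?v e y * pd M d \<rho> y)"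
        by (simp add: B_def sum_distrib_left sum_distrib_right mult_ac)
      also have "(\<Sum>e\<in>UNIV. \<Sum>d\<in>UNIV. ginv y $ d $ e * ?v e y * pd M d \<rho> y) = (\<Sum>d\<in>UNIV. ?w d y * pd M d \<rho> y)"
        unfolding wave_gauge_eq[OF y] sum_distrib_right by (rule sum.swap)
      finally show ?thesis by simp
    qed
    ultimately show ?thesis
      unfolding eq[OF y] kronecker_sum distrib_left sum.distrib by simp
  qed
  let ?A = "\<lambda>i j. A (of_nat i) (of_nat j)" and ?B = "\<lambda>i j. B (of_nat i) (of_nat j)"
  have "linear_wave_solution M G 4 ?A ?B (\<lambda>_ _. 0) (\<lambda>i. ?v (of_nat i))"
    unfolding linear_wave_solution_def sum_of_nat_4[of "\<lambda>d. \<Sum>\<alpha>\<in>UNIV. A _ d \<alpha> _ * pd M \<alpha> (?v d) _"]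
      sum_of_nat_4[of "\<lambda>d. B _ d _ * ?v d _"] reduced_wave_def[symmetric]
    using v2 sol by blast
  moreover have "linear_wave_solution M G 4 ?A ?B (\<lambda>_ _. 0) (\<lambda>i y. 0)"
  proof -
    have "pd M a (pd M b (\<lambda>y. 0)) y = 0" if "y \<in> M" for a b y
      using pd_congr[OF that, of "pd M b (\<lambda>y. 0)" "\<lambda>y. 0" a] by (simp add: pd_within_const that)
    then show ?thesis
      unfolding linear_wave_solution_def by (simp add: pd_within_const Ck_on_const)
  qed
  moreover have "pd M 0 (\<lambda>y. 0) y = 0" if "y \<in> slice 0" for y
    using that slice pd_within_const by blast
  ultimately have zero: "\<forall>i<4. \<forall>x\<in>M. ?v (of_nat i) x = 0"
    using uniq[unfolded linear_wave_uniqueness_def, rule_format,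
        of 4 ?B ?A "\<lambda>_ _. 0" "\<lambda>i. ?v (of_nat i)" "\<lambda>i y. 0"] A0 B0 init by simp
  obtain i where "i < 4" "b = of_nat i" by (rule of_nat_4_cases)
  with zero x show ?thesis by blast
qed

lemma pd_zero_along_axis:
  assumes x: "x \<in> M" and u: "u differentiable_on M"
    and line: "\<And>t. x + t *\<^sub>R axis a 1 \<in> M" "\<And>t. u (x + t *\<^sub>R axis a 1) = 0"
  shows "pd M a u x = 0"
proof -
  obtain u' where u': "(u has_derivative u') (at x within M)" "pd M a u x = u' (axis a 1)"
    using pd_works[OF x u] by metis
  have "((\<lambda>t. x + t *\<^sub>R axis a 1) has_derivative (\<lambda>t. t *\<^sub>R axis a 1)) (at (0 :: real))"
    by (auto intro!: derivative_eq_intros)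
  moreover have "(u has_derivative u') (at (x + 0 *\<^sub>R axis a 1) within range (\<lambda>t. x + t *\<^sub>R axis a 1))"
    using has_derivative_subset[OF u'(1), of "range (\<lambda>t. x + t *\<^sub>R axis a 1)"] line(1)
    by (simp add: image_subset_iff)
  ultimately have "((\<lambda>t. u (x + t *\<^sub>R axis a 1)) has_derivative (\<lambda>t. u' (t *\<^sub>R axis a 1))) (at (0 :: real))"
    by (rule has_derivative_in_compose)
  then have "((\<lambda>t. 0) has_derivative (\<lambda>t. u' (t *\<^sub>R axis a 1))) (at (0 :: real))"
    by (simp only: line(2))
  then have "(\<lambda>t. u' (t *\<^sub>R axis a 1)) = (\<lambda>t :: real. 0)"
    using has_derivative_unique has_derivative_const by blast
  then have "u' (1 *\<^sub>R axis a 1) = 0" by metis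
  then show ?thesis using u'(2) by simp
qed

text \<open>
  Undoing the trace reversal, \<open>D\<close> is \<open>k\<close> times the trace-reversed \<open>P\<close>. As \<open>e\<close> is orthogonal to the slice, the
  momentum constraint contains no trace term and gives \<open>P\<^sub>0\<^sub>j = 0\<close>. Only \<open>P\<^sub>0\<^sub>0\<close> is left, so the trace of \<open>P\<close>
  is \<open>h\<^sup>0\<^sup>0 P\<^sub>0\<^sub>0\<close>; since \<open>h\<^sup>0\<^sup>0 g(e, e) = 1\<close>, the Hamiltonian constraint reads \<open>P\<^sub>0\<^sub>0 - P\<^sub>0\<^sub>0 / 2 = 0\<close>.
\<close>

lemma constraints_imply_gauge_derivative:
  assumes x: "x \<in> M" and P_sym: "\<And>a b. P a b = P b a" and P_tang: "\<And>i j. i \<noteq> 0 \<Longrightarrow> j \<noteq> 0 \<Longrightarrow> P i j = 0"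
    and e0: "e $ 0 = 1" and orth: "\<And>j. j \<noteq> 0 \<Longrightarrow> bil (G x) e (axis j 1) = 0"
    and D: "\<And>a b. D $ a $ b - G x $ a $ b * contract x (\<lambda>a b. D $ a $ b) / 2 = k * P a b" and k: "k \<noteq> 0"
    and ham: "bil D e e = 0" and mom: "\<And>j. j \<noteq> 0 \<Longrightarrow> bil D e (axis j 1) = 0"
  shows "P a b = 0"
proof -
  have bil_axis: "bil A v (axis j 1) = (\<Sum>a\<in>UNIV. A $ a $ j * v $ a)" for A v j
    unfolding bil_def by (rule sum.cong[OF refl]) (simp add: axis_def if_distrib[of "\<lambda>t. _ * t"] cong: if_cong)
  have split0: "(\<Sum>a\<in>UNIV. F a) = F 0" if "\<And>a. a \<noteq> 0 \<Longrightarrow> F a = 0" for F :: "4 \<Rightarrow> real"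
    by (rule sum.remove[of UNIV 0 F, THEN trans]) (simp_all add: that)
  define p where "p = contract x P"
  have "contract x (\<lambda>a b. D $ a $ b - G x $ a $ b * contract x (\<lambda>a b. D $ a $ b) / 2) = k * p"
    unfolding D p_def by (rule contract_linear)
  then have "contract x (\<lambda>a b. D $ a $ b) = - k * p"
    by (simp add: contract_linear contract_G[OF x])
  then have D': "D $ a $ b = k * P a b - (k * p / 2) * G x $ a $ b" for a b
    using D[of a b] by (simp add: field_simps)
  have bilD: "bil D v w = k * (\<Sum>a\<in>UNIV. \<Sum>b\<in>UNIV. P a b * v $ a * w $ b) - (k * p / 2) * bil (G x) v w" for v w
    unfolding bil_def D' by (simp add: algebra_simps sum_subtractf sum_distrib_left)
  have P0: "P 0 j = 0" if j: "j \<noteq> 0" for j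
  proof -
    have "k * (\<Sum>a\<in>UNIV. P a j * e $ a) = bil D e (axis j 1)"
      unfolding bilD orth[OF j] by (simp add: axis_def if_distrib[of "\<lambda>t. _ * t"] cong: if_cong)
    moreover have "(\<Sum>a\<in>UNIV. P a j * e $ a) = P 0 j"
      by (subst split0) (use P_tang[OF _ j] e0 in auto)
    ultimately show ?thesis using mom[OF j] k by simp
  qed
  have off: "P a b = 0" if "a \<noteq> 0 \<or> b \<noteq> 0" for a b
    using that P0[of b] P0[of a] P_sym[of a b] P_tang[of a b] by (cases "a = 0"; cases "b = 0") auto
  have Pvw: "(\<Sum>a\<in>UNIV. \<Sum>b\<in>UNIV. P a b * F a b) = P 0 0 * F 0 0" for F
  proof -
    have "(\<Sum>b\<in>UNIV. P a b * F a b) = P a 0 * F a 0" for a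
      by (rule split0) (simp add: off)
    then show ?thesis by (simp only:) (rule split0, simp add: off)
  qed
  have p: "p = P 0 0 * ginv x $ 0 $ 0"
    using Pvw[of "\<lambda>a b. ginv x $ a $ b"] by (simp add: p_def contract_def mult.commute)
  \<comment> \<open>The covector of the normal e is a multiple of dt, namely \<open>\<kappa> dt\<close> with \<open>\<kappa> = g(e, e)\<close>.\<close>
  define \<kappa> where "\<kappa> = bil (G x) e (axis 0 1)"
  have Ge: "(\<Sum>a\<in>UNIV. G x $ a $ b * e $ a) = (if b = 0 then 1 else 0) * \<kappa>" for b
    using orth[of b] by (auto simp: \<kappa>_def bil_axis)
  have "bil (G x) e e = (\<Sum>b\<in>UNIV. (\<Sum>a\<in>UNIV. G x $ a $ b * e $ a) * e $ b)"
    unfolding bil_def sum_distrib_right by (rule sum.swap)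
  also have "\<dots> = \<kappa>"
    unfolding Ge mult.assoc kronecker_sum by (simp add: e0)
  finally have Gee: "bil (G x) e e = \<kappa>" .
  have "1 = (\<Sum>a\<in>UNIV. (if 0 = a then 1 else 0) * e $ a)"
    unfolding kronecker_sum e0 ..
  also have "\<dots> = (\<Sum>a\<in>UNIV. \<Sum>b\<in>UNIV. ginv x $ 0 $ b * G x $ b $ a * e $ a)"
    unfolding h_G_nth(1)[OF x, symmetric] sum_distrib_right ..
  also have "\<dots> = (\<Sum>b\<in>UNIV. ginv x $ 0 $ b * (\<Sum>a\<in>UNIV. G x $ a $ b * e $ a))"
    unfolding sum_distrib_left by (subst sum.swap) (simp only: G_sym[OF x] mult.assoc)
  also have "\<dots> = ginv x $ 0 $ 0 * \<kappa>"
    unfolding Ge mult.left_commute[of _ "if _ then _ else _"] kronecker_sum ..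
  finally have h\<kappa>: "ginv x $ 0 $ 0 * \<kappa> = 1" by simp
  have "k * P 0 0 - (k * p / 2) * \<kappa> = 0"
    using ham Pvw[of "\<lambda>a b. e $ a * e $ b"] unfolding bilD Gee by (simp add: e0 mult.assoc)
  then have "k * (P 0 0 - P 0 0 * (ginv x $ 0 $ 0 * \<kappa>) / 2) = 0"
    unfolding p by (simp add: algebra_simps)
  then have "P 0 0 = 0"
    unfolding h\<kappa> using k by simp
  then show ?thesis using off[of a b] by blast
qed

end


section \<open>The reduced system solves the conformal field equations\<close>

lemma lorentzianD:
  assumes "lorentzian A"
  shows "transpose A = A" "invertible A"
proof -
  show "transpose A = A" using assms by (simp add: lorentzian_def)
  obtain P :: "real^4^4" where P: "transpose P ** A ** P = (\<chi> \<alpha> \<beta>. if \<alpha> = \<beta> then (if \<alpha> = 0 then -1 else 1) else 0)"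
    using assms by (auto simp: lorentzian_def)
  have "det (transpose P ** A ** P) \<noteq> 0"
    unfolding P by (subst det_diagonal) simp_all
  then show "invertible A"
    by (simp add: det_mul invertible_det_nz)
qed

theorem proposition5p7:
  fixes t_max :: ereal and M :: "(real^4) set"
    and I :: "real set" and f :: "real \<Rightarrow> real"
    and gd g T N :: "real^4 \<Rightarrow> real^4^4" and \<rho> :: "real^4 \<Rightarrow> real"
    and shift :: "real^4 \<Rightarrow> 4 \<Rightarrow> real"
  assumes I: "is_interval I" "open I" "0 \<in> I"
    and f: "smooth_convex_increasing_on I f"
    and M: "0 < t_max" "M = slab t_max"
    and regularity: "tensor_Ck_on 3 M gd" "tensor_Ck_on 1 M T" "Ck_on 2 M \<rho>"
    and lorentz: "\<forall>x\<in>M. lorentzian (gd x)"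
    and slices: "\<forall>t. 0 \<le> t \<and> ereal t < t_max \<longrightarrow>
                   spacelike_slice gd t \<and> cauchy_hypersurface M gd (slice t)"
    and glob_hyp: "globally_hyperbolic M gd"
    and wave_uniqueness: "linear_wave_uniqueness M gd"
    and T_sym: "\<forall>x\<in>M. transpose (T x) = T x"
    and \<rho>_range: "\<forall>x\<in>M. \<rho> x \<in> s_map f ` I"
    and g: "\<forall>x. g x = exp (- 2 * \<rho> x) *\<^sub>R gd x"
    and metric_eq: "\<forall>x\<in>M. \<forall>\<alpha> \<beta>. reduced_wave M gd (\<lambda>y. gd y $ \<alpha> $ \<beta>) x =
          F_field M gd \<alpha> \<beta> x - 12 * pd M \<alpha> \<rho> x * pd M \<beta> \<rho> x
          + W2 I f (\<rho> x) / exp (2 * \<rho> x) * gd x $ \<alpha> $ \<beta>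
          - 16 * pi / exp (2 * \<rho> x) * (T x $ \<alpha> $ \<beta> - g x $ \<alpha> $ \<beta> * tr (g x) (T x) / 2)"
    and matter_eq: "\<forall>x\<in>M. \<forall>\<beta>. divergence M gd T \<beta> x =
          exp (- 2 * \<rho> x) *
            (2 * (\<Sum>\<delta>\<in>UNIV. \<Sum>\<gamma>\<in>UNIV. matrix_inv (g x) $ \<delta> $ \<gamma> * pd M \<gamma> \<rho> x * T x $ \<delta> $ \<beta>)
             - tr (g x) (T x) * pd M \<beta> \<rho> x)"
    and scalar_eq: "\<forall>x\<in>M. reduced_wave M gd \<rho> x =
          W2 I f (\<rho> x) / (6 * exp (2 * \<rho> x)) + f (theta I f (\<rho> x)) / (6 * exp (4 * \<rho> x))
          + 4 * pi * tr (g x) (T x) / (3 * exp (4 * \<rho> x))"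
    and N: "\<forall>x\<in>M. \<forall>\<alpha> \<beta>. N x $ \<alpha> $ \<beta> - g x $ \<alpha> $ \<beta> * tr (g x) (N x) / 2 =
          exp (2 * \<rho> x) * ricci M gd \<alpha> \<beta> x - 6 * exp (2 * \<rho> x) * pd M \<alpha> \<rho> x * pd M \<beta> \<rho> x
          + gd x $ \<alpha> $ \<beta> * W2 I f (\<rho> x) / 2"
    and shift: "\<forall>x\<in>slice 0. \<forall>j\<in>{1, 2, 3}. bil (gd x) (adapted_e0 (shift x)) (axis j 1) = 0"
    and hamiltonian: "\<forall>x\<in>slice 0. bil (N x) (adapted_e0 (shift x)) (adapted_e0 (shift x)) =
          8 * pi * bil (T x) (adapted_e0 (shift x)) (adapted_e0 (shift x))"
    and momentum: "\<forall>x\<in>slice 0. \<forall>j\<in>{1, 2, 3}. bil (N x) (adapted_e0 (shift x)) (axis j 1) =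
          8 * pi * bil (T x) (adapted_e0 (shift x)) (axis j 1)"
    and gauge: "\<forall>x\<in>slice 0. \<forall>\<gamma>. wave_gauge M gd \<gamma> x = 0"
  shows "(\<forall>x\<in>M. \<forall>\<gamma>. wave_gauge M gd \<gamma> x = 0) \<and>
    (\<forall>x\<in>M. scalar_curvature M g x \<in> I \<and> \<rho> x = ln (deriv f (scalar_curvature M g x)) / 2) \<and>
    (\<forall>x\<in>M. \<forall>\<alpha> \<beta>.
          exp (2 * \<rho> x) * ricci M gd \<alpha> \<beta> x - 6 * exp (2 * \<rho> x) * pd M \<alpha> \<rho> x * pd M \<beta> \<rho> x
          + gd x $ \<alpha> $ \<beta> * W2 I f (\<rho> x) / 2 =
          8 * pi * (T x $ \<alpha> $ \<beta> - g x $ \<alpha> $ \<beta> * tr (g x) (T x) / 2))"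
proof -
  interpret regular_domain M
    unfolding M(2) by (rule regular_domain_slab[OF M(1)])
  interpret metric_domain M gd
  proof
    show "tensor_Ck_on 2 M gd"
      by (rule tensor_Ck_on_le[OF regularity(1)]) simp
  qed (use lorentz lorentzianD in blast)+
  let ?v = "wave_gauge_low M gd" and ?r = "\<lambda>a. pd M a \<rho>" and ?E = "\<lambda>y. exp (2 * \<rho> y)"
    and ?\<tau> = "\<lambda>y. contract y (\<lambda>a c. T y $ a $ c)" and ?\<theta> = "\<lambda>y. theta I f (\<rho> y)" and ?W = "\<lambda>y. W2 I f (\<rho> y)"
  define P where "P a b y = (pd M a (?v b) y + pd M b (?v a) y) / 2" for a b y
  have exps: "exp (- 2 * \<rho> y) = inverse (?E y)" "exp (4 * \<rho> y) = ?E y * ?E y" for y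
    by (simp_all add: exp_minus exp_add[symmetric])
  have slice_M: "slice 0 \<subseteq> M"
    using M by (auto simp: slice_def slab_def zero_ereal_def)
  have T_sym': "T y $ a $ b = T y $ b $ a" if "y \<in> M" for y a b
    using T_sym that by (metis transpose_nth)
  have g_inv: "matrix_inv (g y) = ?E y *\<^sub>R ginv y" if "y \<in> M" for y
    using matrix_inv_scaleR[OF that, of "exp (- 2 * \<rho> y)"] by (simp add: g exp_minus)
  have tr_g: "tr (g y) S = ?E y * contract y (\<lambda>a c. S $ a $ c)" if "y \<in> M" for y S
    by (simp add: tr_def contract_def g_inv[OF that] sum_distrib_left mult.assoc)
  have g_tr: "g y $ a $ b * tr (g y) S = gd y $ a $ b * contract y (\<lambda>a c. S $ a $ c)" if "y \<in> M" for y a b S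
    unfolding tr_g[OF that] by (simp add: g exp_minus)

  \<comment> \<open>Decompose the Ricci tensor and insert the reduced equation: the field equation with error P.\<close>
  have ric: "ricci M gd a b y = 6 * (?r a y * ?r b y) + (- ?W y / (2 * ?E y)) * gd y $ a $ b
      + 8 * pi * exp (- 2 * \<rho> y) * (T y $ a $ b - gd y $ a $ b * ?\<tau> y / 2) + P a b y"
    if y: "y \<in> M" for y a b
    unfolding ricci_decomposition[OF y] metric_eq[rule_format, OF y] g_tr[OF y] exps P_def
    by (simp add: field_simps)
  have residual: "?E y * ricci M gd a b y - 6 * ?E y * ?r a y * ?r b y + gd y $ a $ b * ?W y / 2 =
      8 * pi * (T y $ a $ b - gd y $ a $ b * ?\<tau> y / 2) + ?E y * P a b y" if y: "y \<in> M" for y a b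
    unfolding ric[OF y] exps by (simp add: field_simps)
  have W: "(W2 I f has_real_derivative - 2 * f (?\<theta> y) / ?E y) (at (\<rho> y))" "?W y = f (?\<theta> y) / ?E y - ?\<theta> y"
    "?\<theta> y \<in> I" "\<rho> y = ln (deriv f (?\<theta> y)) / 2" if "y \<in> M" for y
    using W2_facts[OF f I(1,2), of "\<rho> y"] \<rho>_range that by auto
  have scalar: "6 * reduced_wave M gd \<rho> y = (f (?\<theta> y) / (?E y * ?E y) + ?W y / ?E y)
      + 8 * pi * exp (- 2 * \<rho> y) * ?\<tau> y" if y: "y \<in> M" for y
    unfolding scalar_eq[rule_format, OF y] tr_g[OF y] exps by (simp add: field_simps)
  have matter: "divergence M gd T b y = 2 * contract y (\<lambda>a c. ?r c y * T y $ a $ b) - ?\<tau> y * ?r b y"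
    if y: "y \<in> M" for y b
  proof -
    have "(\<Sum>\<delta>\<in>UNIV. \<Sum>\<gamma>\<in>UNIV. matrix_inv (g y) $ \<delta> $ \<gamma> * ?r \<gamma> y * T y $ \<delta> $ b) =
        ?E y * contract y (\<lambda>a c. ?r c y * T y $ a $ b)"
      by (simp add: g_inv[OF y] contract_def sum_distrib_left mult_ac)
    then show ?thesis
      unfolding matter_eq[rule_format, OF y] tr_g[OF y] exps by (simp add: field_simps)
  qed
  \<comment> \<open>The potential in the decomposition is \<open>V(s) = - W\<^sub>2(s) / (2 e\<^sup>2\<^sup>s)\<close>.\<close>
  have dV: "((\<lambda>s. - W2 I f s / (2 * exp (2 * s))) has_real_derivative
      f (?\<theta> y) / (?E y * ?E y) + ?W y / ?E y) (at (\<rho> y))" if y: "y \<in> M" for y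
    by (rule derivative_eq_intros W(1)[OF y] refl | simp)+ (simp add: field_simps)
  have wave: "reduced_wave M gd (?v b) y =
      (\<Sum>d\<in>UNIV. wave_gauge M gd d y * (pd M d (?v b) y + pd M b (?v d) y))
      + 12 * (\<Sum>d\<in>UNIV. wave_gauge M gd d y * ?r d y) * ?r b y" if y: "y \<in> M" for y b
    by (rule gauge_wave_equation[OF regularity(1,3,2) T_sym' dV ric[unfolded P_def] matter scalar y])

  have init: "?v b x = 0" if "x \<in> slice 0" for x b
    using gauge that by (simp add: wave_gauge_low_def)
  have v1: "?v b differentiable_on M" for b
    using wave_gauge_Ck(2)[of 2 b] regularity(1) by (simp add: numeral_3_eq_3 numeral_2_eq_2)
  \<comment> \<open>The gauge functions vanish on the whole slice, so tangential derivatives vanish too.\<close>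
  have tang: "pd M i (?v b) x = 0" if x: "x \<in> slice 0" and i: "i \<noteq> 0" for x b i
  proof (rule pd_zero_along_axis)
    have "x + t *\<^sub>R axis i 1 \<in> slice 0" for t
      using x i by (simp add: slice_def axis_def)
    then show "x + t *\<^sub>R axis i 1 \<in> M" "?v b (x + t *\<^sub>R axis i 1) = 0" for t
      using slice_M init by blast+
  qed (use x slice_M v1 in blast)+
  have P0: "P a b x = 0" if x: "x \<in> slice 0" for x a b
  proof -
    let ?e = "adapted_e0 (shift x)" and ?D = "N x - (8 * pi) *\<^sub>R T x"
    have xM: "x \<in> M" using x slice_M by blast
    have nonzero: "j \<in> {1, 2, 3}" if "j \<noteq> 0" for j :: 4
      using exhaust_4[of j] that by auto
    have bil_diff: "bil (A - k *\<^sub>R B) v w = bil A v w - k * bil B v w" for A B :: "real^4^4" and k v w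
      by (simp add: bil_def algebra_simps sum_subtractf sum_distrib_left)
    show ?thesis
    proof (rule constraints_imply_gauge_derivative[OF xM, where e = ?e and D = ?D and k = "?E x"])
      show "P a b x = P b a x" for a b by (simp add: P_def add.commute)
      show "P i j x = 0" if "i \<noteq> 0" "j \<noteq> 0" for i j
        using tang[OF x] that by (simp add: P_def)
      show "?e $ 0 = 1" by (simp add: adapted_e0_def axis_def)
      show "bil (gd x) ?e (axis j 1) = 0" if "j \<noteq> 0" for j
        using shift x nonzero[OF that] by blast
      show "bil ?D ?e (axis j 1) = 0" if "j \<noteq> 0" for j
        unfolding bil_diff momentum[rule_format, OF x nonzero[OF that]] by simp
      show "bil ?D ?e ?e = 0"
        unfolding bil_diff hamiltonian[rule_format, OF x] by simp
      show "?D $ a $ b - gd x $ a $ b * contract x (\<lambda>a b. ?D $ a $ b) / 2 = ?E x * P a b x" for a b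
      proof -
        have "N x $ a $ b - gd x $ a $ b * contract x (\<lambda>a b. N x $ a $ b) / 2 =
            8 * pi * (T x $ a $ b - gd x $ a $ b * ?\<tau> x / 2) + ?E x * P a b x"
          using N[rule_format, OF xM, of a b] unfolding g_tr[OF xM] residual[OF xM] .
        then show ?thesis
          by (simp add: contract_linear algebra_simps diff_divide_distrib)
      qed
    qed simp
  qed
  have init': "pd M 0 (?v b) x = 0" if x: "x \<in> slice 0" for x b
    using P0[OF x, of 0 b] tang[OF x, of b 0] by (cases "b = 0") (simp_all add: P_def)
  have v0: "?v b x = 0" if "x \<in> M" for x b
    by (rule gauge_vanishes[OF regularity(1,3) wave_uniqueness wave slice_M init init' that])
  have gauge0: "wave_gauge M gd c x = 0" if "x \<in> M" for x c
    by (simp add: wave_gauge_eq[OF that] v0[OF that])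
  have P_zero: "P a b x = 0" if "x \<in> M" for x a b
  proof -
    have "pd M i (?v j) x = 0" for i j
      using pd_congr[OF that, of "?v j" "\<lambda>y. 0" i] v0 pd_within_const[OF that] by simp
    then show ?thesis by (simp add: P_def)
  qed
  have field: "?E x * ricci M gd a b x - 6 * ?E x * ?r a x * ?r b x + gd x $ a $ b * ?W x / 2 =
      8 * pi * (T x $ a $ b - g x $ a $ b * tr (g x) (T x) / 2)" if x: "x \<in> M" for x a b
    unfolding residual[OF x] P_zero[OF x] g_tr[OF x] by simp
  have R: "scalar_curvature M g x = ?\<theta> x" if x: "x \<in> M" for x
  proof -
    have "scalar_curvature M g x = ?E x * (contract x (\<lambda>a b. ricci M gd a b x) + 6 * reduced_wave M gd \<rho> x
        - 6 * contract x (\<lambda>a b. ?r a x * ?r b x))"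
      using scalar_curvature_conformal[OF regularity(3) _ x, of g] g gauge0[OF x] by simp
    also have "contract x (\<lambda>a b. ricci M gd a b x) = 6 * contract x (\<lambda>a b. ?r a x * ?r b x)
        - 2 * ?W x / ?E x - 8 * pi * exp (- 2 * \<rho> x) * ?\<tau> x"
      unfolding ric[OF x] P_zero[OF x] add_0_right contract_linear contract_G[OF x] by (simp add: field_simps)
    also have "?E x * (\<dots> + 6 * reduced_wave M gd \<rho> x - 6 * contract x (\<lambda>a b. ?r a x * ?r b x)) =
        - ?W x + f (?\<theta> x) / ?E x"
      unfolding scalar[OF x] by (simp add: field_simps)
    finally show ?thesis by (simp add: W(2)[OF x])
  qed
  show ?thesis
    using gauge0 field R W(3,4) by simp
qed

end
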